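(* Let $\Omega \subset \mathbb{C}^n$ be a $C^\infty$-smooth, bounded pseudoconvex domain with boundary $b\Omega$. If the Hausdorff two-dimensional measure of the support $S_{\mathfrak{C}(\mathcal{N})}$ of the Levi core of $b\Omega$ is zero, then Property ($P$) holds for $b\Omega$.
   Context: **Property ($P$).** A compact set $K \subset \mathbb{C}^n$ satisfies Property ($P$) if for every $M>0$ there are a neighborhood $U$ of $K$ and a function $\lambda_M \in C^2(U)$ with $0 \le \lambda_M \le 1$ such that $\sum_{j,k=1}^n \frac{\partial^2 \lambda_M}{\partial z_j \partial \overline{z}_k}(z)\, w_j \overline{w}_k \ge M|w|^2$ for all $z \in U$, $w \in \mathbb{C}^n$. **Distributions and supports.** A complex distribution $\mathcal{D}=\{\mathcal{D}_p\}_{p\in b\Omega}$ on the smooth manifold $b\Omega$ assigns to each $p$ a complex linear subspace $\mathcal{D}_p$ of the complexified tangent space $\mathbb{C}T_p b\Omega$ (no constancy of dimension is required). Its support is $S_{\mathcal{D}}=\{p\in b\Omega : \dim \mathcal{D}_p>0\}$. **Levi null distribution.** $\mathcal{N}=\{\mathcal{N}_p\}_{p\in b\Omega}$, where $\mathcal{N}_p$ is the space of Levi null vectors at $p$, i.e. the vectors $X=\sum_{k=1}^n a_k\,\partial/\partial z_k|_p$ of type $(1,0)$ tangent to $b\Omega$ at $p$ that lie in the kernel of the Levi form of $b\Omega$ at $p$ (by pseudoconvexity, equivalently, those on which the Levi form vanishes). **$C^\infty$-Zariski tangent space.** For a subset $A$ of a smooth manifold $M$ and $p \in M$, $T_pA=\{X_p\in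 T_pM : X_pf=0 \text{ for all real-valued } f\in C^\infty(M) \text{ with } f|_A\equiv 0\}$, and $\mathbb{C}T_pA$ is its complexification. Here $M=b\Omega$. **Derived distributions and Levi core.** Define by transfinite recursion, for each $p \in b\Omega$: $\mathcal{N}^0_p=\mathcal{N}_p$; $\mathcal{N}^{\alpha}_p=\mathcal{N}^{\alpha-1}_p\cap \mathbb{C}T_pS_{\mathcal{N}^{\alpha-1}}$ if $\alpha$ is a successor ordinal; $\mathcal{N}^\alpha_p=\bigcap_{\beta<\alpha}\mathcal{N}^\beta_p$ if $\alpha$ is a limit ordinal. This sequence stabilizes: there is a countable ordinal $\gamma$ with $\mathcal{N}^\gamma=\mathcal{N}^\eta$ for all $\eta\ge\gamma$. The Levi core is $\mathfrak{C}(\mathcal{N})=\mathcal{N}^\gamma$, and $S_{\mathfrak{C}(\mathcal{N})}$ is its support, a compact subset of $b\Omega$. *)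

theory Defs
  imports "HOL-Analysis.Analysis"
begin

section \<open>Smooth functions\<close>

text \<open>Meant for open \<open>S\<close> in a finite-dimensional space, where a function is \<open>C\<^sup>k\<^sup>+\<^sup>1\<close> iff it is
  differentiable and all its directional derivatives are \<open>C\<^sup>k\<close>.\<close>

primrec Ck_on :: "nat \<Rightarrow> ('a::real_normed_vector \<Rightarrow> 'b::real_normed_vector) \<Rightarrow> 'a set \<Rightarrow> bool" where
  "Ck_on 0 f S \<longleftrightarrow> continuous_on S f"
| "Ck_on (Suc k) f S \<longleftrightarrow>
     (\<forall>x\<in>S. f differentiable (at x)) \<and>
     (\<forall>v. Ck_on k (\<lambda>x. frechet_derivative f (at x) v) S)"

definition smooth_on :: "('a::real_normed_vector \<Rightarrow> 'b::real_normed_vector) \<Rightarrow> 'a set \<Rightarrow> bool" where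
  "smooth_on f S \<longleftrightarrow> (\<forall>k. Ck_on k f S)"


section \<open>Complex derivatives and the complex Hessian\<close>

definition wirt_dz :: "'n::finite \<Rightarrow> (complex^'n \<Rightarrow> complex) \<Rightarrow> complex^'n \<Rightarrow> complex" where
  "wirt_dz k f z =
     (frechet_derivative f (at z) (axis k 1) - \<i> * frechet_derivative f (at z) (axis k \<i>)) / 2"

definition wirt_dzbar :: "'n::finite \<Rightarrow> (complex^'n \<Rightarrow> complex) \<Rightarrow> complex^'n \<Rightarrow> complex" where
  "wirt_dzbar k f z =
     (frechet_derivative f (at z) (axis k 1) + \<i> * frechet_derivative f (at z) (axis k \<i>)) / 2"

definition complex_hessian ::
    "(complex^'n::finite \<Rightarrow> real) \<Rightarrow> complex^'n \<Rightarrow> complex^'n \<Rightarrow> complex^'n \<Rightarrow> complex" where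
  "complex_hessian f z a b =
     (\<Sum>j\<in>UNIV. \<Sum>k\<in>UNIV. wirt_dz j (wirt_dzbar k (\<lambda>x. complex_of_real (f x))) z * a $ j * cnj (b $ k))"


section \<open>Property (P)\<close>

text \<open>For a real \<open>C\<^sup>2\<close> function the matrix of \<open>complex_hessian\<close> is Hermitian, so its quadratic form is
  real and \<open>Re\<close> discards nothing.\<close>

definition property_P :: "(complex^'n::finite) set \<Rightarrow> bool" where
  "property_P K \<longleftrightarrow> compact K \<and>
     (\<forall>M>0::real. \<exists>U g. open U \<and> K \<subseteq> U \<and> Ck_on 2 g U \<and>
        (\<forall>z\<in>U. 0 \<le> g z \<and> g z \<le> 1) \<and>
        (\<forall>z\<in>U. \<forall>w. Re (complex_hessian g z w w) \<ge> M * (norm w)\<^sup>2))"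


section \<open>Hausdorff measure\<close>

text \<open>No normalizing constant is included. The guard for empty sets only matters for \<open>d = 0\<close>.\<close>

definition hausdorff_premeasure :: "nat \<Rightarrow> real \<Rightarrow> 'a::metric_space set \<Rightarrow> ennreal" where
  "hausdorff_premeasure d \<delta> A =
     (INF C \<in> {C :: nat \<Rightarrow> 'a set. A \<subseteq> (\<Union>i. C i) \<and> (\<forall>i. bounded (C i) \<and> diameter (C i) \<le> \<delta>)}.
        \<Sum>i. if C i = {} then 0 else ennreal (diameter (C i) ^ d))"

definition hausdorff_measure :: "nat \<Rightarrow> 'a::metric_space set \<Rightarrow> ennreal" where
  "hausdorff_measure d A = (SUP \<delta>\<in>{0<..}. hausdorff_premeasure d \<delta> A)"


section \<open>Smooth bounded domains and their tangent spaces\<close>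

definition local_defining_function ::
    "(complex^'n::finite) set \<Rightarrow> complex^'n \<Rightarrow> (complex^'n) set \<Rightarrow> (complex^'n \<Rightarrow> real) \<Rightarrow> bool" where
  "local_defining_function \<Omega> p U r \<longleftrightarrow>
     p \<in> frontier \<Omega> \<and> open U \<and> p \<in> U \<and> smooth_on r U \<and>
     \<Omega> \<inter> U = {z\<in>U. r z < 0} \<and>
     (\<forall>z\<in>U. frechet_derivative r (at z) \<noteq> (\<lambda>_. 0))"

definition smooth_bounded_domain :: "(complex^'n::finite) set \<Rightarrow> bool" where
  "smooth_bounded_domain \<Omega> \<longleftrightarrow>
     open \<Omega> \<and> connected \<Omega> \<and> \<Omega> \<noteq> {} \<and> bounded \<Omega> \<and>
     (\<forall>p\<in>frontier \<Omega>. \<exists>U r. local_defining_function \<Omega> p U r)"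

text \<open>Here, and in \<open>levi_null\<close> below, the choice of the local defining function is immaterial: two of them
  differ near \<open>p\<close> by a positive smooth factor, which rescales the differential on the boundary and the
  Levi form on \<open>(1,0)\<close> tangent vectors.\<close>

definition tangent_space :: "(complex^'n::finite) set \<Rightarrow> complex^'n \<Rightarrow> (complex^'n) set" where
  "tangent_space \<Omega> p =
     {v. \<exists>U r. local_defining_function \<Omega> p U r \<and> frechet_derivative r (at p) v = 0}"

text \<open>The pair \<open>(u, v)\<close> stands for the complexified vector \<open>u + iv\<close>.\<close>

type_synonym 'n ctangent = "(complex^'n) \<times> (complex^'n)"

definition complexify :: "(complex^'n::finite) set \<Rightarrow> 'n ctangent set" where
  "complexify V = V \<times> V"

text \<open>The vector \<open>\<Sum>\<^sub>k a\<^sub>k \<partial>/\<partial>z\<^sub>k\<close>; with \<open>\<partial>/\<partial>z\<^sub>k = (\<partial>/\<partial>x\<^sub>k - i \<partial>/\<partial>y\<^sub>k)/2\<close> its real and imaginary parts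
  are the real vectors \<open>a/2\<close> and \<open>-ia/2\<close>.\<close>

definition type10 :: "complex^'n::finite \<Rightarrow> 'n ctangent" where
  "type10 a = ((\<chi> k. a $ k / 2), (\<chi> k. - \<i> * a $ k / 2))"

lemma type10_action:
  fixes f :: "complex^'n::finite \<Rightarrow> real"
  assumes "f differentiable (at p)"
  shows "complex_of_real (frechet_derivative f (at p) (fst (type10 a))) +
           \<i> * complex_of_real (frechet_derivative f (at p) (snd (type10 a))) =
         (\<Sum>k\<in>UNIV. a $ k * wirt_dz k (\<lambda>z. complex_of_real (f z)) p)"
proof -
  let ?D = "frechet_derivative f (at p)"
  have D: "(f has_derivative ?D) (at p)"
    using assms frechet_derivative_works by blast
  then have lin: "linear ?D"
    by (rule has_derivative_linear)
  have DC: "frechet_derivative (\<lambda>z. complex_of_real (f z)) (at p) = (\<lambda>v. complex_of_real (?D v))"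
    using has_derivative_of_real[OF D] frechet_derivative_at by metis
  have expand: "?D (\<chi> k. c k) = (\<Sum>k\<in>UNIV. Re (c k) * ?D (axis k 1) + Im (c k) * ?D (axis k \<i>))"
    for c :: "'n \<Rightarrow> complex"
  proof -
    have "(\<chi> k. c k) = (\<Sum>k\<in>UNIV. Re (c k) *\<^sub>R axis k 1 + Im (c k) *\<^sub>R axis k \<i>)"
      by (simp add: vec_eq_iff axis_def complex_eq_iff if_distrib sum.delta cong: if_cong)
    then show ?thesis
      by (simp add: linear_sum[OF lin] linear_add[OF lin] linear_scale[OF lin])
  qed
  show ?thesis
    unfolding type10_def wirt_dz_def DC fst_conv snd_conv expand
    by (simp add: sum_distrib_left complex_eq_iff sum.distrib[symmetric])
       (intro conjI sum.cong refl; simp add: field_simps)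
qed

definition tangent10 :: "(complex^'n::finite) set \<Rightarrow> complex^'n \<Rightarrow> (complex^'n) set" where
  "tangent10 \<Omega> p = {a. type10 a \<in> complexify (tangent_space \<Omega> p)}"

definition levi_pseudoconvex :: "(complex^'n::finite) set \<Rightarrow> bool" where
  "levi_pseudoconvex \<Omega> \<longleftrightarrow>
     (\<forall>p U r. local_defining_function \<Omega> p U r \<longrightarrow>
        (\<forall>a\<in>tangent10 \<Omega> p. Re (complex_hessian r p a a) \<ge> 0))"


section \<open>Distributions on the boundary\<close>

type_synonym 'n distribution = "complex^'n \<Rightarrow> 'n ctangent set"

definition levi_null :: "(complex^'n::finite) set \<Rightarrow> 'n distribution" where
  "levi_null \<Omega> p =
     {type10 a | a. a \<in> tangent10 \<Omega> p \<and>
        (\<exists>U r. local_defining_function \<Omega> p U r \<and> (\<forall>b\<in>tangent10 \<Omega> p. complex_hessian r p a b = 0))}"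

text \<open>\<open>dim\<close> is the real dimension, which is twice the complex one on complex subspaces.\<close>

definition dist_support :: "(complex^'n::finite) set \<Rightarrow> 'n distribution \<Rightarrow> (complex^'n) set" where
  "dist_support \<Omega> D = {p \<in> frontier \<Omega>. dim (D p) > 0}"


section \<open>Zariski tangent spaces of subsets of the boundary\<close>

definition smooth_extension_at ::
    "(complex^'n::finite) set \<Rightarrow> (complex^'n \<Rightarrow> real) \<Rightarrow> complex^'n \<Rightarrow> (complex^'n) set \<Rightarrow>
     (complex^'n \<Rightarrow> real) \<Rightarrow> bool" where
  "smooth_extension_at M f p U F \<longleftrightarrow>
     open U \<and> p \<in> U \<and> smooth_on F U \<and> (\<forall>z\<in>U \<inter> M. F z = f z)"

definition smooth_on_submanifold :: "(complex^'n::finite) set \<Rightarrow> (complex^'n \<Rightarrow> real) \<Rightarrow> bool" where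
  "smooth_on_submanifold M f \<longleftrightarrow> (\<forall>p\<in>M. \<exists>U F. smooth_extension_at M f p U F)"

text \<open>A tangent vector \<open>v\<close> acts on a smooth function \<open>f\<close> on the boundary through any local smooth
  extension \<open>F\<close> of \<open>f\<close>; the value does not depend on \<open>F\<close>.\<close>

definition zariski_tangent_space ::
    "(complex^'n::finite) set \<Rightarrow> (complex^'n) set \<Rightarrow> complex^'n \<Rightarrow> (complex^'n) set" where
  "zariski_tangent_space \<Omega> A p =
     {v \<in> tangent_space \<Omega> p.
        \<forall>f. smooth_on_submanifold (frontier \<Omega>) f \<and> (\<forall>z\<in>A. f z = 0) \<longrightarrow>
          (\<forall>U F. smooth_extension_at (frontier \<Omega>) f p U F \<longrightarrow> frechet_derivative F (at p) v = 0)}"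


section \<open>Derived distributions and the Levi core\<close>

definition derived_dist :: "(complex^'n::finite) set \<Rightarrow> 'n distribution \<Rightarrow> 'n distribution" where
  "derived_dist \<Omega> D p = D p \<inter> complexify (zariski_tangent_space \<Omega> (dist_support \<Omega> D) p)"

text \<open>Ordinals are represented by the elements of the field of a (reflexive) well-order \<open>r\<close>;
  \<open>underS r i\<close> is the set of elements strictly below \<open>i\<close>.\<close>

definition immediate_pred :: "'i rel \<Rightarrow> 'i \<Rightarrow> 'i \<Rightarrow> bool" where
  "immediate_pred r j i \<longleftrightarrow> j \<in> underS r i \<and> (\<forall>k\<in>underS r i. (k, j) \<in> r)"

definition iterated_dist_step ::
    "'i rel \<Rightarrow> (complex^'n::finite) set \<Rightarrow> 'n distribution \<Rightarrow> ('i \<Rightarrow> 'n distribution) \<Rightarrow> 'i \<Rightarrow> 'n distribution"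
  where
  "iterated_dist_step r \<Omega> D f i =
     (if underS r i = {} then D
      else if \<exists>j. immediate_pred r j i then derived_dist \<Omega> (f (THE j. immediate_pred r j i))
      else (\<lambda>p. \<Inter>j\<in>underS r i. f j p))"

definition iterated_dist ::
    "'i rel \<Rightarrow> (complex^'n::finite) set \<Rightarrow> 'n distribution \<Rightarrow> 'i \<Rightarrow> 'n distribution" where
  "iterated_dist r \<Omega> D = wo_rel.worec r (iterated_dist_step r \<Omega> D)"

lemma the_immediate_pred:
  assumes "Well_order r" and "immediate_pred r j i"
  shows "(THE k. immediate_pred r k i) = j"
proof (rule the_equality)
  have "antisym r"
    using assms(1) by (simp add: wo_rel.ANTISYM wo_rel_def)
  then show "k = j" if "immediate_pred r k i" for k
    using that assms(2) unfolding immediate_pred_def by (blast dest: antisymD)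
qed (fact assms(2))

lemma iterated_dist_unfold:
  assumes "Well_order r"
  shows "iterated_dist r \<Omega> D i = iterated_dist_step r \<Omega> D (iterated_dist r \<Omega> D) i"
proof -
  have wo: "wo_rel r"
    using assms by (simp add: wo_rel_def)
  have "iterated_dist_step r \<Omega> D f i = iterated_dist_step r \<Omega> D g i"
    if "\<forall>j\<in>underS r i. f j = g j" for f g i
  proof (cases "\<exists>j. immediate_pred r j i")
    case True
    then obtain j where j: "immediate_pred r j i" by blast
    then have "f j = g j"
      using that by (simp add: immediate_pred_def)
    moreover have "underS r i \<noteq> {}"
      using j by (auto simp: immediate_pred_def)
    ultimately show ?thesis
      using True by (simp add: iterated_dist_step_def the_immediate_pred[OF assms j])
  qed (use that in \<open>auto simp: iterated_dist_step_def fun_eq_iff\<close>)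
  then have "wo_rel.adm_wo r (iterated_dist_step r \<Omega> D)"
    unfolding wo_rel.adm_wo_def[OF wo] by blast
  then show ?thesis
    unfolding iterated_dist_def by (metis wo_rel.worec_fixpoint[OF wo])
qed

lemma iterated_dist_zero:
  "Well_order r \<Longrightarrow> underS r i = {} \<Longrightarrow> iterated_dist r \<Omega> D i = D"
  by (simp add: iterated_dist_unfold iterated_dist_step_def)

lemma iterated_dist_succ:
  assumes "Well_order r" and j: "immediate_pred r j i"
  shows "iterated_dist r \<Omega> D i = derived_dist \<Omega> (iterated_dist r \<Omega> D j)"
proof -
  have "underS r i \<noteq> {}"
    using j by (auto simp: immediate_pred_def)
  moreover have "\<exists>j. immediate_pred r j i"
    using j by blast
  ultimately show ?thesis
    by (simp add: iterated_dist_unfold[OF assms(1), of \<Omega> D i] iterated_dist_step_def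
        the_immediate_pred[OF assms])
qed

lemma iterated_dist_limit:
  "Well_order r \<Longrightarrow> underS r i \<noteq> {} \<Longrightarrow> \<nexists>j. immediate_pred r j i \<Longrightarrow>
     iterated_dist r \<Omega> D i p = (\<Inter>j\<in>underS r i. iterated_dist r \<Omega> D j p)"
  by (subst iterated_dist_unfold) (auto simp: iterated_dist_step_def)

text \<open>The first uncountable cardinal, a well-order of type \<open>\<omega>\<^sub>1\<close>: the elements of its field are
  the countable ordinals.\<close>

abbreviation omega1 :: "nat set rel" where
  "omega1 \<equiv> cardSuc natLeq"

text \<open>The value at which the sequence of iterated derived distributions stabilizes.\<close>

definition dist_core :: "(complex^'n::finite) set \<Rightarrow> 'n distribution \<Rightarrow> 'n distribution" where
  "dist_core \<Omega> D =
     (THE C. \<exists>\<gamma>\<in>Field omega1. \<forall>\<eta>. (\<gamma>, \<eta>) \<in> omega1 \<longrightarrow> iterated_dist omega1 \<Omega> D \<eta> = C)"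

lemma dist_core_eqI:
  assumes "\<gamma> \<in> Field omega1"
    and "\<And>\<eta>. (\<gamma>, \<eta>) \<in> omega1 \<Longrightarrow> iterated_dist omega1 \<Omega> D \<eta> = iterated_dist omega1 \<Omega> D \<gamma>"
  shows "dist_core \<Omega> D = iterated_dist omega1 \<Omega> D \<gamma>"
  unfolding dist_core_def
proof (rule the_equality)
  have "Well_order omega1"
    using cardSuc_Card_order[OF natLeq_Card_order] card_order_on_well_order_on by blast
  then have wo: "wo_rel omega1"
    by (simp add: wo_rel_def)
  fix C
  assume "\<exists>\<gamma>\<in>Field omega1. \<forall>\<eta>. (\<gamma>, \<eta>) \<in> omega1 \<longrightarrow> iterated_dist omega1 \<Omega> D \<eta> = C"
  then obtain \<gamma>' where \<gamma>': "\<gamma>' \<in> Field omega1"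
    "\<And>\<eta>. (\<gamma>', \<eta>) \<in> omega1 \<Longrightarrow> iterated_dist omega1 \<Omega> D \<eta> = C" by blast
  have refl: "(\<gamma>, \<gamma>) \<in> omega1" "(\<gamma>', \<gamma>') \<in> omega1"
    using wo_rel.REFL[OF wo] assms(1) \<gamma>'(1) by (auto simp: refl_on_def)
  have "(\<gamma>, \<gamma>') \<in> omega1 \<or> (\<gamma>', \<gamma>) \<in> omega1"
    using wo_rel.TOTALS[OF wo] assms(1) \<gamma>'(1) by blast
  then show "C = iterated_dist omega1 \<Omega> D \<gamma>"
    using assms(2) \<gamma>'(2) refl by metis
qed (use assms in blast)

definition levi_core :: "(complex^'n::finite) set \<Rightarrow> 'n distribution" where
  "levi_core \<Omega> = dist_core \<Omega> (levi_null \<Omega>)"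

end

theory Submission
  imports Defs
begin

text \<open>Fix the compact set \<open>K = frontier \<Omega>\<close> and consider all pairs \<open>(z, w)\<close> of a point \<open>z\<close> of \<open>K\<close> and a unit
vector \<open>w\<close>. A set of pairs is called removable if there are \<open>C\<^sup>2\<close> functions on the whole space, as small
as desired on \<open>K\<close>, whose complex Hessian is at least \<open>1\<close> on that set and at least an arbitrarily small
negative number on all other pairs. Such functions can be added and multiplied by constants, so a
compact set of pairs that is locally removable is removable (\<open>removable_compact\<close>), and if all pairs are
removable, then such a function, multiplied by a large constant and shifted into \<open>[0, 1]\<close>, proves Property (P).

Everything rests on one way to produce removable pairs (\<open>removable_dirs_extend\<close>). Let \<open>R\<close> be the compact
set of pairs that have no removable neighbourhood, and let \<open>g\<close> be a \<open>C\<^sup>2\<close> function that vanishes at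
the base points of \<open>R\<close> and has nonnegative Hessian on \<open>R\<close>. Then a pair at which the Hessian of \<open>g\<close> is
positive is not in \<open>R\<close>. Indeed, \<open>\<epsilon> sin (c g / \<epsilon>)\<close> is bounded by \<open>\<epsilon>\<close>, and where \<open>g = 0\<close> its Hessian is \<open>c\<close> times
that of \<open>g\<close>. So the pairs where its Hessian is too small form a compact set outside \<open>R\<close>, on which it
can be corrected by adding a function that removes this set.

This is applied to three kinds of functions \<open>g\<close>, each cut off near a point.
\<^item> The square of a function \<open>F\<close> that vanishes on the base points of \<open>R\<close>: its Hessian there is
  \<open>2 |\<partial>F(w)|\<^sup>2\<close>, so \<open>R\<close> contains only vectors \<open>w\<close> with \<open>\<partial>F(w) = 0\<close> (\<open>removable_if_transverse\<close>). For a
  defining function this means that the vectors in \<open>R\<close> are tangent to the boundary.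
\<^item> A defining function itself: on tangent vectors its Hessian is the Levi form, which is nonnegative by
  pseudoconvexity, so \<open>R\<close> contains only Levi null vectors (\<open>removable_if_not_levi_null\<close>).
\<^item> The square of a function that vanishes on the support of a distribution that contains \<open>R\<close>: by the
  first item \<open>R\<close> lies in the derived distribution as well (\<open>outside_removable_derived\<close>).

By transfinite induction, in which limit stages are trivial, \<open>R\<close> is contained in every iterated derived
distribution, hence in the Levi core. That the core is one of the iterates needs a separate argument:
a derivation that changes a distribution removes a vector together with an open neighbourhood,
and in a second countable space this cannot happen at uncountably many stages
(\<open>levi_core_eq_iterated\<close>).

Finally, the base points of \<open>R\<close> form a compact subset of the support of the core, which is a null set
for the two-dimensional Hausdorff measure. The coordinate projections of this subset can be covered by
small grid squares of small total area, and the sum of the regularised logarithmic potentials of these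
squares is uniformly small, has nonnegative Hessian everywhere and Hessian at least \<open>1\<close> over the set
(\<open>small_psh_test_on_null_set\<close>). Such a function disposes of the remaining pairs \<open>R\<close>.\<close>

section \<open>Second-order calculus\<close>

definition dir_deriv :: "('a::real_normed_vector \<Rightarrow> real) \<Rightarrow> 'a \<Rightarrow> 'a \<Rightarrow> real" where
  "dir_deriv f x v = frechet_derivative f (at x) v"

definition dir_deriv2 :: "('a::real_normed_vector \<Rightarrow> real) \<Rightarrow> 'a \<Rightarrow> 'a \<Rightarrow> 'a \<Rightarrow> real" where
  "dir_deriv2 f x u v = dir_deriv (\<lambda>y. dir_deriv f y v) x u"

text \<open>All test functions below are only \<open>C\<^sup>2\<close>. They are handled through their first and second directional
derivatives, for which the calculus rules are pointwise identities on an open set.\<close>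

lemma Ck_on_2_iff:
  "Ck_on 2 f U \<longleftrightarrow>
     (\<forall>x\<in>U. f differentiable (at x)) \<and>
     (\<forall>v. \<forall>x\<in>U. (\<lambda>y. dir_deriv f y v) differentiable (at x)) \<and>
     (\<forall>u v. continuous_on U (\<lambda>x. dir_deriv2 f x u v))"
  by (auto simp: numeral_2_eq_2 dir_deriv_def dir_deriv2_def)

lemma Ck_on_2_subset:
  fixes f :: "'a::real_normed_vector \<Rightarrow> real"
  shows "Ck_on 2 f U \<Longrightarrow> V \<subseteq> U \<Longrightarrow> Ck_on 2 f V"
  unfolding Ck_on_2_iff by (meson continuous_on_subset subsetD)

lemma has_derivative_dir_deriv:
  assumes "Ck_on 2 f U" "x \<in> U"
  shows "(f has_derivative dir_deriv f x) (at x)"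
    and "((\<lambda>y. dir_deriv f y v) has_derivative (\<lambda>u. dir_deriv2 f x u v)) (at x)"
proof -
  have "f differentiable (at x)" "(\<lambda>y. dir_deriv f y v) differentiable (at x)"
    using assms by (auto simp: Ck_on_2_iff)
  then show "(f has_derivative dir_deriv f x) (at x)"
    "((\<lambda>y. dir_deriv f y v) has_derivative (\<lambda>u. dir_deriv2 f x u v)) (at x)"
    unfolding dir_deriv2_def dir_deriv_def[abs_def]
    by (simp_all add: frechet_derivative_works eta_contract_eq)
qed

lemma dir_deriv_eqI: "(f has_derivative f') (at x) \<Longrightarrow> dir_deriv f x = f'"
  unfolding dir_deriv_def[abs_def] using frechet_derivative_at by metis

lemma Ck_on_2I:
  assumes "open U"
    and d1: "\<And>x. x \<in> U \<Longrightarrow> (f has_derivative f' x) (at x)"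
    and d2: "\<And>x v. x \<in> U \<Longrightarrow> ((\<lambda>y. f' y v) has_derivative (\<lambda>u. f'' x u v)) (at x)"
    and c: "\<And>u v. continuous_on U (\<lambda>x. f'' x u v)"
  shows "Ck_on 2 f U"
    and "\<And>x v. x \<in> U \<Longrightarrow> dir_deriv f x v = f' x v"
    and "\<And>x u v. x \<in> U \<Longrightarrow> dir_deriv2 f x u v = f'' x u v"
proof -
  show e1: "dir_deriv f x v = f' x v" if "x \<in> U" for x v
    using dir_deriv_eqI[OF d1[OF that]] by simp
  have h2: "((\<lambda>y. dir_deriv f y v) has_derivative (\<lambda>u. f'' x u v)) (at x)" if "x \<in> U" for x v
    by (rule has_derivative_transform_within_open[OF d2[OF that] \<open>open U\<close> that]) (simp add: e1)
  show e2: "dir_deriv2 f x u v = f'' x u v" if "x \<in> U" for x u v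
    unfolding dir_deriv2_def using dir_deriv_eqI[OF h2[OF that]] by simp
  have "continuous_on U (\<lambda>x. dir_deriv2 f x u v)" for u v
    using c[of u v] by (rule continuous_on_eq) (simp add: e2)
  then show "Ck_on 2 f U"
    unfolding Ck_on_2_iff using d1 h2 by (auto simp: differentiable_def; blast)
qed

lemma Ck_on_2_cong_open:
  assumes "open U" "Ck_on 2 f U" "\<And>y. y \<in> U \<Longrightarrow> f y = g y"
  shows "Ck_on 2 g U"
    and "\<And>x v. x \<in> U \<Longrightarrow> dir_deriv g x v = dir_deriv f x v"
    and "\<And>x u v. x \<in> U \<Longrightarrow> dir_deriv2 g x u v = dir_deriv2 f x u v"
proof -
  note h = has_derivative_dir_deriv[OF assms(2)]
  have d1: "(g has_derivative dir_deriv f x) (at x)" if "x \<in> U" for x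
    by (rule has_derivative_transform_within_open[OF h(1)[OF that] assms(1) that]) (simp add: assms(3))
  have c: "continuous_on U (\<lambda>x. dir_deriv2 f x u v)" for u v
    using assms(2) by (simp add: Ck_on_2_iff)
  note r = Ck_on_2I[OF assms(1) d1 h(2) c]
  show "Ck_on 2 g U" "\<And>x v. x \<in> U \<Longrightarrow> dir_deriv g x v = dir_deriv f x v"
    "\<And>x u v. x \<in> U \<Longrightarrow> dir_deriv2 g x u v = dir_deriv2 f x u v"
    using r by blast+
qed

lemma Ck_on_2_Un:
  fixes f :: "'a::real_normed_vector \<Rightarrow> real"
  assumes "open U" "open V" "Ck_on 2 f U" "Ck_on 2 f V"
  shows "Ck_on 2 f (U \<union> V)"
  using assms unfolding Ck_on_2_iff by (auto intro: continuous_on_open_Un)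

lemma Ck_on_2_continuous:
  assumes "Ck_on 2 f U"
  shows "continuous_on U f" "continuous_on U (\<lambda>x. dir_deriv f x v)"
  using has_derivative_dir_deriv[OF assms] has_derivative_continuous
  by (blast intro: continuous_at_imp_continuous_on)+

lemma Ck_on_2_continuous2:
  "Ck_on 2 f U \<Longrightarrow> continuous_on U (\<lambda>x. dir_deriv2 f x u v)"
  by (simp add: Ck_on_2_iff)

lemma Ck_on_2_const: "open U \<Longrightarrow> Ck_on 2 (\<lambda>x. c :: real) U"
  by (rule Ck_on_2I(1)[where f' = "\<lambda>x v. 0" and f'' = "\<lambda>x u v. 0"]) auto

lemma dir_deriv_linear:
  assumes "Ck_on 2 f U" "x \<in> U"
  shows "linear (dir_deriv f x)"
  using has_derivative_dir_deriv(1)[OF assms] has_derivative_linear by blast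

lemma dir_deriv2_linear_left:
  assumes "Ck_on 2 f U" "x \<in> U"
  shows "linear (\<lambda>u. dir_deriv2 f x u v)"
  using has_derivative_dir_deriv(2)[OF assms] has_derivative_linear by blast

lemma dir_deriv2_linear_right:
  assumes "open U" "Ck_on 2 f U" "x \<in> U"
  shows "linear (\<lambda>v. dir_deriv2 f x u v)"
proof
  note h = has_derivative_dir_deriv(2)[OF assms(2,3)]
  fix v w :: 'a and c :: real
  have "((\<lambda>y. dir_deriv f y v + dir_deriv f y w) has_derivative
      (\<lambda>u. dir_deriv2 f x u v + dir_deriv2 f x u w)) (at x)"
    by (intro has_derivative_add h)
  then have "((\<lambda>y. dir_deriv f y (v + w)) has_derivative
      (\<lambda>u. dir_deriv2 f x u v + dir_deriv2 f x u w)) (at x)"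
    by (rule has_derivative_transform_within_open[OF _ assms(1,3)])
      (simp add: linear_add[OF dir_deriv_linear[OF assms(2)]])
  then show "dir_deriv2 f x u (v + w) = dir_deriv2 f x u v + dir_deriv2 f x u w"
    unfolding dir_deriv2_def[of f x u "v + w"] by (simp add: dir_deriv_eqI)
  have "((\<lambda>y. c * dir_deriv f y v) has_derivative (\<lambda>u. c * dir_deriv2 f x u v)) (at x)"
    by (intro has_derivative_mult_right h)
  then have "((\<lambda>y. dir_deriv f y (c *\<^sub>R v)) has_derivative (\<lambda>u. c * dir_deriv2 f x u v)) (at x)"
    by (rule has_derivative_transform_within_open[OF _ assms(1,3)])
      (simp add: linear_scale[OF dir_deriv_linear[OF assms(2)]])
  then show "dir_deriv2 f x u (c *\<^sub>R v) = c *\<^sub>R dir_deriv2 f x u v"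
    unfolding dir_deriv2_def[of f x u "c *\<^sub>R v"] by (simp add: dir_deriv_eqI)
qed

lemma Ck_on_2_add:
  assumes U: "open U" and f: "Ck_on 2 f U" and g: "Ck_on 2 g U"
  shows "Ck_on 2 (\<lambda>x. f x + g x) U"
    and "\<And>x v. x \<in> U \<Longrightarrow> dir_deriv (\<lambda>x. f x + g x) x v = dir_deriv f x v + dir_deriv g x v"
    and "\<And>x u v. x \<in> U \<Longrightarrow> dir_deriv2 (\<lambda>x. f x + g x) x u v = dir_deriv2 f x u v + dir_deriv2 g x u v"
proof -
  note hf = has_derivative_dir_deriv[OF f] and hg = has_derivative_dir_deriv[OF g]
  have d1: "((\<lambda>x. f x + g x) has_derivative (\<lambda>v. dir_deriv f x v + dir_deriv g x v)) (at x)" if "x \<in> U" for x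
    using hf(1)[OF that] hg(1)[OF that] by (rule has_derivative_add)
  have d2: "((\<lambda>x. dir_deriv f x v + dir_deriv g x v) has_derivative (\<lambda>u. dir_deriv2 f x u v + dir_deriv2 g x u v)) (at x)"
    if "x \<in> U" for x v
    using hf(2)[OF that] hg(2)[OF that] by (rule has_derivative_add)
  have c: "continuous_on U (\<lambda>x. dir_deriv2 f x u v + dir_deriv2 g x u v)" for u v
    by (intro continuous_intros Ck_on_2_continuous2 f g)
  note r = Ck_on_2I[OF U d1 d2 c]
  show "Ck_on 2 (\<lambda>x. f x + g x) U"
    "\<And>x v. x \<in> U \<Longrightarrow> dir_deriv (\<lambda>x. f x + g x) x v = dir_deriv f x v + dir_deriv g x v"
    "\<And>x u v. x \<in> U \<Longrightarrow> dir_deriv2 (\<lambda>x. f x + g x) x u v = dir_deriv2 f x u v + dir_deriv2 g x u v"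
    using r by blast+
qed

lemma Ck_on_2_mult:
  assumes U: "open U" and f: "Ck_on 2 f U" and g: "Ck_on 2 g U"
  shows "Ck_on 2 (\<lambda>x. f x * g x) U"
    and "\<And>x v. x \<in> U \<Longrightarrow> dir_deriv (\<lambda>x. f x * g x) x v = f x * dir_deriv g x v + dir_deriv f x v * g x"
    and "\<And>x u v. x \<in> U \<Longrightarrow> dir_deriv2 (\<lambda>x. f x * g x) x u v =
       f x * dir_deriv2 g x u v + dir_deriv f x u * dir_deriv g x v +
       (dir_deriv f x v * dir_deriv g x u + dir_deriv2 f x u v * g x)"
proof -
  note hf = has_derivative_dir_deriv[OF f] and hg = has_derivative_dir_deriv[OF g]
  have d1: "((\<lambda>x. f x * g x) has_derivative (\<lambda>v. f x * dir_deriv g x v + dir_deriv f x v * g x)) (at x)" if "x \<in> U" for x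
    using hf(1)[OF that] hg(1)[OF that] by (rule has_derivative_mult)
  have d2: "((\<lambda>x. f x * dir_deriv g x v + dir_deriv f x v * g x) has_derivative
      (\<lambda>u. f x * dir_deriv2 g x u v + dir_deriv f x u * dir_deriv g x v +
       (dir_deriv f x v * dir_deriv g x u + dir_deriv2 f x u v * g x))) (at x)"
    if "x \<in> U" for x v
    using hf[OF that] hg[OF that] by (intro has_derivative_add has_derivative_mult)
  have c: "continuous_on U (\<lambda>x. f x * dir_deriv2 g x u v + dir_deriv f x u * dir_deriv g x v +
       (dir_deriv f x v * dir_deriv g x u + dir_deriv2 f x u v * g x))" for u v
    by (intro continuous_intros Ck_on_2_continuous2 Ck_on_2_continuous f g)
  note r = Ck_on_2I[OF U d1 d2 c]
  show "Ck_on 2 (\<lambda>x. f x * g x) U"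
    "\<And>x v. x \<in> U \<Longrightarrow> dir_deriv (\<lambda>x. f x * g x) x v = f x * dir_deriv g x v + dir_deriv f x v * g x"
    "\<And>x u v. x \<in> U \<Longrightarrow> dir_deriv2 (\<lambda>x. f x * g x) x u v =
       f x * dir_deriv2 g x u v + dir_deriv f x u * dir_deriv g x v +
       (dir_deriv f x v * dir_deriv g x u + dir_deriv2 f x u v * g x)"
    using r by blast+
qed

lemma Ck_on_2_compose:
  fixes \<phi> :: "real \<Rightarrow> real"
  assumes U: "open U" and f: "Ck_on 2 f U"
    and p1: "\<And>x. x \<in> U \<Longrightarrow> (\<phi> has_field_derivative \<phi>' (f x)) (at (f x))"
    and p2: "\<And>x. x \<in> U \<Longrightarrow> (\<phi>' has_field_derivative \<phi>'' (f x)) (at (f x))"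
    and pc: "continuous_on (f ` U) \<phi>''"
  shows "Ck_on 2 (\<lambda>x. \<phi> (f x)) U"
    and "\<And>x v. x \<in> U \<Longrightarrow> dir_deriv (\<lambda>x. \<phi> (f x)) x v = \<phi>' (f x) * dir_deriv f x v"
    and "\<And>x u v. x \<in> U \<Longrightarrow> dir_deriv2 (\<lambda>x. \<phi> (f x)) x u v =
       \<phi>' (f x) * dir_deriv2 f x u v + \<phi>'' (f x) * dir_deriv f x u * dir_deriv f x v"
proof -
  note hf = has_derivative_dir_deriv[OF f]
  have comp: "((\<lambda>x. \<psi> (f x)) has_derivative (\<lambda>v. \<psi>' * dir_deriv f x v)) (at x)"
    if "x \<in> U" "(\<psi> has_field_derivative \<psi>') (at (f x))" for x \<psi> \<psi>'
    using has_derivative_compose[OF hf(1)[OF that(1)]] that(2)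
    unfolding has_field_derivative_def by blast
  note d1 = comp[OF _ p1]
  have d2: "((\<lambda>x. \<phi>' (f x) * dir_deriv f x v) has_derivative
      (\<lambda>u. \<phi>' (f x) * dir_deriv2 f x u v + \<phi>'' (f x) * dir_deriv f x u * dir_deriv f x v)) (at x)"
    if "x \<in> U" for x v
    using comp[OF that p2[OF that]] hf(2)[OF that] by (rule has_derivative_mult)
  have "continuous_on U (\<lambda>x. \<phi>' (f x))"
    by (intro continuous_at_imp_continuous_on ballI has_derivative_continuous[OF comp[OF _ p2]])
  then have c: "continuous_on U (\<lambda>x. \<phi>' (f x) * dir_deriv2 f x u v + \<phi>'' (f x) * dir_deriv f x u * dir_deriv f x v)" for u v
    using continuous_on_compose2[OF pc Ck_on_2_continuous(1)[OF f] order_refl]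
    by (intro continuous_intros Ck_on_2_continuous2[OF f] Ck_on_2_continuous(2)[OF f])
  note r = Ck_on_2I[OF U d1 d2 c]
  show "Ck_on 2 (\<lambda>x. \<phi> (f x)) U"
    "\<And>x v. x \<in> U \<Longrightarrow> dir_deriv (\<lambda>x. \<phi> (f x)) x v = \<phi>' (f x) * dir_deriv f x v"
    "\<And>x u v. x \<in> U \<Longrightarrow> dir_deriv2 (\<lambda>x. \<phi> (f x)) x u v =
       \<phi>' (f x) * dir_deriv2 f x u v + \<phi>'' (f x) * dir_deriv f x u * dir_deriv f x v"
    using r by blast+
qed

lemma continuous_on_dir_deriv:
  fixes f :: "'a::euclidean_space \<Rightarrow> real"
  assumes "Ck_on 2 f U"
  shows "continuous_on (U \<times> UNIV) (\<lambda>(x, v). dir_deriv f x v)"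
proof -
  have "continuous_on (U \<times> UNIV) (\<lambda>p. \<Sum>b\<in>Basis. (snd p \<bullet> b) * dir_deriv f (fst p) b)"
    by (intro continuous_intros continuous_on_compose2[OF Ck_on_2_continuous(2)[OF assms]]) auto
  then show ?thesis
  proof (rule continuous_on_eq)
    fix p assume "p \<in> U \<times> (UNIV :: 'a set)"
    then have l: "linear (dir_deriv f (fst p))"
      using dir_deriv_linear[OF assms] by auto
    have "dir_deriv f (fst p) (snd p) = dir_deriv f (fst p) (\<Sum>b\<in>Basis. (snd p \<bullet> b) *\<^sub>R b)"
      by (simp add: euclidean_representation)
    then show "(\<Sum>b\<in>Basis. (snd p \<bullet> b) * dir_deriv f (fst p) b) = (case p of (x, v) \<Rightarrow> dir_deriv f x v)"
      by (simp add: linear_sum[OF l] linear_scale[OF l] case_prod_beta)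
  qed
qed

lemma continuous_on_dir_deriv2:
  fixes f :: "'a::euclidean_space \<Rightarrow> real"
  assumes "open U" "Ck_on 2 f U"
  shows "continuous_on (U \<times> UNIV) (\<lambda>(x, v). dir_deriv2 f x v v)"
proof -
  have "continuous_on (U \<times> UNIV) (\<lambda>p. \<Sum>b\<in>Basis. \<Sum>c\<in>Basis.
      (snd p \<bullet> b) * (snd p \<bullet> c) * dir_deriv2 f (fst p) b c)"
    by (intro continuous_intros continuous_on_compose2[OF Ck_on_2_continuous2[OF assms(2)]]) auto
  then show ?thesis
  proof (rule continuous_on_eq)
    fix p assume p: "p \<in> U \<times> (UNIV :: 'a set)"
    let ?D = "dir_deriv2 f (fst p)"
    have l: "linear (\<lambda>u. ?D u v)" "linear (\<lambda>v. ?D u v)" for u v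
      using p dir_deriv2_linear_left[OF assms(2)] dir_deriv2_linear_right[OF assms] by auto
    define s where "s = (\<Sum>b\<in>Basis. (snd p \<bullet> b) *\<^sub>R b)"
    have "?D s s = (\<Sum>b\<in>Basis. (snd p \<bullet> b) * ?D b s)"
      by (subst (1) s_def) (simp only: linear_sum[OF l(1)] linear_scale[OF l(1)] real_scaleR_def)
    also have "\<dots> = (\<Sum>b\<in>Basis. (snd p \<bullet> b) * (\<Sum>c\<in>Basis. (snd p \<bullet> c) * ?D b c))"
      by (simp only: s_def linear_sum[OF l(2)] linear_scale[OF l(2)] real_scaleR_def)
    also have "s = snd p"
      by (simp add: s_def euclidean_representation)
    finally show "(\<Sum>b\<in>Basis. \<Sum>c\<in>Basis. (snd p \<bullet> b) * (snd p \<bullet> c) * ?D b c) =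
        (case p of (x, v) \<Rightarrow> dir_deriv2 f x v v)"
      by (simp add: case_prod_beta sum_distrib_left mult.assoc)
  qed
qed

text \<open>Two applications of the mean value theorem. The left-hand side is symmetric in \<open>u\<close> and \<open>v\<close>, while the
right-hand side differentiates first along \<open>u\<close> and then along \<open>v\<close>; this yields the symmetry of the second
derivative.\<close>

lemma second_difference_mean_value:
  fixes f :: "'a::real_normed_vector \<Rightarrow> real"
  assumes f: "Ck_on 2 f U" and B: "ball z d \<subseteq> U" and h: "0 < h" "h * (norm u + norm v) < d"
  shows "\<exists>p\<in>ball z d. f (z + h *\<^sub>R u + h *\<^sub>R v) - f (z + h *\<^sub>R u) - f (z + h *\<^sub>R v) + f z
           = h\<^sup>2 * dir_deriv2 f p v u"
proof -
  note hd = has_derivative_dir_deriv[OF f]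
  have line: "((\<lambda>s. \<psi> (y + s *\<^sub>R e)) has_real_derivative \<psi>' e) (at s)"
    if "(\<psi> has_derivative \<psi>') (at (y + s *\<^sub>R e))" for \<psi> :: "'a \<Rightarrow> real" and \<psi>' y e s
  proof -
    have "((\<lambda>s. y + s *\<^sub>R e) has_derivative (\<lambda>t. t *\<^sub>R e)) (at s)"
      by (auto intro!: derivative_eq_intros)
    from has_derivative_compose[OF this that] linear_scale[OF has_derivative_linear[OF that]]
    show ?thesis
      by (simp add: has_field_derivative_def mult_commute_abs)
  qed
  have mem: "z + s *\<^sub>R u + t *\<^sub>R v \<in> ball z d" if "0 \<le> s" "s \<le> h" "0 \<le> t" "t \<le> h" for s t
  proof -
    have "norm (s *\<^sub>R u + t *\<^sub>R v) \<le> s * norm u + t * norm v"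
      using that norm_triangle_ineq[of "s *\<^sub>R u" "t *\<^sub>R v"] by simp
    also have "\<dots> \<le> h * norm u + h * norm v"
      by (intro add_mono mult_right_mono that) auto
    finally have "norm (s *\<^sub>R u + t *\<^sub>R v) < d"
      using h(2) by (simp add: distrib_left)
    moreover have "z - (z + s *\<^sub>R u + t *\<^sub>R v) = - (s *\<^sub>R u + t *\<^sub>R v)" by simp
    ultimately show ?thesis
      unfolding mem_ball dist_norm by (simp only: norm_minus_cancel)
  qed
  define g where "g s = f (z + h *\<^sub>R v + s *\<^sub>R u) - f (z + s *\<^sub>R u)" for s
  have "\<exists>\<xi>>0. \<xi> < h \<and> g h - g 0 = (h - 0) * (dir_deriv f (z + h *\<^sub>R v + \<xi> *\<^sub>R u) u - dir_deriv f (z + \<xi> *\<^sub>R u) u)"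
  proof (rule MVT2[OF h(1)])
    fix s assume s: "0 \<le> s" "s \<le> h"
    have "z + h *\<^sub>R v + s *\<^sub>R u \<in> U" "z + s *\<^sub>R u \<in> U"
      using mem[OF s, of h] mem[OF s, of 0] h(1) B by (auto simp: algebra_simps)
    then show "(g has_real_derivative dir_deriv f (z + h *\<^sub>R v + s *\<^sub>R u) u - dir_deriv f (z + s *\<^sub>R u) u) (at s)"
      unfolding g_def by (intro DERIV_diff line hd)
  qed
  then obtain \<xi> where xi: "0 < \<xi>" "\<xi> < h"
    and g: "g h - g 0 = h * (dir_deriv f (z + h *\<^sub>R v + \<xi> *\<^sub>R u) u - dir_deriv f (z + \<xi> *\<^sub>R u) u)" by auto
  have "\<exists>\<eta>>0. \<eta> < h \<and> dir_deriv f (z + \<xi> *\<^sub>R u + h *\<^sub>R v) u - dir_deriv f (z + \<xi> *\<^sub>R u + 0 *\<^sub>R v) u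
      = (h - 0) * dir_deriv2 f (z + \<xi> *\<^sub>R u + \<eta> *\<^sub>R v) v u"
  proof (rule MVT2[OF h(1)])
    fix t assume t: "0 \<le> t" "t \<le> h"
    then have "z + \<xi> *\<^sub>R u + t *\<^sub>R v \<in> U"
      using mem[of \<xi> t] xi B by auto
    then show "((\<lambda>t. dir_deriv f (z + \<xi> *\<^sub>R u + t *\<^sub>R v) u) has_real_derivative
        dir_deriv2 f (z + \<xi> *\<^sub>R u + t *\<^sub>R v) v u) (at t)"
      by (intro line hd)
  qed
  then obtain \<eta> where eta: "0 < \<eta>" "\<eta> < h"
    and e: "dir_deriv f (z + \<xi> *\<^sub>R u + h *\<^sub>R v) u - dir_deriv f (z + \<xi> *\<^sub>R u) u
      = h * dir_deriv2 f (z + \<xi> *\<^sub>R u + \<eta> *\<^sub>R v) v u" by auto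
  have "f (z + h *\<^sub>R u + h *\<^sub>R v) - f (z + h *\<^sub>R u) - f (z + h *\<^sub>R v) + f z = g h - g 0"
    by (simp add: g_def algebra_simps)
  also have "\<dots> = h\<^sup>2 * dir_deriv2 f (z + \<xi> *\<^sub>R u + \<eta> *\<^sub>R v) v u"
    using g e by (simp add: algebra_simps power2_eq_square)
  finally show ?thesis
    using mem[of \<xi> \<eta>] xi eta by auto
qed

lemma dir_deriv2_symmetric:
  fixes f :: "'a::real_normed_vector \<Rightarrow> real"
  assumes U: "open U" and f: "Ck_on 2 f U" and z: "z \<in> U"
  shows "dir_deriv2 f z u v = dir_deriv2 f z v u"
proof (rule ccontr)
  define e where "e = \<bar>dir_deriv2 f z u v - dir_deriv2 f z v u\<bar> / 2"
  assume "dir_deriv2 f z u v \<noteq> dir_deriv2 f z v u"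
  then have e: "e > 0" by (simp add: e_def)
  have cont: "\<exists>d>0. \<forall>y. dist y z < d \<longrightarrow> \<bar>dir_deriv2 f y a b - dir_deriv2 f z a b\<bar> < e" for a b
  proof -
    have "continuous (at z) (\<lambda>y. dir_deriv2 f y a b)"
      using Ck_on_2_continuous2[OF f, of a b] z continuous_on_eq_continuous_at[OF U] by blast
    then show ?thesis
      using e unfolding continuous_within_eps_delta by (auto simp: dist_real_def)
  qed
  obtain d1 d2 d3 where d: "d1 > 0" "d2 > 0" "d3 > 0"
    and d1: "\<And>y. dist y z < d1 \<Longrightarrow> \<bar>dir_deriv2 f y u v - dir_deriv2 f z u v\<bar> < e"
    and d2: "\<And>y. dist y z < d2 \<Longrightarrow> \<bar>dir_deriv2 f y v u - dir_deriv2 f z v u\<bar> < e"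
    and d3: "ball z d3 \<subseteq> U"
    using cont[of u v] cont[of v u] U z by (meson open_contains_ball)
  define d where "d = min d1 (min d2 d3)"
  have dpos: "d > 0" and B: "ball z d \<subseteq> U" using d d3 by (auto simp: d_def)
  define h where "h = d / (2 * (norm u + norm v + 1))"
  have "norm u + norm v + 1 > 0" by (simp add: add_nonneg_pos)
  then have h: "h > 0" "h * (norm u + norm v) < d"
    using dpos by (auto simp: h_def field_simps add_nonneg_pos)
  obtain p where p: "p \<in> ball z d"
    "f (z + h *\<^sub>R u + h *\<^sub>R v) - f (z + h *\<^sub>R u) - f (z + h *\<^sub>R v) + f z = h\<^sup>2 * dir_deriv2 f p v u"
    using second_difference_mean_value[OF f B h] by blast
  obtain q where q: "q \<in> ball z d"
    "f (z + h *\<^sub>R v + h *\<^sub>R u) - f (z + h *\<^sub>R v) - f (z + h *\<^sub>R u) + f z = h\<^sup>2 * dir_deriv2 f q u v"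
    using second_difference_mean_value[OF f B h(1), of v u] h(2) by (auto simp: add.commute)
  have "h\<^sup>2 * dir_deriv2 f p v u = h\<^sup>2 * dir_deriv2 f q u v"
    unfolding p(2)[symmetric] q(2)[symmetric] by (simp add: algebra_simps)
  then have "dir_deriv2 f p v u = dir_deriv2 f q u v" using h by simp
  moreover have "\<bar>dir_deriv2 f q u v - dir_deriv2 f z u v\<bar> < e" "\<bar>dir_deriv2 f p v u - dir_deriv2 f z v u\<bar> < e"
    using d1[of q] d2[of p] p(1) q(1) by (auto simp: d_def dist_commute)
  ultimately show False unfolding e_def by (simp add: abs_if split: if_splits)
qed

section \<open>The complex Hessian in real terms\<close>

lemma linear_expand_complex:
  fixes g :: "complex^'n::finite \<Rightarrow> real"
  assumes "linear g"
  shows "g a = (\<Sum>k\<in>UNIV. Re (a $ k) * g (axis k 1) + Im (a $ k) * g (axis k \<i>))"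
proof -
  have "a = (\<Sum>k\<in>UNIV. Re (a $ k) *\<^sub>R axis k 1 + Im (a $ k) *\<^sub>R axis k \<i>)"
    by (simp add: vec_eq_iff axis_def complex_eq_iff if_distrib sum.delta cong: if_cong)
  then have "g a = g (\<Sum>k\<in>UNIV. Re (a $ k) *\<^sub>R axis k 1 + Im (a $ k) *\<^sub>R axis k \<i>)" by simp
  then show ?thesis
    by (simp add: linear_sum[OF assms] linear_add[OF assms] linear_scale[OF assms])
qed

text \<open>With \<open>B\<close> a second derivative, the right-hand side is four times the real part of the complex Hessian.
Both sides are expanded in the real basis of the vectors \<open>e\<^sub>k\<close> and \<open>\<i> e\<^sub>k\<close> and compared term by term.\<close>

lemma bilinear_rotation_sum:
  fixes B :: "complex^'n::finite \<Rightarrow> complex^'n \<Rightarrow> real"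
  assumes l: "\<And>v. linear (\<lambda>u. B u v)" "\<And>u. linear (B u)"
  shows "B a b + B (\<i> *s a) (\<i> *s b) =
    (\<Sum>j\<in>UNIV. \<Sum>k\<in>UNIV. Re ((of_real (B (axis j 1) (axis k 1) + B (axis j \<i>) (axis k \<i>))
       + \<i> * of_real (B (axis j 1) (axis k \<i>) - B (axis j \<i>) (axis k 1))) * a $ j * cnj (b $ k)))"
proof -
  have e: "B a b = (\<Sum>j\<in>UNIV. \<Sum>k\<in>UNIV.
      Re (a $ j) * Re (b $ k) * B (axis j 1) (axis k 1) + Re (a $ j) * Im (b $ k) * B (axis j 1) (axis k \<i>)
      + Im (a $ j) * Re (b $ k) * B (axis j \<i>) (axis k 1) + Im (a $ j) * Im (b $ k) * B (axis j \<i>) (axis k \<i>))" for a b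
  proof -
    have "B a b = (\<Sum>j\<in>UNIV. Re (a $ j) * B (axis j 1) b + Im (a $ j) * B (axis j \<i>) b)"
      by (rule linear_expand_complex[OF l(1)])
    also have "\<dots> = (\<Sum>j\<in>UNIV. Re (a $ j) * (\<Sum>k\<in>UNIV. Re (b $ k) * B (axis j 1) (axis k 1) + Im (b $ k) * B (axis j 1) (axis k \<i>))
       + Im (a $ j) * (\<Sum>k\<in>UNIV. Re (b $ k) * B (axis j \<i>) (axis k 1) + Im (b $ k) * B (axis j \<i>) (axis k \<i>)))"
      by (subst (1 2) linear_expand_complex[OF l(2), of _ b]) (rule refl)
    also have "\<dots> = (\<Sum>j\<in>UNIV. \<Sum>k\<in>UNIV.
      Re (a $ j) * Re (b $ k) * B (axis j 1) (axis k 1) + Re (a $ j) * Im (b $ k) * B (axis j 1) (axis k \<i>)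
      + Im (a $ j) * Re (b $ k) * B (axis j \<i>) (axis k 1) + Im (a $ j) * Im (b $ k) * B (axis j \<i>) (axis k \<i>))"
      unfolding sum_distrib_left sum.distrib[symmetric]
      by (intro sum.cong refl) (simp add: algebra_simps)
    finally show ?thesis .
  qed
  show ?thesis
    unfolding e[of a b] e[of "\<i> *s a" "\<i> *s b"] sum.distrib[symmetric]
    by (intro sum.cong refl) (simp add: algebra_simps)
qed

lemma complex_hessian_rotate_right:
  "complex_hessian f z a (\<i> *s b) = - \<i> * complex_hessian f z a b"
  unfolding complex_hessian_def sum_distrib_left
  by (intro sum.cong refl) simp

lemma Re_complex_hessian:
  fixes f :: "complex^'n::finite \<Rightarrow> real"
  assumes U: "open U" and f: "Ck_on 2 f U" and z: "z \<in> U"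
  shows "Re (complex_hessian f z a b) = (dir_deriv2 f z a b + dir_deriv2 f z (\<i> *s a) (\<i> *s b)) / 4"
proof -
  note hd = has_derivative_dir_deriv[OF f]
  let ?D = "dir_deriv2 f z"
  have bar: "wirt_dzbar k (\<lambda>x. complex_of_real (f x)) y =
      (of_real (dir_deriv f y (axis k 1)) + \<i> * of_real (dir_deriv f y (axis k \<i>))) / 2" if "y \<in> U" for y k
    unfolding wirt_dzbar_def frechet_derivative_at[OF has_derivative_of_real[OF hd(1)[OF that]], symmetric] ..
  have w: "wirt_dz j (wirt_dzbar k (\<lambda>x. complex_of_real (f x))) z =
      (of_real (?D (axis j 1) (axis k 1) + ?D (axis j \<i>) (axis k \<i>))
       + \<i> * of_real (?D (axis j 1) (axis k \<i>) - ?D (axis j \<i>) (axis k 1))) / 4" for j k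
  proof -
    have "((\<lambda>y. (complex_of_real (dir_deriv f y (axis k 1)) + \<i> * of_real (dir_deriv f y (axis k \<i>))) / 2) has_derivative
       (\<lambda>u. (of_real (?D u (axis k 1)) + \<i> * of_real (?D u (axis k \<i>))) / 2)) (at z)"
      by (intro bounded_linear.has_derivative[OF bounded_linear_divide] has_derivative_add has_derivative_mult_right has_derivative_of_real hd z)
    then have "(wirt_dzbar k (\<lambda>x. complex_of_real (f x)) has_derivative
       (\<lambda>u. (of_real (?D u (axis k 1)) + \<i> * of_real (?D u (axis k \<i>))) / 2)) (at z)"
      by (rule has_derivative_transform_within_open[OF _ U z]) (simp add: bar)
    then have "frechet_derivative (wirt_dzbar k (\<lambda>x. complex_of_real (f x))) (at z) =
       (\<lambda>u. (of_real (?D u (axis k 1)) + \<i> * of_real (?D u (axis k \<i>))) / 2)"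
      by (rule frechet_derivative_at[symmetric])
    then show ?thesis
      by (simp add: wirt_dz_def field_simps)
  qed
  have "Re (complex_hessian f z a b) = (\<Sum>j\<in>UNIV. \<Sum>k\<in>UNIV.
     Re ((of_real (?D (axis j 1) (axis k 1) + ?D (axis j \<i>) (axis k \<i>))
       + \<i> * of_real (?D (axis j 1) (axis k \<i>) - ?D (axis j \<i>) (axis k 1))) / 4 * a $ j * cnj (b $ k)))"
    by (simp only: complex_hessian_def w Re_sum)
  also have "\<dots> = (\<Sum>j\<in>UNIV. \<Sum>k\<in>UNIV.
     Re ((of_real (?D (axis j 1) (axis k 1) + ?D (axis j \<i>) (axis k \<i>))
       + \<i> * of_real (?D (axis j 1) (axis k \<i>) - ?D (axis j \<i>) (axis k 1))) * a $ j * cnj (b $ k))) / 4"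
    unfolding sum_divide_distrib by (intro sum.cong refl) simp
  also have "\<dots> = (?D a b + ?D (\<i> *s a) (\<i> *s b)) / 4"
    by (subst bilinear_rotation_sum[OF dir_deriv2_linear_left[OF f z] dir_deriv2_linear_right[OF U f z]]) simp
  finally show ?thesis .
qed

text \<open>The quadratic form of the complex Hessian (see \<open>Re_complex_hessian\<close>), written with real second
derivatives only.\<close>

definition levi_quad :: "(complex^'n::finite \<Rightarrow> real) \<Rightarrow> complex^'n \<Rightarrow> complex^'n \<Rightarrow> real" where
  "levi_quad f z w = (dir_deriv2 f z w w + dir_deriv2 f z (\<i> *s w) (\<i> *s w)) / 4"

lemma i_scale_linear: "linear (\<lambda>w::complex^'n::finite. \<i> *s w)"
  by (rule linearI) (simp_all add: vec_eq_iff algebra_simps scaleR_conv_of_real)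

lemma continuous_on_levi_quad:
  fixes f :: "complex^'n::finite \<Rightarrow> real"
  assumes "open U" "Ck_on 2 f U"
  shows "continuous_on (U \<times> UNIV) (\<lambda>x. levi_quad f (fst x) (snd x))"
proof -
  have c: "continuous_on (U \<times> UNIV) (\<lambda>x. dir_deriv2 f (fst x) (snd x) (snd x))"
    using continuous_on_dir_deriv2[OF assms] by (simp add: case_prod_beta)
  have "continuous_on (U \<times> UNIV) (\<lambda>x. dir_deriv2 f (fst (fst x, \<i> *s snd x)) (snd (fst x, \<i> *s snd x)) (snd (fst x, \<i> *s snd x)))"
    by (rule continuous_on_compose2[OF c, of _ "\<lambda>x. (fst x, \<i> *s snd x)"])
      (auto intro!: continuous_intros linear_continuous_on_compose[OF _ i_scale_linear])
  then show ?thesis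
    unfolding levi_quad_def using c by (intro continuous_intros) auto
qed

lemma levi_quad_scaleR:
  fixes f :: "complex^'n::finite \<Rightarrow> real"
  assumes "open U" "Ck_on 2 f U" "z \<in> U"
  shows "levi_quad f z (c *\<^sub>R w) = c\<^sup>2 * levi_quad f z w"
  unfolding levi_quad_def
  by (simp only: linear_scale[OF i_scale_linear] linear_scale[OF dir_deriv2_linear_left[OF assms(2,3)]]
      linear_scale[OF dir_deriv2_linear_right[OF assms]])
    (simp add: power2_eq_square algebra_simps)

lemma levi_quad_add:
  fixes f g :: "complex^'n::finite \<Rightarrow> real"
  assumes "open U" "Ck_on 2 f U" "Ck_on 2 g U" "z \<in> U"
  shows "levi_quad (\<lambda>x. f x + g x) z w = levi_quad f z w + levi_quad g z w"
  using Ck_on_2_add(3)[OF assms] by (simp add: levi_quad_def field_simps)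

lemma levi_quad_mult:
  fixes f g :: "complex^'n::finite \<Rightarrow> real"
  assumes "open U" "Ck_on 2 f U" "Ck_on 2 g U" "z \<in> U"
  shows "levi_quad (\<lambda>x. f x * g x) z w = f z * levi_quad g z w + levi_quad f z w * g z
     + (dir_deriv f z w * dir_deriv g z w + dir_deriv f z (\<i> *s w) * dir_deriv g z (\<i> *s w)) / 2"
  using Ck_on_2_mult(3)[OF assms] by (simp add: levi_quad_def field_simps)

lemma levi_quad_cong_open:
  fixes f g :: "complex^'n::finite \<Rightarrow> real"
  assumes "open U" "Ck_on 2 f U" "\<And>y. y \<in> U \<Longrightarrow> f y = g y" "z \<in> U"
  shows "levi_quad g z w = levi_quad f z w"
  using Ck_on_2_cong_open(3)[OF assms] by (simp add: levi_quad_def)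

text \<open>The last term is \<open>\<phi>''(f)\<close> times the squared modulus of \<open>\<partial>f(w)\<close>.\<close>

lemma levi_quad_compose:
  fixes f :: "complex^'n::finite \<Rightarrow> real" and \<phi> :: "real \<Rightarrow> real"
  assumes U: "open U" "Ck_on 2 f U"
    and p1: "\<And>z. z \<in> U \<Longrightarrow> (\<phi> has_field_derivative \<phi>' (f z)) (at (f z))"
    and p2: "\<And>z. z \<in> U \<Longrightarrow> (\<phi>' has_field_derivative \<phi>'' (f z)) (at (f z))"
    and pc: "continuous_on (f ` U) \<phi>''"
  shows "Ck_on 2 (\<lambda>x. \<phi> (f x)) U"
    and "\<And>z w. z \<in> U \<Longrightarrow> levi_quad (\<lambda>x. \<phi> (f x)) z w = \<phi>' (f z) * levi_quad f z w +
       \<phi>'' (f z) * ((dir_deriv f z w)\<^sup>2 + (dir_deriv f z (\<i> *s w))\<^sup>2) / 4"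
proof -
  note r = Ck_on_2_compose[OF U p1 p2 pc]
  show "Ck_on 2 (\<lambda>x. \<phi> (f x)) U" by (rule r(1))
  show "levi_quad (\<lambda>x. \<phi> (f x)) z w = \<phi>' (f z) * levi_quad f z w +
       \<phi>'' (f z) * ((dir_deriv f z w)\<^sup>2 + (dir_deriv f z (\<i> *s w))\<^sup>2) / 4" if "z \<in> U" for z w
    by (simp add: levi_quad_def r(3)[OF _ _ that] power2_eq_square field_simps)
qed

lemma levi_quad_cmult:
  fixes f :: "complex^'n::finite \<Rightarrow> real"
  assumes "open U" "Ck_on 2 f U"
  shows "Ck_on 2 (\<lambda>x. c * f x) U"
    and "\<And>z w. z \<in> U \<Longrightarrow> levi_quad (\<lambda>x. c * f x) z w = c * levi_quad f z w"
  using levi_quad_compose[OF assms, of "\<lambda>t. c * t" "\<lambda>t. c" "\<lambda>t. 0"]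
  by (auto intro!: derivative_eq_intros)

lemma continuous_levi_quad_UNIV:
  fixes f :: "complex^'n::finite \<Rightarrow> real"
  assumes "Ck_on 2 f UNIV"
  shows "continuous_on A (\<lambda>x. levi_quad f (fst x) (snd x))"
  using continuous_on_levi_quad[OF open_UNIV assms] by (rule continuous_on_subset) auto

section \<open>Removable directions\<close>

definition unit_dirs :: "(complex^'n::finite) set \<Rightarrow> ((complex^'n) \<times> (complex^'n)) set" where
  "unit_dirs K = K \<times> sphere 0 1"

text \<open>The functions that may be added to a candidate for Property (P) at an arbitrarily small cost: they are
defined and \<open>C\<^sup>2\<close> everywhere, but only their behaviour on \<open>K\<close> is restricted.\<close>

definition flat_test :: "(complex^'n::finite) set \<Rightarrow> real \<Rightarrow> (complex^'n \<Rightarrow> real) \<Rightarrow> bool" where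
  "flat_test K \<epsilon> g \<longleftrightarrow> Ck_on 2 g UNIV \<and> (\<forall>z\<in>K. \<bar>g z\<bar> \<le> \<epsilon>) \<and>
     (\<forall>x\<in>unit_dirs K. levi_quad g (fst x) (snd x) \<ge> - \<epsilon>)"

text \<open>The lower bound \<open>1\<close> could be any other constant, because \<open>\<epsilon>\<close> is arbitrary and tests can be multiplied
by positive constants (\<open>removableD\<close>).\<close>

definition removable :: "(complex^'n::finite) set \<Rightarrow> ((complex^'n) \<times> (complex^'n)) set \<Rightarrow> bool" where
  "removable K A \<longleftrightarrow> (\<forall>\<epsilon>>0. \<exists>g. flat_test K \<epsilon> g \<and> (\<forall>x\<in>A. levi_quad g (fst x) (snd x) \<ge> 1))"

text \<open>The largest relatively open set of pairs that is locally removable. It is open by construction, so that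
the remaining pairs form a compact set.\<close>

definition removable_dirs :: "(complex^'n::finite) set \<Rightarrow> ((complex^'n) \<times> (complex^'n)) set" where
  "removable_dirs K = {x\<in>unit_dirs K. \<exists>V. open V \<and> x \<in> V \<and> removable K (V \<inter> unit_dirs K)}"

lemma flat_test_add:
  assumes "flat_test K \<epsilon> f" "flat_test K \<delta> g"
  shows "flat_test K (\<epsilon> + \<delta>) (\<lambda>z. f z + g z)"
    and "levi_quad (\<lambda>z. f z + g z) z w = levi_quad f z w + levi_quad g z w"
proof -
  have c: "Ck_on 2 f UNIV" "Ck_on 2 g UNIV" using assms by (auto simp: flat_test_def)
  show l: "levi_quad (\<lambda>z. f z + g z) z w = levi_quad f z w + levi_quad g z w" for z w
    by (rule levi_quad_add[OF open_UNIV c UNIV_I])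
  have "\<bar>f z + g z\<bar> \<le> \<epsilon> + \<delta>" if "z \<in> K" for z
    using assms that abs_triangle_ineq[of "f z" "g z"] by (fastforce simp: flat_test_def)
  moreover have "levi_quad f (fst x) (snd x) + levi_quad g (fst x) (snd x) \<ge> - (\<epsilon> + \<delta>)" if "x \<in> unit_dirs K" for x
  proof -
    have "levi_quad f (fst x) (snd x) \<ge> - \<epsilon>" "levi_quad g (fst x) (snd x) \<ge> - \<delta>"
      using assms that by (auto simp: flat_test_def)
    then show ?thesis by linarith
  qed
  ultimately show "flat_test K (\<epsilon> + \<delta>) (\<lambda>z. f z + g z)"
    unfolding flat_test_def l using Ck_on_2_add(1)[OF open_UNIV c] by blast
qed

lemma flat_test_cmult:
  assumes "flat_test K \<epsilon> f" "c > 0"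
  shows "flat_test K (c * \<epsilon>) (\<lambda>z. c * f z)"
    and "levi_quad (\<lambda>z. c * f z) z w = c * levi_quad f z w"
proof -
  have c: "Ck_on 2 f UNIV" using assms by (auto simp: flat_test_def)
  show l: "levi_quad (\<lambda>z. c * f z) z w = c * levi_quad f z w" for z w
    by (rule levi_quad_cmult(2)[OF open_UNIV c UNIV_I])
  have "- (c * \<epsilon>) \<le> c * levi_quad f (fst x) (snd x)" if "x \<in> unit_dirs K" for x
    using assms that mult_left_mono[of "- \<epsilon>" "levi_quad f (fst x) (snd x)" c] by (auto simp: flat_test_def)
  then show "flat_test K (c * \<epsilon>) (\<lambda>z. c * f z)"
    using assms levi_quad_cmult(1)[OF open_UNIV c] by (auto simp: flat_test_def l abs_mult)
qed

lemma flat_test_mono: "flat_test K \<epsilon> f \<Longrightarrow> \<epsilon> \<le> \<delta> \<Longrightarrow> flat_test K \<delta> f"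
  unfolding flat_test_def by (meson order_trans neg_le_iff_le)

lemma removable_subset: "removable K A \<Longrightarrow> B \<subseteq> A \<Longrightarrow> removable K B"
  unfolding removable_def by (meson subsetD)

lemma removableD:
  assumes "removable K A" "\<epsilon> > 0"
  obtains g where "flat_test K \<epsilon> g" "\<And>x. x \<in> A \<Longrightarrow> levi_quad g (fst x) (snd x) \<ge> C"
proof -
  define c where "c = max C 1"
  have c: "c > 0" "c \<ge> C" by (auto simp: c_def)
  obtain g where g: "flat_test K (\<epsilon> / c) g" "\<And>x. x \<in> A \<Longrightarrow> levi_quad g (fst x) (snd x) \<ge> 1"
    using assms c unfolding removable_def by (meson divide_pos_pos)
  have "levi_quad (\<lambda>z. c * g z) (fst x) (snd x) \<ge> C" if "x \<in> A" for x
  proof -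
    have "c * 1 \<le> c * levi_quad g (fst x) (snd x)"
      using g(2)[OF that] c by (intro mult_left_mono) auto
    then show ?thesis
      using c unfolding flat_test_cmult(2)[OF g(1) c(1)] by linarith
  qed
  then show ?thesis
    using that flat_test_cmult(1)[OF g(1) c(1)] c by simp
qed

text \<open>Any fixed loss in the lower bound is made up by doubling the test.\<close>

lemma removableI_approx:
  assumes "\<And>\<epsilon>. \<epsilon> > 0 \<Longrightarrow> \<epsilon> < 1 \<Longrightarrow> \<exists>g. flat_test K \<epsilon> g \<and> (\<forall>x\<in>A. levi_quad g (fst x) (snd x) \<ge> 1 - \<epsilon>)"
  shows "removable K A"
  unfolding removable_def
proof (intro allI impI)
  fix \<epsilon> :: real assume "\<epsilon> > 0"
  define d where "d = min \<epsilon> 1 / 2"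
  have d: "d > 0" "d < 1" "d \<le> 1/2" "2 * d \<le> \<epsilon>" using \<open>\<epsilon> > 0\<close> by (auto simp: d_def)
  obtain g where g: "flat_test K d g" "\<And>x. x \<in> A \<Longrightarrow> levi_quad g (fst x) (snd x) \<ge> 1 - d"
    using assms[OF d(1,2)] by blast
  have "levi_quad (\<lambda>z. 2 * g z) (fst x) (snd x) \<ge> 1" if "x \<in> A" for x
    using g(2)[OF that] d flat_test_cmult(2)[OF g(1), of 2] by simp
  moreover have "flat_test K \<epsilon> (\<lambda>z. 2 * g z)"
    using flat_test_mono[OF flat_test_cmult(1)[OF g(1), of 2] d(4)] by simp
  ultimately show "\<exists>g. flat_test K \<epsilon> g \<and> (\<forall>x\<in>A. levi_quad g (fst x) (snd x) \<ge> 1)" by blast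
qed

lemma removable_empty: "removable K {}"
proof -
  have "flat_test K \<epsilon> (\<lambda>z. 0)" if "\<epsilon> > 0" for \<epsilon>
    using that Ck_on_2_const[OF open_UNIV, of 0]
    by (simp add: flat_test_def levi_quad_def dir_deriv2_def dir_deriv_def)
  then show ?thesis unfolding removable_def by blast
qed

lemma removable_Un:
  assumes "removable K A" "removable K B" "A \<union> B \<subseteq> unit_dirs K"
  shows "removable K (A \<union> B)"
proof (rule removableI_approx)
  fix \<epsilon> :: real assume "\<epsilon> > 0"
  then have e: "\<epsilon> / 2 > 0" by simp
  obtain f where f: "flat_test K (\<epsilon>/2) f" "\<And>x. x \<in> A \<Longrightarrow> levi_quad f (fst x) (snd x) \<ge> 1"
    using removableD[OF assms(1) e] by blast
  obtain g where g: "flat_test K (\<epsilon>/2) g" "\<And>x. x \<in> B \<Longrightarrow> levi_quad g (fst x) (snd x) \<ge> 1"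
    using removableD[OF assms(2) e] by blast
  have "levi_quad (\<lambda>z. f z + g z) (fst x) (snd x) \<ge> 1 - \<epsilon>" if "x \<in> A \<union> B" for x
  proof -
    have "levi_quad f (fst x) (snd x) \<ge> - (\<epsilon>/2)" "levi_quad g (fst x) (snd x) \<ge> - (\<epsilon>/2)"
      using f(1) g(1) that assms(3) by (auto simp: flat_test_def)
    then show ?thesis
      using f(2)[of x] g(2)[of x] that \<open>\<epsilon> > 0\<close> by (auto simp: flat_test_add(2)[OF f(1) g(1)])
  qed
  then show "\<exists>g. flat_test K \<epsilon> g \<and> (\<forall>x\<in>A \<union> B. levi_quad g (fst x) (snd x) \<ge> 1 - \<epsilon>)"
    using flat_test_add(1)[OF f(1) g(1)] by auto
qed

text \<open>Finitely many removable sets are removed by the sum of their tests, since each summand is almost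
nonnegative on the other sets.\<close>

lemma removable_compact:
  assumes "compact F" "F \<subseteq> removable_dirs K"
  shows "removable K F"
proof -
  let ?\<C> = "{V. open V \<and> removable K (V \<inter> unit_dirs K)}"
  obtain \<D> where D: "\<D> \<subseteq> ?\<C>" "finite \<D>" "F \<subseteq> \<Union>\<D>"
    by (rule compactE[OF assms(1), of ?\<C>]) (use assms(2) in \<open>auto simp: removable_dirs_def\<close>)
  have "removable K (\<Union>\<D> \<inter> unit_dirs K)"
    using D(2,1)
  proof (induction \<D>)
    case empty then show ?case by (simp add: removable_empty)
  next
    case (insert V \<D>)
    then have "removable K ((V \<inter> unit_dirs K) \<union> (\<Union>\<D> \<inter> unit_dirs K))"
      by (intro removable_Un) auto
    then show ?case by (simp add: Int_Un_distrib2)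
  qed
  then show ?thesis
    using D(3) assms(2) by (elim removable_subset) (auto simp: removable_dirs_def)
qed

lemma compact_unit_dirs: "compact K \<Longrightarrow> compact (unit_dirs K)"
  unfolding unit_dirs_def by (intro compact_Times) auto

lemma levi_quad_bounded:
  assumes "compact K" "Ck_on 2 g UNIV"
  obtains C where "\<And>x. x \<in> unit_dirs K \<Longrightarrow> \<bar>levi_quad g (fst x) (snd x)\<bar> \<le> C"
proof -
  have "compact ((\<lambda>x. levi_quad g (fst x) (snd x)) ` unit_dirs K)"
    by (intro compact_continuous_image continuous_levi_quad_UNIV assms compact_unit_dirs)
  then obtain C where "\<forall>y\<in>(\<lambda>x. levi_quad g (fst x) (snd x)) ` unit_dirs K. norm y \<le> C"
    using compact_imp_bounded bounded_iff by blast
  then show ?thesis by (intro that[of C]) auto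
qed

lemma closed_levi_quad:
  assumes "Ck_on 2 g UNIV"
  shows "closed {x. levi_quad g (fst x) (snd x) \<le> c}" "closed {x. c \<le> levi_quad g (fst x) (snd x)}"
  by (intro closed_Collect_le continuous_on_const continuous_levi_quad_UNIV assms)+

text \<open>A small function whose Hessian is bad only on a compact set of locally removable pairs becomes a test:
a test that is very positive on this set outweighs the bounded negative part.\<close>

lemma correct_on_removable:
  assumes K: "compact K" and g: "Ck_on 2 g UNIV" "\<And>z. z \<in> K \<Longrightarrow> \<bar>g z\<bar> \<le> \<epsilon>"
    and F: "compact F" "F \<subseteq> removable_dirs K"
    and off: "\<And>x. x \<in> unit_dirs K - F \<Longrightarrow> levi_quad g (fst x) (snd x) \<ge> - \<epsilon>"
    and e: "\<epsilon> > 0"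
  obtains h where "flat_test K (2 * \<epsilon>) h"
    "\<And>x. x \<in> F \<Longrightarrow> levi_quad h (fst x) (snd x) \<ge> 1"
    "\<And>x. x \<in> unit_dirs K \<Longrightarrow> levi_quad h (fst x) (snd x) \<ge> levi_quad g (fst x) (snd x) - \<epsilon>"
proof -
  obtain C where C: "\<And>x. x \<in> unit_dirs K \<Longrightarrow> \<bar>levi_quad g (fst x) (snd x)\<bar> \<le> C"
    using levi_quad_bounded[OF K g(1)] by blast
  obtain f where f: "flat_test K \<epsilon> f" "\<And>x. x \<in> F \<Longrightarrow> levi_quad f (fst x) (snd x) \<ge> C + 1"
    using removableD[OF removable_compact[OF F] e] by metis
  have fc: "Ck_on 2 f UNIV" using f(1) by (simp add: flat_test_def)
  let ?h = "\<lambda>z. g z + f z"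
  have l: "levi_quad ?h z w = levi_quad g z w + levi_quad f z w" for z w
    by (rule levi_quad_add[OF open_UNIV g(1) fc UNIV_I])
  have FE: "F \<subseteq> unit_dirs K" using F(2) by (auto simp: removable_dirs_def)
  have b: "\<bar>g z + f z\<bar> \<le> 2 * \<epsilon>" if "z \<in> K" for z
    using g(2)[OF that] f(1) that abs_triangle_ineq[of "g z" "f z"] by (fastforce simp: flat_test_def)
  have 1: "levi_quad ?h (fst x) (snd x) \<ge> 1" if "x \<in> F" for x
    using f(2)[OF that] C[of x] that FE unfolding l by (auto simp: abs_le_iff)
  have 2: "levi_quad ?h (fst x) (snd x) \<ge> levi_quad g (fst x) (snd x) - \<epsilon>" if "x \<in> unit_dirs K" for x
    using f(1) that unfolding l flat_test_def by force
  have "levi_quad ?h (fst x) (snd x) \<ge> - (2 * \<epsilon>)" if "x \<in> unit_dirs K" for x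
    using 1[of x] 2[OF that] off[of x] that e by (cases "x \<in> F") auto
  then have "flat_test K (2 * \<epsilon>) ?h"
    unfolding flat_test_def using b Ck_on_2_add(1)[OF open_UNIV g(1) fc] by blast
  then show ?thesis using that 1 2 by blast
qed

text \<open>The engine of the whole proof. A function that vanishes at the base points of the remaining pairs need not
be small on \<open>K\<close>. Passing from \<open>g\<close> to \<open>\<delta> sin (c g / \<delta>)\<close> makes it small everywhere and multiplies
the Hessian by \<open>c\<close> where \<open>g = 0\<close>; the damage elsewhere concerns removable pairs only and is repaired by
\<open>correct_on_removable\<close>. The neighbourhood \<open>V\<close> does not depend on the smallness \<open>\<delta>\<close>, as the definition of
\<open>removable_dirs\<close> demands.\<close>

lemma removable_dirs_extend:
  assumes K: "compact K" and g: "Ck_on 2 g UNIV"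
    and zero: "\<And>x. x \<in> unit_dirs K - removable_dirs K \<Longrightarrow> g (fst x) = 0"
    and nonneg: "\<And>x. x \<in> unit_dirs K - removable_dirs K \<Longrightarrow> levi_quad g (fst x) (snd x) \<ge> 0"
    and x0: "x0 \<in> unit_dirs K" "levi_quad g (fst x0) (snd x0) > 0"
  shows "x0 \<in> removable_dirs K"
proof -
  define \<kappa> where "\<kappa> = levi_quad g (fst x0) (snd x0) / 2"
  have k: "\<kappa> > 0" using x0 by (simp add: \<kappa>_def)
  define V where "V = {x. levi_quad g (fst x) (snd x) > \<kappa>}"
  have "open V"
    unfolding V_def by (intro open_Collect_less continuous_on_const continuous_levi_quad_UNIV g)
  have "removable K (V \<inter> unit_dirs K)"
  proof (rule removableI_approx)
    fix \<epsilon> :: real assume "\<epsilon> > 0" "\<epsilon> < 1"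
    define \<delta> where "\<delta> = \<epsilon> / 2"
    have d: "\<delta> > 0" "\<delta> < 1" using \<open>\<epsilon> > 0\<close> \<open>\<epsilon> < 1\<close> by (auto simp: \<delta>_def)
    define c where "c = 2 / \<kappa>"
    define \<mu> where "\<mu> z = \<delta> * sin (c / \<delta> * g z)" for z
    have comp: "Ck_on 2 \<mu> UNIV"
      "levi_quad \<mu> z w = c * cos (c / \<delta> * g z) * levi_quad g z w +
         (- (c\<^sup>2 / \<delta> * sin (c / \<delta> * g z))) * ((dir_deriv g z w)\<^sup>2 + (dir_deriv g z (\<i> *s w))\<^sup>2) / 4" for z w
      unfolding \<mu>_def
      by (intro levi_quad_compose[where f = g and U = UNIV and \<phi> = "\<lambda>t. \<delta> * sin (c / \<delta> * t)"
            and \<phi>' = "\<lambda>t. c * cos (c / \<delta> * t)" and \<phi>'' = "\<lambda>t. - (c\<^sup>2 / \<delta> * sin (c / \<delta> * t))"] g;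
          use d in \<open>auto intro!: derivative_eq_intros continuous_intros simp: power2_eq_square field_simps\<close>)+
    have b: "\<bar>\<mu> z\<bar> \<le> \<delta>" for z
      using d abs_sin_le_one[of "c / \<delta> * g z"] by (simp add: \<mu>_def abs_mult mult_left_le)
    have eq: "levi_quad \<mu> (fst x) (snd x) = c * levi_quad g (fst x) (snd x)"
      if "x \<in> unit_dirs K - removable_dirs K" for x
      using zero[OF that] by (simp add: comp(2))
    \<comment> \<open>the pairs where the Hessian of \<open>\<mu>\<close> is too small, either in general or on \<open>V\<close>; the latter condition
      uses the closed set \<open>\<kappa> \<le> levi_quad g\<close> instead of \<open>V\<close>, so that \<open>F\<close> is compact\<close>
    define F where "F = unit_dirs K \<inter> ({x. levi_quad \<mu> (fst x) (snd x) \<le> - \<delta>} \<union>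
        ({x. \<kappa> \<le> levi_quad g (fst x) (snd x)} \<inter> {x. levi_quad \<mu> (fst x) (snd x) \<le> 1}))"
    have "compact F"
      unfolding F_def
      by (intro compact_Int_closed compact_unit_dirs K closed_Un closed_Int closed_levi_quad g comp)
    have "F \<subseteq> removable_dirs K"
    proof (rule ccontr)
      assume "\<not> F \<subseteq> removable_dirs K"
      then obtain x where x: "x \<in> F" "x \<in> unit_dirs K - removable_dirs K"
        by (auto simp: F_def)
      from x(1) consider "c * levi_quad g (fst x) (snd x) \<le> - \<delta>"
        | "\<kappa> \<le> levi_quad g (fst x) (snd x)" "c * levi_quad g (fst x) (snd x) \<le> 1"
        by (auto simp: F_def eq[OF x(2)])
      then show False
      proof cases
        case 1
        have "c * levi_quad g (fst x) (snd x) \<ge> 0"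
          using nonneg[OF x(2)] k by (simp add: c_def)
        then show False using 1 d by simp
      next
        case 2
        then have "c * \<kappa> \<le> 1" using mult_left_mono[OF 2(1), of c] k by (simp add: c_def)
        then show False using k by (simp add: c_def)
      qed
    qed
    moreover have "levi_quad \<mu> (fst x) (snd x) \<ge> - \<delta>" if "x \<in> unit_dirs K - F" for x
      using that by (auto simp: F_def)
    ultimately obtain h where h: "flat_test K (2 * \<delta>) h"
      "\<And>x. x \<in> F \<Longrightarrow> levi_quad h (fst x) (snd x) \<ge> 1"
      "\<And>x. x \<in> unit_dirs K \<Longrightarrow> levi_quad h (fst x) (snd x) \<ge> levi_quad \<mu> (fst x) (snd x) - \<delta>"
      using correct_on_removable[OF K comp(1) b \<open>compact F\<close> _ _ d(1)] by blast
    have "levi_quad h (fst x) (snd x) \<ge> 1 - \<epsilon>" if "x \<in> V \<inter> unit_dirs K" for x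
    proof (cases "x \<in> F")
      case True then show ?thesis using h(2)[OF True] \<open>\<epsilon> > 0\<close> by simp
    next
      case False
      then have "levi_quad \<mu> (fst x) (snd x) \<ge> 1" using that by (auto simp: F_def V_def)
      then show ?thesis using h(3)[of x] that \<open>\<epsilon> > 0\<close> by (auto simp: \<delta>_def)
    qed
    then show "\<exists>g. flat_test K \<epsilon> g \<and> (\<forall>x\<in>V \<inter> unit_dirs K. levi_quad g (fst x) (snd x) \<ge> 1 - \<epsilon>)"
      using h(1) by (auto simp: \<delta>_def)
  qed
  moreover have "x0 \<in> V" using k by (simp add: V_def \<kappa>_def)
  ultimately show ?thesis
    using \<open>open V\<close> x0(1) unfolding removable_dirs_def by blast
qed

text \<open>A test that is small on \<open>K\<close> and very positive on all unit vectors over \<open>K\<close> keeps both properties on a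
neighbourhood, by compactness of the unit sphere.\<close>

lemma property_P_if_all_removable:
  assumes K: "compact K" and r: "removable K (unit_dirs K)"
  shows "property_P K"
  unfolding property_P_def
proof (intro conjI K allI impI)
  fix M :: real assume M: "M > 0"
  obtain g where g: "flat_test K (1/4) g" "\<And>x. x \<in> unit_dirs K \<Longrightarrow> levi_quad g (fst x) (snd x) \<ge> M + 1"
    using removableD[OF r, of "1/4" "M + 1"] by auto
  have gc: "Ck_on 2 g UNIV" using g(1) by (simp add: flat_test_def)
  let ?h = "\<lambda>z. 1/2 + g z"
  have hc: "Ck_on 2 ?h UNIV" and hl: "levi_quad ?h z w = levi_quad g z w" for z w
  proof -
    have "((\<lambda>t. 1/2 + t) has_real_derivative 1) (at t)" for t :: real
      by (auto intro!: derivative_eq_intros)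
    note r = levi_quad_compose[OF open_UNIV gc this DERIV_const continuous_on_const]
    show "Ck_on 2 ?h UNIV" by (rule r(1))
    show "levi_quad ?h z w = levi_quad g z w" for z w using r(2) by simp
  qed
  define A where "A = {x. levi_quad g (fst x) (snd x) > M}"
  have "open A" unfolding A_def by (intro open_Collect_less continuous_on_const continuous_levi_quad_UNIV gc)
  define U1 where "U1 = {z. {z} \<times> sphere 0 1 \<subseteq> A}"
  have "\<exists>V. open V \<and> z \<in> V \<and> V \<subseteq> U1" if "z \<in> U1" for z
    using Elementary_Topology.tube_lemma[OF compact_sphere \<open>open A\<close>, of z 0 1] that unfolding U1_def by blast
  then have "open U1" by (subst open_subopen) blast
  define U where "U = U1 \<inter> {z. -1/2 < g z} \<inter> {z. g z < 1/2}"
  have "open U"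
    unfolding U_def using \<open>open U1\<close> 
    by (intro open_Int open_Collect_less continuous_on_const Ck_on_2_continuous(1)[OF gc])
  moreover have "K \<subseteq> U"
  proof
    fix z assume z: "z \<in> K"
    have "\<bar>g z\<bar> \<le> 1/4" using g(1) z by (simp add: flat_test_def)
    moreover have "z \<in> U1" using g(2)[of "(z, w)" for w] z by (fastforce simp: U1_def A_def unit_dirs_def)
    ultimately show "z \<in> U" by (auto simp: U_def abs_le_iff)
  qed
  moreover have "Ck_on 2 ?h U" using hc by (rule Ck_on_2_subset) simp
  moreover have "\<forall>z\<in>U. 0 \<le> ?h z \<and> ?h z \<le> 1" by (auto simp: U_def)
  moreover have "Re (complex_hessian ?h z w w) \<ge> M * (norm w)\<^sup>2" if z: "z \<in> U" for z w
  proof -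
    have "Re (complex_hessian ?h z w w) = levi_quad g z w"
      using Re_complex_hessian[OF open_UNIV hc UNIV_I] hl[of z w] by (simp add: levi_quad_def)
    moreover have "levi_quad g z w \<ge> M * (norm w)\<^sup>2"
    proof (cases "w = 0")
      case True
      then show ?thesis
        using levi_quad_scaleR[OF open_UNIV gc UNIV_I, of z 0 0] by simp
    next
      case False
      let ?e = "(1 / norm w) *\<^sub>R w"
      have "(z, ?e) \<in> A" using z False by (auto simp: U_def U1_def)
      then have "M < levi_quad g z ?e" by (simp add: A_def)
      moreover have "levi_quad g z w = (norm w)\<^sup>2 * levi_quad g z ?e"
        using levi_quad_scaleR[OF open_UNIV gc UNIV_I, of z "norm w" ?e] False by simp
      ultimately show ?thesis
        using mult_right_mono[of M "levi_quad g z ?e" "(norm w)\<^sup>2"] by (simp add: mult.commute)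
    qed
    ultimately show ?thesis by simp
  qed
  ultimately show "\<exists>U g. open U \<and> K \<subseteq> U \<and> Ck_on 2 g U \<and>
        (\<forall>z\<in>U. 0 \<le> g z \<and> g z \<le> 1) \<and> (\<forall>z\<in>U. \<forall>w. Re (complex_hessian g z w w) \<ge> M * (norm w)\<^sup>2)"
    by (intro exI[of _ U] exI[of _ ?h]) blast
qed

text \<open>The pairs that are not locally removable may be treated by functions \<open>g\<close> with nonnegative Hessian. The
pairs where the Hessian of \<open>g\<close> is not close to \<open>1\<close> are again a compact set of locally removable pairs.\<close>

lemma property_P_if_rest_tested:
  assumes K: "compact K"
    and ex: "\<And>\<epsilon>. \<epsilon> > 0 \<Longrightarrow> \<exists>g. Ck_on 2 g UNIV \<and> (\<forall>z\<in>K. \<bar>g z\<bar> \<le> \<epsilon>) \<and>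
      (\<forall>z w. levi_quad g z w \<ge> 0) \<and> (\<forall>x\<in>unit_dirs K - removable_dirs K. levi_quad g (fst x) (snd x) \<ge> 1)"
  shows "property_P K"
proof (rule property_P_if_all_removable[OF K], rule removableI_approx)
  fix \<epsilon> :: real assume "\<epsilon> > 0" "\<epsilon> < 1"
  then have e: "\<epsilon> / 2 > 0" by simp
  obtain g where g: "Ck_on 2 g UNIV" "\<And>z. z \<in> K \<Longrightarrow> \<bar>g z\<bar> \<le> \<epsilon>/2" "\<And>z w. levi_quad g z w \<ge> 0"
    "\<And>x. x \<in> unit_dirs K - removable_dirs K \<Longrightarrow> levi_quad g (fst x) (snd x) \<ge> 1"
    using ex[OF e] by blast
  define F where "F = unit_dirs K \<inter> {x. levi_quad g (fst x) (snd x) \<le> 1 - \<epsilon>/2}"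
  have "compact F"
    unfolding F_def by (intro compact_Int_closed compact_unit_dirs K closed_levi_quad g)
  have FW: "F \<subseteq> removable_dirs K"
    using g(4) \<open>\<epsilon> > 0\<close> by (fastforce simp: F_def)
  have off: "levi_quad g (fst x) (snd x) \<ge> - (\<epsilon>/2)" for x
    using g(3)[of "fst x" "snd x"] e by linarith
  obtain h where h: "flat_test K (2 * (\<epsilon>/2)) h"
      "\<And>x. x \<in> F \<Longrightarrow> levi_quad h (fst x) (snd x) \<ge> 1"
      "\<And>x. x \<in> unit_dirs K \<Longrightarrow> levi_quad h (fst x) (snd x) \<ge> levi_quad g (fst x) (snd x) - \<epsilon>/2"
    using correct_on_removable[OF K g(1,2) \<open>compact F\<close> FW off e] by blast
  have "levi_quad h (fst x) (snd x) \<ge> 1 - \<epsilon>" if "x \<in> unit_dirs K" for x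
    using h(2)[of x] h(3)[OF that] that \<open>\<epsilon> > 0\<close> by (cases "x \<in> F") (auto simp: F_def)
  then show "\<exists>g. flat_test K \<epsilon> g \<and> (\<forall>x\<in>unit_dirs K. levi_quad g (fst x) (snd x) \<ge> 1 - \<epsilon>)"
    using h(1) by auto
qed

section \<open>Sets of vanishing two-dimensional Hausdorff measure\<close>

text \<open>The sets of a countable cover are enlarged to open balls around one of their points. The enlargements
\<open>e i\<close> have summable squares, so the sum of the squared radii stays under control.\<close>

lemma hausdorff_null_ball_cover:
  fixes A :: "'a::real_normed_vector set"
  assumes "hausdorff_measure 2 A = 0" and "\<eta> > 0"
  obtains c :: "nat \<Rightarrow> 'a" and d :: "nat \<Rightarrow> real" where
    "\<And>i. d i > 0" "A \<subseteq> (\<Union>i. ball (c i) (d i))" "\<And>I. finite I \<Longrightarrow> (\<Sum>i\<in>I. (d i)\<^sup>2) \<le> \<eta>"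
proof -
  have "hausdorff_premeasure 2 1 A \<le> hausdorff_measure 2 A"
    unfolding hausdorff_measure_def by (rule SUP_upper) simp
  then have "hausdorff_premeasure 2 1 A < ennreal (\<eta>/4)"
    using assms by simp
  then obtain C :: "nat \<Rightarrow> 'a set" where C: "A \<subseteq> (\<Union>i. C i)" "\<And>i. bounded (C i)"
    and s: "(\<Sum>i. if C i = {} then 0 else ennreal (diameter (C i) ^ 2)) < ennreal (\<eta>/4)"
    unfolding hausdorff_premeasure_def INF_less_iff by auto
  define e where "e i = sqrt (\<eta>/4 * (1/2) ^ Suc i)" for i :: nat
  have e: "e i > 0" "(e i)\<^sup>2 = \<eta>/4 * (1/2) ^ Suc i" for i
    using assms(2) by (auto simp: e_def)
  define d where "d i = diameter (C i) + e i" for i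
  define c where "c i = (SOME x. x \<in> C i)" for i
  have diam0: "diameter (C i) \<ge> 0" for i
    using C(2) by (rule diameter_ge_0)
  have d0: "d i > 0" for i
    using diam0[of i] e(1)[of i] by (simp add: d_def)
  have "A \<subseteq> (\<Union>i. ball (c i) (d i))"
  proof
    fix x assume "x \<in> A"
    then obtain i where i: "x \<in> C i" using C by auto
    then have "c i \<in> C i" unfolding c_def by (rule someI)
    then have "dist (c i) x \<le> diameter (C i)"
      using diameter_bounded_bound[OF C(2)] i by blast
    then have "x \<in> ball (c i) (d i)" using e(1)[of i] by (simp add: d_def)
    then show "x \<in> (\<Union>i. ball (c i) (d i))" by blast
  qed
  moreover have "(\<Sum>i\<in>I. (d i)\<^sup>2) \<le> \<eta>" if fin: "finite I" for I
  proof -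
    have "ennreal (\<Sum>i\<in>I. (diameter (C i))\<^sup>2) = (\<Sum>i\<in>I. ennreal ((diameter (C i))\<^sup>2))"
      by simp
    also have "\<dots> = (\<Sum>i\<in>I. if C i = {} then 0 else ennreal (diameter (C i) ^ 2))"
      by (intro sum.cong) auto
    also have "\<dots> \<le> (\<Sum>i. if C i = {} then 0 else ennreal (diameter (C i) ^ 2))"
      by (rule sum_le_suminf) (use fin in \<open>auto intro: summableI\<close>)
    also note s
    finally have lt: "ennreal (\<Sum>i\<in>I. (diameter (C i))\<^sup>2) < ennreal (\<eta>/4)" .
    have "0 \<le> (\<Sum>i\<in>I. (diameter (C i))\<^sup>2)" by (rule sum_nonneg) simp
    from ennreal_less_iff[OF this] lt have 1: "(\<Sum>i\<in>I. (diameter (C i))\<^sup>2) \<le> \<eta>/4"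
      by (metis less_imp_le)
    obtain n where n: "I \<subseteq> {..<n}" using fin by (meson finite_nat_iff_bounded)
    have "(\<Sum>i\<in>I. (1/2::real) ^ Suc i) \<le> (\<Sum>i<n. (1/2) ^ Suc i)"
      by (intro sum_mono2 n) auto
    also have "\<dots> = 1 - (1/2) ^ n" by (induction n) auto
    also have "\<dots> \<le> 1" by simp
    finally have "(\<Sum>i\<in>I. (1/2::real) ^ Suc i) \<le> 1" .
    then have 2: "(\<Sum>i\<in>I. (e i)\<^sup>2) \<le> \<eta>/4"
      using assms(2) mult_left_mono[of "\<Sum>i\<in>I. (1/2::real) ^ Suc i" 1 "\<eta>/4"]
      unfolding e(2) sum_distrib_left[symmetric] by simp
    have "(\<Sum>i\<in>I. (d i)\<^sup>2) \<le> (\<Sum>i\<in>I. 2 * (diameter (C i))\<^sup>2 + 2 * (e i)\<^sup>2)"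
    proof (rule sum_mono)
      fix i
      have "0 \<le> (diameter (C i) - e i)\<^sup>2" by simp
      then show "(d i)\<^sup>2 \<le> 2 * (diameter (C i))\<^sup>2 + 2 * (e i)\<^sup>2"
        by (simp add: d_def power2_eq_square algebra_simps)
    qed
    also have "\<dots> = 2 * (\<Sum>i\<in>I. (diameter (C i))\<^sup>2) + 2 * (\<Sum>i\<in>I. (e i)\<^sup>2)"
      by (simp add: sum.distrib sum_distrib_left)
    finally show ?thesis using 1 2 by simp
  qed
  ultimately show ?thesis using that d0 by blast
qed

lemma sum_inverse_sqrt_le: "(\<Sum>k<N. 1 / sqrt (real k + 1)) \<le> 2 * sqrt (real N)"
proof (induction N)
  case (Suc N)
  have "1 / sqrt (real N + 1) \<le> 2 * (sqrt (real N + 1) - sqrt (real N))"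
  proof -
    have "sqrt (real N) * sqrt (real N + 1) \<le> real N + 1/2"
    proof -
      have "sqrt (real N * (real N + 1)) \<le> sqrt ((real N + 1/2)\<^sup>2)"
        by (intro real_sqrt_le_mono) (simp add: power2_eq_square algebra_simps)
      then show ?thesis by (simp add: real_sqrt_mult)
    qed
    moreover have "sqrt (real N + 1) * sqrt (real N + 1) = real N + 1" by simp
    ultimately have "1 \<le> 2 * (sqrt (real N + 1) - sqrt (real N)) * sqrt (real N + 1)"
      by (simp add: algebra_simps)
    then show ?thesis by (simp add: pos_divide_le_eq)
  qed
  then show ?case using Suc by (simp add: algebra_simps)
qed simp

text \<open>A discrete version of the integrability of \<open>\<bar>x - t\<bar>\<^sup>-\<^sup>1\<^sup>/\<^sup>2\<close> on a bounded interval, with a bound that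
depends neither on the mesh \<open>\<delta>\<close> nor on \<open>x\<close>. The grid points on either side of \<open>x\<close> are numbered by
increasing distance; the \<open>k\<close>-th one has distance at least \<open>\<delta> k\<close>.\<close>

lemma sum_grid_inverse_sqrt_le:
  fixes \<delta> R x :: real
  assumes d: "0 < \<delta>" "\<delta> \<le> 1" and x: "\<bar>x\<bar> \<le> R"
  shows "finite {m::int. \<bar>\<delta> * m\<bar> \<le> R}"
    and "(\<Sum>m\<in>{m::int. \<bar>\<delta> * m\<bar> \<le> R}. \<delta> / sqrt (\<delta> + \<bar>x - \<delta> * m\<bar>)) \<le> 4 * sqrt (2 * R + 1)"
proof -
  let ?I = "{m::int. \<bar>\<delta> * m\<bar> \<le> R}"
  define m0 where "m0 = \<lceil>x / \<delta>\<rceil>"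
  have m0: "x \<le> \<delta> * m0" "\<delta> * (m0 - 1) \<le> x"
  proof -
    have "x / \<delta> \<le> m0" "m0 - 1 \<le> x / \<delta>" unfolding m0_def by linarith+
    then show "x \<le> \<delta> * m0" "\<delta> * (m0 - 1) \<le> x" using d by (simp_all add: field_simps)
  qed
  define N where "N = nat \<lfloor>2 * R / \<delta>\<rfloor> + 1"
  have R0: "R \<ge> 0" using x by simp
  have N: "\<delta> * real N \<le> 2 * R + 1"
  proof -
    have "real N \<le> 2 * R / \<delta> + 1" unfolding N_def using R0 d by simp
    then have "\<delta> * real N \<le> \<delta> * (2 * R / \<delta> + 1)" using d by (intro mult_left_mono) auto
    also have "\<delta> * (2 * R / \<delta> + 1) = 2 * R + \<delta>" using d by (simp add: distrib_left)
    finally show ?thesis using d by simp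
  qed
  have less_N: "k < N" if "\<delta> * real k \<le> 2 * R" for k
  proof -
    have "real k \<le> 2 * R / \<delta>" using that d by (simp add: field_simps)
    then have "int k \<le> \<lfloor>2 * R / \<delta>\<rfloor>" by (simp add: le_floor_iff)
    then show ?thesis unfolding N_def by linarith
  qed
  let ?up = "\<lambda>k::nat. m0 + int k" and ?dn = "\<lambda>k::nat. m0 - 1 - int k"
  let ?f = "\<lambda>m::int. \<delta> / sqrt (\<delta> + \<bar>x - \<delta> * m\<bar>)"
  have sub: "?I \<subseteq> ?up ` {..<N} \<union> ?dn ` {..<N}"
  proof
    fix m assume m: "m \<in> ?I"
    show "m \<in> ?up ` {..<N} \<union> ?dn ` {..<N}"
    proof (cases "m \<ge> m0")
      case True
      define k where "k = nat (m - m0)"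
      have k: "m = m0 + int k" using True by (simp add: k_def)
      have "\<delta> * real k = \<delta> * m - \<delta> * m0" by (simp add: k algebra_simps)
      also have "\<dots> \<le> 2 * R" using m m0(1) x by auto
      finally show ?thesis using less_N k by blast
    next
      case False
      define k where "k = nat (m0 - 1 - m)"
      have k: "m = m0 - 1 - int k" using False by (simp add: k_def)
      have "\<delta> * real k = \<delta> * (m0 - 1) - \<delta> * m" by (simp add: k algebra_simps)
      also have "\<dots> \<le> 2 * R" using m m0(2) x by auto
      finally show ?thesis using less_N k by blast
    qed
  qed
  show "finite ?I" by (rule finite_subset[OF sub]) simp
  have half: "(\<Sum>k<N. ?f (h k)) \<le> 2 * sqrt (2 * R + 1)"
    if h: "\<And>k. \<delta> * real k \<le> \<bar>x - \<delta> * (h k)\<bar>" for h :: "nat \<Rightarrow> int"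
  proof -
    have "(\<Sum>k<N. ?f (h k)) \<le> (\<Sum>k<N. sqrt \<delta> * (1 / sqrt (real k + 1)))"
    proof (rule sum_mono)
      fix k
      have "sqrt (\<delta> * (real k + 1)) \<le> sqrt (\<delta> + \<bar>x - \<delta> * (h k)\<bar>)"
        using h[of k] by (intro real_sqrt_le_mono) (simp add: algebra_simps)
      then have "?f (h k) \<le> \<delta> / sqrt (\<delta> * (real k + 1))"
        using d by (intro divide_left_mono mult_pos_pos) (auto simp: add_pos_nonneg)
      also have "\<dots> = sqrt \<delta> * (1 / sqrt (real k + 1))"
        unfolding real_sqrt_mult divide_divide_eq_left[symmetric] using d by (simp add: real_div_sqrt)
      finally show "?f (h k) \<le> sqrt \<delta> * (1 / sqrt (real k + 1))" .
    qed
    also have "\<dots> = sqrt \<delta> * (\<Sum>k<N. 1 / sqrt (real k + 1))"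
      by (simp only: sum_distrib_left)
    also have "\<dots> \<le> sqrt \<delta> * (2 * sqrt (real N))"
      using d by (intro mult_left_mono sum_inverse_sqrt_le) auto
    also have "\<dots> = 2 * sqrt (\<delta> * real N)" by (simp add: real_sqrt_mult)
    also have "\<dots> \<le> 2 * sqrt (2 * R + 1)" using N by simp
    finally show ?thesis .
  qed
  have nn: "?f m \<ge> 0" for m using d by simp
  have up: "(\<Sum>m\<in>?up ` {..<N}. ?f m) \<le> 2 * sqrt (2 * R + 1)"
  proof -
    have "\<delta> * real k \<le> \<bar>x - \<delta> * (?up k)\<bar>" for k using m0(1) by (simp add: algebra_simps)
    from half[OF this] show ?thesis by (subst sum.reindex) (auto simp: inj_on_def)
  qed
  have dn: "(\<Sum>m\<in>?dn ` {..<N}. ?f m) \<le> 2 * sqrt (2 * R + 1)"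
  proof -
    have "\<delta> * real k \<le> \<bar>x - \<delta> * (?dn k)\<bar>" for k using m0(2) by (simp add: algebra_simps)
    from half[OF this] show ?thesis by (subst sum.reindex) (auto simp: inj_on_def)
  qed
  have "(\<Sum>m\<in>?I. ?f m) \<le> (\<Sum>m\<in>?up ` {..<N} \<union> ?dn ` {..<N}. ?f m)"
    using nn by (intro sum_mono2 sub) auto
  also have "\<dots> \<le> (\<Sum>m\<in>?up ` {..<N}. ?f m) + (\<Sum>m\<in>?dn ` {..<N}. ?f m)"
    using nn sum.union_inter[of "?up ` {..<N}" "?dn ` {..<N}" ?f]
      sum_nonneg[of "?up ` {..<N} \<inter> ?dn ` {..<N}" ?f] by simp
  also have "\<dots> \<le> 4 * sqrt (2 * R + 1)" using up dn by simp
  finally show "(\<Sum>m\<in>?I. ?f m) \<le> 4 * sqrt (2 * R + 1)" .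
qed

text \<open>The parameter \<open>s\<close> trades the two terms against each other. Summed over grid squares, the first term
contributes \<open>s\<close> times the total area, and the second one a bounded quantity divided by \<open>s\<close>.\<close>

lemma ln_le_split:
  fixes y s :: real
  assumes "y \<ge> 1" "s > 0"
  shows "ln y \<le> s + 16 * sqrt y / s"
proof -
  have y: "y > 0" using assms by simp
  have l0: "ln y \<ge> 0" using assms by simp
  have "ln y = 4 * ln (sqrt (sqrt y))" using y by (simp add: ln_sqrt)
  also have "\<dots> \<le> 4 * sqrt (sqrt y)" using y ln_le_minus_one[of "sqrt (sqrt y)"] by simp
  finally have "(ln y)\<^sup>2 \<le> (4 * sqrt (sqrt y))\<^sup>2" using l0 by (rule power_mono)
  also have "\<dots> = 16 * sqrt y" using y by (simp add: power_mult_distrib)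
  finally have sq: "(ln y)\<^sup>2 \<le> 16 * sqrt y" .
  have "ln y \<le> s + (ln y)\<^sup>2 / s"
  proof -
    have "0 \<le> (ln y)\<^sup>2 - s * ln y + s\<^sup>2"
      using zero_le_power2[of "ln y - s"] mult_nonneg_nonneg[OF _ l0, of s] assms(2)
      by (simp add: power2_eq_square algebra_simps)
    then show ?thesis using assms(2) by (simp add: field_simps power2_eq_square)
  qed
  also have "\<dots> \<le> s + 16 * sqrt y / s" using sq assms(2) by (simp add: divide_right_mono)
  finally show ?thesis .
qed

text \<open>The logarithmic potential of a union of grid squares of total area \<open>\<delta>\<^sup>2 card G\<close>, regularised at scale \<open>\<delta>\<close>
and normalised to be nonpositive on the square of side \<open>2 R\<close>, is small if the area is small: the constant
of the second term does not depend on \<open>\<delta>\<close> and \<open>G\<close>, so \<open>s\<close> may be chosen large first and the area small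
afterwards. Since \<open>q\<close> is bounded below by a multiple of the product of \<open>\<delta> + \<bar>X - \<delta> m\<bar>\<close> and
\<open>\<delta> + \<bar>Y - \<delta> n\<bar>\<close>, the sum over the planar grid is dominated by a product of two sums over linear grids.\<close>

lemma grid_log_sum_bound:
  fixes \<delta> R X Y s :: real and G :: "(int \<times> int) set"
  assumes d: "0 < \<delta>" "\<delta> \<le> 1" and R: "1 \<le> R" and XY: "\<bar>X\<bar> \<le> R" "\<bar>Y\<bar> \<le> R" and s: "0 < s"
    and G: "G \<subseteq> {m. \<bar>\<delta> * m\<bar> \<le> R} \<times> {n. \<bar>\<delta> * n\<bar> \<le> R}"
  defines "q \<equiv> \<lambda>(m, n). \<delta>\<^sup>2 + (X - \<delta> * of_int m)\<^sup>2 + (Y - \<delta> * of_int n)\<^sup>2"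
  shows "\<bar>\<Sum>c\<in>G. \<delta>\<^sup>2 * ln (q c / (9 * R\<^sup>2))\<bar> \<le> s * (\<delta>\<^sup>2 * card G) + 1536 * R * (2 * R + 1) / s"
proof -
  let ?I = "{m::int. \<bar>\<delta> * m\<bar> \<le> R}"
  have fin: "finite ?I" using sum_grid_inverse_sqrt_le(1)[OF d XY(1)] .
  then have finG: "finite G" using G finite_subset by blast
  define a where "a m = \<delta> / sqrt (\<delta> + \<bar>X - \<delta> * of_int m\<bar>)" for m
  define b where "b m = \<delta> / sqrt (\<delta> + \<bar>Y - \<delta> * of_int m\<bar>)" for m
  have ab: "a m \<ge> 0" "b m \<ge> 0" for m using d by (auto simp: a_def b_def)
  have term_bound: "\<bar>\<delta>\<^sup>2 * ln (q (m, n) / (9 * R\<^sup>2))\<bar> \<le> s * \<delta>\<^sup>2 + 96 * R / s * (a m * b n)"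
    if mn: "(m, n) \<in> G" for m n
  proof -
    define A where "A = \<delta> + \<bar>X - \<delta> * of_int m\<bar>"
    define B where "B = \<delta> + \<bar>Y - \<delta> * of_int n\<bar>"
    define Q where "Q = q (m, n)"
    have AB: "A > 0" "B > 0" using d by (auto simp: A_def B_def)
    have Q0: "Q > 0" using d by (auto simp: Q_def q_def add_pos_nonneg)
    have "\<bar>X - \<delta> * m\<bar> \<le> 2 * R" "\<bar>Y - \<delta> * n\<bar> \<le> 2 * R"
      using mn G XY by auto
    then have "(X - \<delta> * m)\<^sup>2 \<le> (2 * R)\<^sup>2" "(Y - \<delta> * n)\<^sup>2 \<le> (2 * R)\<^sup>2"
      using power_mono[of "\<bar>X - \<delta> * m\<bar>" "2 * R" 2] power_mono[of "\<bar>Y - \<delta> * n\<bar>" "2 * R" 2] by auto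
    moreover have "\<delta>\<^sup>2 \<le> R\<^sup>2" using d R by (intro power_mono) auto
    ultimately have QR: "Q \<le> 9 * R\<^sup>2" by (simp add: Q_def q_def power_mult_distrib)
    have "A * B \<le> 4 * Q"
    proof -
      have "2 * (A * B) \<le> A\<^sup>2 + B\<^sup>2" using sum_squares_bound[of A B] by simp
      moreover have "A\<^sup>2 \<le> 2 * \<delta>\<^sup>2 + 2 * (X - \<delta> * m)\<^sup>2"
        using zero_le_power2[of "\<delta> - \<bar>X - \<delta> * m\<bar>"] by (simp add: A_def power2_sum power2_diff)
      moreover have "B\<^sup>2 \<le> 2 * \<delta>\<^sup>2 + 2 * (Y - \<delta> * n)\<^sup>2"
        using zero_le_power2[of "\<delta> - \<bar>Y - \<delta> * n\<bar>"] by (simp add: B_def power2_sum power2_diff)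
      moreover have "Q = \<delta>\<^sup>2 + (X - \<delta> * m)\<^sup>2 + (Y - \<delta> * n)\<^sup>2"
        by (simp add: Q_def q_def)
      ultimately show ?thesis using zero_le_power2[of \<delta>] zero_le_power2[of "X - \<delta> * m"] zero_le_power2[of "Y - \<delta> * n"] by linarith
    qed
    then have "sqrt (A * B) \<le> sqrt (2\<^sup>2 * Q)" by simp
    then have sq: "sqrt A * sqrt B \<le> 2 * sqrt Q" by (simp add: real_sqrt_mult)
    let ?y = "9 * R\<^sup>2 / Q"
    have y1: "?y \<ge> 1" using QR Q0 by simp
    have "ln (Q / (9 * R\<^sup>2)) = - ln ?y"
      using Q0 R by (simp add: ln_div)
    then have "\<bar>\<delta>\<^sup>2 * ln (Q / (9 * R\<^sup>2))\<bar> = \<delta>\<^sup>2 * ln ?y"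
      using y1 by (simp add: abs_mult)
    also have "\<dots> \<le> \<delta>\<^sup>2 * (s + 16 * sqrt ?y / s)"
      by (intro mult_left_mono ln_le_split y1 s) simp
    also have "sqrt ?y = 3 * R / sqrt Q"
      using R by (simp add: real_sqrt_divide real_sqrt_mult)
    also have "\<delta>\<^sup>2 * (s + 16 * (3 * R / sqrt Q) / s) = s * \<delta>\<^sup>2 + 48 * R / s * (\<delta>\<^sup>2 / sqrt Q)"
      by (simp add: algebra_simps)
    also have "\<dots> \<le> s * \<delta>\<^sup>2 + 48 * R / s * (2 * (a m * b n))"
    proof -
      have "\<delta>\<^sup>2 / sqrt Q \<le> \<delta>\<^sup>2 / (sqrt A * sqrt B / 2)"
        using sq AB Q0 by (intro divide_left_mono mult_pos_pos) auto
      also have "\<dots> = 2 * (a m * b n)"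
        by (simp add: a_def b_def A_def B_def power2_eq_square)
      finally show ?thesis using R s by (intro add_left_mono mult_left_mono) auto
    qed
    finally show ?thesis by (simp add: Q_def)
  qed
  have "\<bar>\<Sum>c\<in>G. \<delta>\<^sup>2 * ln (q c / (9 * R\<^sup>2))\<bar> \<le> (\<Sum>c\<in>G. \<bar>\<delta>\<^sup>2 * ln (q c / (9 * R\<^sup>2))\<bar>)"
    by (rule sum_abs)
  also have "\<dots> \<le> (\<Sum>c\<in>G. s * \<delta>\<^sup>2 + 96 * R / s * (a (fst c) * b (snd c)))"
    using term_bound by (intro sum_mono) (metis prod.collapse)
  also have "\<dots> = s * (\<delta>\<^sup>2 * card G) + 96 * R / s * (\<Sum>c\<in>G. a (fst c) * b (snd c))"
    by (simp add: sum.distrib sum_distrib_left)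
  also have "\<dots> \<le> s * (\<delta>\<^sup>2 * card G) + 96 * R / s * (16 * (2 * R + 1))"
  proof -
    have "(\<Sum>c\<in>G. a (fst c) * b (snd c)) \<le> (\<Sum>c\<in>?I \<times> ?I. a (fst c) * b (snd c))"
      using ab fin by (intro sum_mono2 G) auto
    also have "\<dots> = (\<Sum>m\<in>?I. a m) * (\<Sum>n\<in>?I. b n)"
      by (simp add: sum_product sum.cartesian_product case_prod_beta)
    also have "\<dots> \<le> (4 * sqrt (2 * R + 1)) * (4 * sqrt (2 * R + 1))"
      using sum_grid_inverse_sqrt_le(2)[OF d XY(1)] sum_grid_inverse_sqrt_le(2)[OF d XY(2)] R ab
      by (intro mult_mono sum_nonneg) (auto simp: a_def b_def)
    also have "\<dots> = 16 * (2 * R + 1)" using R by simp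
    finally show ?thesis using R s by (intro add_left_mono mult_left_mono) auto
  qed
  also have "96 * R / s * (16 * (2 * R + 1)) = 1536 * R * (2 * R + 1) / s"
    by simp
  finally show ?thesis .
qed

lemma card_grid_interval:
  fixes \<delta> r x :: real
  assumes "0 < \<delta>" "\<delta> \<le> r"
  shows "finite {m::int. \<bar>\<delta> * m - x\<bar> \<le> 2 * r}" "real (card {m::int. \<bar>\<delta> * m - x\<bar> \<le> 2 * r}) \<le> 5 * r / \<delta>"
proof -
  let ?S = "{m::int. \<bar>\<delta> * m - x\<bar> \<le> 2 * r}" and ?l = "\<lceil>(x - 2 * r) / \<delta>\<rceil>" and ?u = "\<lfloor>(x + 2 * r) / \<delta>\<rfloor>"
  have sub: "?S \<subseteq> {?l..?u}"
    using assms by (auto simp: ceiling_le_iff le_floor_iff field_simps abs_le_iff)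
  then show "finite ?S" by (rule finite_subset) simp
  have "card ?S \<le> nat (?u - ?l + 1)"
    using card_mono[OF _ sub] by simp
  moreover have "real (nat (?u - ?l + 1)) \<le> 5 * r / \<delta>"
  proof -
    have "1 \<le> r / \<delta>" using assms by simp
    have "of_int (?u - ?l + 1) \<le> (x + 2 * r) / \<delta> - (x - 2 * r) / \<delta> + 1"
      using of_int_floor_le[of "(x + 2 * r) / \<delta>"] le_of_int_ceiling[of "(x - 2 * r) / \<delta>"] by simp linarith
    also have "\<dots> = 4 * (r / \<delta>) + 1" by (simp add: diff_divide_distrib add_divide_distrib)
    also have "\<dots> \<le> 5 * r / \<delta>" using \<open>1 \<le> r / \<delta>\<close> by simp
    finally have "of_int (?u - ?l + 1) \<le> 5 * r / \<delta>" .
    moreover have "0 \<le> 5 * r / \<delta>" using assms by simp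
    ultimately show ?thesis by (cases "?u - ?l + 1 \<ge> 0") (simp_all del: of_int_add of_int_diff)
  qed
  ultimately show "real (card ?S) \<le> 5 * r / \<delta>" by linarith
qed

lemma levi_quad_sum:
  fixes f :: "'i \<Rightarrow> complex^'n::finite \<Rightarrow> real"
  assumes "finite I" "open U" "\<And>i. i \<in> I \<Longrightarrow> Ck_on 2 (f i) U"
  shows "Ck_on 2 (\<lambda>z. \<Sum>i\<in>I. f i z) U \<and> (\<forall>z\<in>U. \<forall>w. levi_quad (\<lambda>z. \<Sum>i\<in>I. f i z) z w = (\<Sum>i\<in>I. levi_quad (f i) z w))"
  using assms(1,3)
proof (induction I)
  case empty
  then show ?case using Ck_on_2_const[OF assms(2), of 0]
    by (simp add: levi_quad_def dir_deriv2_def dir_deriv_def)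
next
  case (insert i I)
  then have i: "Ck_on 2 (f i) U" and r: "Ck_on 2 (\<lambda>z. \<Sum>i\<in>I. f i z) U" by auto
  show ?case
    using insert Ck_on_2_add(1)[OF assms(2) i r] levi_quad_add[OF assms(2) i r] by simp
qed

text \<open>The regularised logarithmic kernel in one complex coordinate is plurisubharmonic, and its Hessian is of
size \<open>\<delta>\<^sup>-\<^sup>2\<close> at distance \<open>\<delta>\<close> from its centre.\<close>

lemma log_kernel:
  fixes j :: "'n::finite" and a b \<delta> Q :: real
  assumes d: "\<delta> > 0" and Q: "Q > 0"
  defines "q \<equiv> \<lambda>z :: complex^'n. \<delta>\<^sup>2 + (Re (z $ j) - a)\<^sup>2 + (Im (z $ j) - b)\<^sup>2"
  shows "Ck_on 2 (\<lambda>z. ln (q z / Q)) UNIV"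
    and "levi_quad (\<lambda>z. ln (q z / Q)) z w = \<delta>\<^sup>2 * (cmod (w $ j))\<^sup>2 / (q z)\<^sup>2"
proof -
  have q0: "q z > 0" for z using d by (simp add: q_def add_pos_nonneg)
  have coord: "((\<lambda>x :: complex^'n. x $ j) has_derivative (\<lambda>v. v $ j)) (at z)" for z
    by (intro bounded_linear_imp_has_derivative bounded_linear_vec_nth)
  have d1: "(q has_derivative (\<lambda>v. 2 * (Re (z $ j) - a) * Re (v $ j) + 2 * (Im (z $ j) - b) * Im (v $ j))) (at z)" for z
    unfolding q_def by (auto intro!: derivative_eq_intros coord simp: algebra_simps)
  have d2: "((\<lambda>y. 2 * (Re (y $ j) - a) * Re (v $ j) + 2 * (Im (y $ j) - b) * Im (v $ j)) has_derivative
      (\<lambda>u. 2 * Re (u $ j) * Re (v $ j) + 2 * Im (u $ j) * Im (v $ j))) (at z)" for z v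
    by (auto intro!: derivative_eq_intros coord simp: algebra_simps)
  note qq = Ck_on_2I[OF open_UNIV d1 d2 continuous_on_const]
  have lq: "levi_quad q z w = (cmod (w $ j))\<^sup>2" for z w
    by (simp add: levi_quad_def qq(3) cmod_power2) (simp add: power2_eq_square)
  note c = levi_quad_compose[OF open_UNIV qq(1), of "\<lambda>t. ln (t / Q)" "\<lambda>t. 1 / t" "\<lambda>t. - (1 / t\<^sup>2)"]
  have p: "((\<lambda>t. ln (t / Q)) has_field_derivative 1 / t) (at t)"
    "((\<lambda>t. 1 / t) has_field_derivative - (1 / t\<^sup>2)) (at t)" if "t > 0" for t :: real
    using that Q by (auto intro!: derivative_eq_intros simp: power2_eq_square)
  have pc: "continuous_on (q ` UNIV) (\<lambda>t. - (1 / t\<^sup>2))"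
    using q0 by (auto intro!: continuous_intros simp: less_imp_neq[THEN not_sym] dest: less_imp_neq)
  show "Ck_on 2 (\<lambda>z. ln (q z / Q)) UNIV"
    by (rule c(1)[OF p(1)[OF q0] p(2)[OF q0] pc])
  have "levi_quad (\<lambda>z. ln (q z / Q)) z w = 1 / q z * levi_quad q z w +
      - (1 / (q z)\<^sup>2) * ((dir_deriv q z w)\<^sup>2 + (dir_deriv q z (\<i> *s w))\<^sup>2) / 4"
    by (rule c(2)[OF p(1)[OF q0] p(2)[OF q0] pc UNIV_I])
  also have "(dir_deriv q z w)\<^sup>2 + (dir_deriv q z (\<i> *s w))\<^sup>2 = 4 * (q z - \<delta>\<^sup>2) * (cmod (w $ j))\<^sup>2"
  proof -
    have "q z - \<delta>\<^sup>2 = (Re (z $ j) - a)\<^sup>2 + (Im (z $ j) - b)\<^sup>2" by (simp add: q_def)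
    then show ?thesis
      unfolding qq(2)[OF UNIV_I] cmod_power2 \<open>q z - \<delta>\<^sup>2 = _\<close>
      by (simp add: power2_eq_square algebra_simps)
  qed
  also have "1 / q z * levi_quad q z w + - (1 / (q z)\<^sup>2) * (4 * (q z - \<delta>\<^sup>2) * (cmod (w $ j))\<^sup>2) / 4
      = \<delta>\<^sup>2 * (cmod (w $ j))\<^sup>2 / (q z)\<^sup>2"
    using q0[of z] by (simp add: lq field_simps power2_eq_square)
  finally show "levi_quad (\<lambda>z. ln (q z / Q)) z w = \<delta>\<^sup>2 * (cmod (w $ j))\<^sup>2 / (q z)\<^sup>2" .
qed

text \<open>Cover \<open>S\<close> by finitely many balls with small sum of squared radii and take a grid whose mesh \<open>\<delta>\<close> is at
most every radius. In each coordinate plane the grid points near the projected balls number at most a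
constant times that sum divided by \<open>\<delta>\<^sup>2\<close>. Over \<open>S\<close> one of the kernels of each coordinate is within
distance \<open>2 \<delta>\<close> of its centre, which makes the Hessian large, while \<open>grid_log_sum_bound\<close> keeps the sum
of all kernels small.\<close>

lemma small_psh_test_on_null_set:
  fixes S K A :: "(complex^'n::finite) set"
  assumes S: "compact S" "S \<subseteq> A" "hausdorff_measure 2 A = 0" and K: "bounded K" and e: "\<epsilon> > 0"
  shows "\<exists>g. Ck_on 2 g UNIV \<and> (\<forall>z\<in>K. \<bar>g z\<bar> \<le> \<epsilon>) \<and> (\<forall>z w. levi_quad g z w \<ge> 0) \<and>
     (\<forall>z\<in>S. \<forall>w. levi_quad g z w \<ge> (norm w)\<^sup>2)"
proof -
  have "bounded (S \<union> K)" using S(1) K by (simp add: compact_imp_bounded)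
  then obtain R0 where R0: "R0 > 0" "\<And>z. z \<in> S \<union> K \<Longrightarrow> norm z \<le> R0"
    unfolding bounded_pos by blast
  \<comment> \<open>the extra \<open>1\<close> makes room for the grid point next to a point of \<open>S\<close>, since the mesh is at most \<open>1\<close>\<close>
  define R where "R = R0 + 1"
  have R: "R \<ge> 1" using R0 by (simp add: R_def)
  have coord: "\<bar>Re (z $ j)\<bar> \<le> R0" "\<bar>Im (z $ j)\<bar> \<le> R0" if "z \<in> S \<union> K" for z j
    using R0(2)[OF that] Finite_Cartesian_Product.norm_nth_le[of z j] abs_Re_le_cmod[of "z $ j"] abs_Im_le_cmod[of "z $ j"]
    by linarith+
  define N where "N = real CARD('n)"
  have N: "N > 0" by (simp add: N_def)
  define B where "B = 1536 * R * (2 * R + 1)"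
  have B: "B > 0" using R by (simp add: B_def)
  \<comment> \<open>the bound of \<open>grid_log_sum_bound\<close>, summed over the \<open>N\<close> coordinates with weight \<open>9\<close> and for area at
    most \<open>25 \<eta>\<close>, is \<open>225 N s \<eta> + 9 N B / s\<close>; both terms are made equal to \<open>\<epsilon> / 2\<close>\<close>
  define s where "s = 18 * N * B / \<epsilon>"
  have s: "s > 0" using N B e by (simp add: s_def)
  define \<eta> where "\<eta> = \<epsilon> / (450 * N * s)"
  have eta: "\<eta> > 0" using N s e by (simp add: \<eta>_def)
  obtain c :: "nat \<Rightarrow> complex^'n" and d where d: "\<And>i. d i > 0" and cov: "A \<subseteq> (\<Union>i. ball (c i) (d i))"
    and sum_d: "\<And>I. finite I \<Longrightarrow> (\<Sum>i\<in>I. (d i)\<^sup>2) \<le> \<eta>"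
    using hausdorff_null_ball_cover[OF S(3) eta] by metis
  have "S \<subseteq> (\<Union>i\<in>UNIV. ball (c i) (d i))" using S(2) cov by blast
  then obtain I where I: "finite I" "S \<subseteq> (\<Union>i\<in>I. ball (c i) (d i))"
    by (rule compactE_image[OF S(1) open_ball])
  define \<delta> where "\<delta> = Min (insert 1 (d ` I))"
  have \<delta>: "0 < \<delta>" "\<delta> \<le> 1" and \<delta>d: "\<And>i. i \<in> I \<Longrightarrow> \<delta> \<le> d i"
    using I(1) d by (auto simp: \<delta>_def)
  define box where "box i j = {m. \<bar>\<delta> * of_int m - Re (c i $ j)\<bar> \<le> 2 * d i} \<times>
      {n. \<bar>\<delta> * of_int n - Im (c i $ j)\<bar> \<le> 2 * d i}" for i j
  define G where "G j = (\<Union>i\<in>I. box i j) \<inter>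
      ({m. \<bar>\<delta> * of_int m\<bar> \<le> R} \<times> {n. \<bar>\<delta> * of_int n\<bar> \<le> R})" for j
  have finbox: "finite (box i j)" and cardbox: "real (card (box i j)) \<le> (5 * d i / \<delta>)\<^sup>2" if "i \<in> I" for i j
  proof -
    note c1 = card_grid_interval[OF \<delta>(1) \<delta>d[OF that]]
    show "finite (box i j)" unfolding box_def by (intro finite_cartesian_product c1)
    show "real (card (box i j)) \<le> (5 * d i / \<delta>)\<^sup>2"
      unfolding box_def card_cartesian_product of_nat_mult power2_eq_square
      using \<delta>(1) d[of i] by (intro mult_mono c1) auto
  qed
  have finG: "finite (G j)" for j using I(1) finbox by (auto simp: G_def)
  have cardG: "\<delta>\<^sup>2 * real (card (G j)) \<le> 25 * \<eta>" for j
  proof -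
    have "card (G j) \<le> card (\<Union>i\<in>I. box i j)"
      using I(1) finbox by (intro card_mono) (auto simp: G_def)
    also have "\<dots> \<le> (\<Sum>i\<in>I. card (box i j))" by (rule card_UN_le[OF I(1)])
    finally have "real (card (G j)) \<le> (\<Sum>i\<in>I. real (card (box i j)))"
      by (metis of_nat_le_iff of_nat_sum)
    also have "\<dots> \<le> (\<Sum>i\<in>I. (5 * d i / \<delta>)\<^sup>2)" by (intro sum_mono cardbox)
    also have "\<dots> = 25 / \<delta>\<^sup>2 * (\<Sum>i\<in>I. (d i)\<^sup>2)"
      unfolding sum_distrib_left by (intro sum.cong refl) (simp add: power_divide power_mult_distrib)
    also have "\<dots> \<le> 25 / \<delta>\<^sup>2 * \<eta>" using sum_d[OF I(1)] by (intro mult_left_mono) auto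
    finally have "\<delta>\<^sup>2 * real (card (G j)) \<le> \<delta>\<^sup>2 * (25 / \<delta>\<^sup>2 * \<eta>)" by (intro mult_left_mono) auto
    then show ?thesis using \<delta> by simp
  qed
  define q where "q j p z = \<delta>\<^sup>2 + (Re (z $ j) - \<delta> * of_int (fst p))\<^sup>2 + (Im (z $ j) - \<delta> * of_int (snd p))\<^sup>2"
    for j :: 'n and p :: "int \<times> int" and z :: "complex^'n"
  have q0: "q j p z > 0" for j p z using \<delta> by (simp add: q_def add_pos_nonneg)
  have "9 * R\<^sup>2 > 0" using R by simp
  note k = log_kernel[OF \<delta>(1) this]
  have ker: "Ck_on 2 (\<lambda>z. ln (q j p z / (9 * R\<^sup>2))) UNIV"
    "levi_quad (\<lambda>z. ln (q j p z / (9 * R\<^sup>2))) z w = \<delta>\<^sup>2 * (cmod (w $ j))\<^sup>2 / (q j p z)\<^sup>2" for j p z w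
    unfolding q_def by (rule k)+
  note kerm = levi_quad_cmult[OF open_UNIV ker(1), where c = "9 * \<delta>\<^sup>2"]
  \<comment> \<open>the weight \<open>9\<close> compensates \<open>q \<le> 3 \<delta>\<^sup>2\<close> at the points of \<open>S\<close>\<close>
  define g1 where "g1 j z = (\<Sum>p\<in>G j. 9 * \<delta>\<^sup>2 * ln (q j p z / (9 * R\<^sup>2)))" for j z
  define g where "g z = (\<Sum>j\<in>UNIV. g1 j z)" for z
  have g1: "Ck_on 2 (g1 j) UNIV" "levi_quad (g1 j) z w = (\<Sum>p\<in>G j. 9 * \<delta>\<^sup>2 * (\<delta>\<^sup>2 * (cmod (w $ j))\<^sup>2 / (q j p z)\<^sup>2))" for j z w
    using levi_quad_sum[OF finG[of j] open_UNIV, where f = "\<lambda>p z. 9 * \<delta>\<^sup>2 * ln (q j p z / (9 * R\<^sup>2))", OF kerm(1)]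
    unfolding g1_def[abs_def] by (simp_all add: kerm(2) ker(2))
  have g: "Ck_on 2 g UNIV" "levi_quad g z w = (\<Sum>j\<in>UNIV. levi_quad (g1 j) z w)" for z w
    using levi_quad_sum[where f = g1, OF finite_class.finite_UNIV open_UNIV g1(1)] unfolding g_def[abs_def] by auto
  have nn: "0 \<le> 9 * \<delta>\<^sup>2 * (\<delta>\<^sup>2 * (cmod (w $ j))\<^sup>2 / (q j p z)\<^sup>2)" for j p z w by simp
  have "levi_quad g z w \<ge> 0" for z w
    unfolding g g1 by (intro sum_nonneg nn)
  moreover have "\<bar>g z\<bar> \<le> \<epsilon>" if z: "z \<in> K" for z
  proof -
    have "\<bar>g1 j z\<bar> \<le> 9 * (s * (25 * \<eta>) + B / s)" for j
    proof -
      have "\<bar>Re (z $ j)\<bar> \<le> R" "\<bar>Im (z $ j)\<bar> \<le> R" using coord[of z j] z by (auto simp: R_def)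
      note b = grid_log_sum_bound[OF \<delta> R this s, of "G j"]
      have "G j \<subseteq> {m. \<bar>\<delta> * of_int m\<bar> \<le> R} \<times> {n. \<bar>\<delta> * of_int n\<bar> \<le> R}" by (auto simp: G_def)
      from b[OF this] have b': "\<bar>\<Sum>p\<in>G j. \<delta>\<^sup>2 * ln (q j p z / (9 * R\<^sup>2))\<bar> \<le> s * (\<delta>\<^sup>2 * card (G j)) + B / s"
        by (simp add: q_def case_prod_beta B_def)
      have "g1 j z = 9 * (\<Sum>p\<in>G j. \<delta>\<^sup>2 * ln (q j p z / (9 * R\<^sup>2)))"
        by (simp add: g1_def sum_distrib_left mult.assoc)
      then have "\<bar>g1 j z\<bar> \<le> 9 * (s * (\<delta>\<^sup>2 * card (G j)) + B / s)" using b' by (simp add: abs_mult)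
      also have "\<dots> \<le> 9 * (s * (25 * \<eta>) + B / s)"
        using cardG[of j] s by (intro mult_left_mono add_right_mono) auto
      finally show ?thesis .
    qed
    then have "\<bar>g z\<bar> \<le> (\<Sum>j\<in>(UNIV::'n set). 9 * (s * (25 * \<eta>) + B / s))"
      unfolding g_def by (intro order_trans[OF sum_abs] sum_mono)
    also have "\<dots> = N * (9 * (s * (25 * \<eta>) + B / s))" by (simp add: N_def)
    also have "\<dots> = \<epsilon>"
    proof -
      define t where "t = B / s"
      have "N * s * \<eta> * 450 = \<epsilon>" using N s by (simp add: \<eta>_def)
      moreover have "N * t * 18 = \<epsilon>" using N B e by (simp add: t_def s_def field_simps)
      ultimately show ?thesis unfolding t_def[symmetric] by (simp add: algebra_simps)
    qed
    finally show ?thesis .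
  qed
  moreover have "levi_quad g z w \<ge> (norm w)\<^sup>2" if z: "z \<in> S" for z w
  proof -
    obtain i where i: "i \<in> I" "z \<in> ball (c i) (d i)" using I(2) z by auto
    have "levi_quad (g1 j) z w \<ge> (cmod (w $ j))\<^sup>2" for j
    proof -
      define m where "m = \<lfloor>Re (z $ j) / \<delta>\<rfloor>"
      define n where "n = \<lfloor>Im (z $ j) / \<delta>\<rfloor>"
      have fl: "\<delta> * \<lfloor>t / \<delta>\<rfloor> \<le> t \<and> t \<le> \<delta> * \<lfloor>t / \<delta>\<rfloor> + \<delta>" for t :: real
      proof -
        have fl: "of_int \<lfloor>t / \<delta>\<rfloor> \<le> t / \<delta>" "t / \<delta> \<le> of_int \<lfloor>t / \<delta>\<rfloor> + 1" by linarith+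
        have "\<delta> * of_int \<lfloor>t / \<delta>\<rfloor> \<le> \<delta> * (t / \<delta>)" "\<delta> * (t / \<delta>) \<le> \<delta> * (of_int \<lfloor>t / \<delta>\<rfloor> + 1)"
          using \<delta>(1) by (intro mult_left_mono fl; simp)+
        moreover have "\<delta> * (t / \<delta>) = t" using \<delta> by simp
        ultimately show ?thesis by (simp add: distrib_left)
      qed
      have mn: "\<bar>Re (z $ j) - \<delta> * m\<bar> \<le> \<delta>" "\<bar>Im (z $ j) - \<delta> * n\<bar> \<le> \<delta>"
        using fl[of "Re (z $ j)"] fl[of "Im (z $ j)"] by (auto simp: m_def n_def abs_le_iff)
      have "norm ((z - c i) $ j) < d i"
        using i(2) Finite_Cartesian_Product.norm_nth_le[of "z - c i" j] by (simp add: dist_norm norm_minus_commute)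
      then have "\<bar>Re (z $ j) - Re (c i $ j)\<bar> < d i" "\<bar>Im (z $ j) - Im (c i $ j)\<bar> < d i"
        using abs_Re_le_cmod[of "(z - c i) $ j"] abs_Im_le_cmod[of "(z - c i) $ j"] by auto
      then have "(m, n) \<in> box i j"
        using mn \<delta>d[OF i(1)] unfolding box_def by auto
      moreover have "\<bar>\<delta> * m\<bar> \<le> R" "\<bar>\<delta> * n\<bar> \<le> R"
        using mn coord[of z j] z \<delta>(2) by (auto simp: R_def)
      ultimately have G: "(m, n) \<in> G j" using i(1) by (auto simp: G_def)
      have "(Re (z $ j) - \<delta> * m)\<^sup>2 \<le> \<delta>\<^sup>2" "(Im (z $ j) - \<delta> * n)\<^sup>2 \<le> \<delta>\<^sup>2"
        using power_mono[OF mn(1), of 2] power_mono[OF mn(2), of 2] by auto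
      then have "q j (m, n) z \<le> 3 * \<delta>\<^sup>2" by (simp add: q_def)
      then have "(q j (m, n) z)\<^sup>2 \<le> (3 * \<delta>\<^sup>2)\<^sup>2" using q0[of j "(m, n)" z] by (intro power_mono) auto
      then have "(cmod (w $ j))\<^sup>2 * (q j (m, n) z)\<^sup>2 \<le> (cmod (w $ j))\<^sup>2 * (3 * \<delta>\<^sup>2)\<^sup>2"
        by (rule mult_left_mono) simp
      then have "(cmod (w $ j))\<^sup>2 \<le> 9 * \<delta>\<^sup>2 * (\<delta>\<^sup>2 * (cmod (w $ j))\<^sup>2 / (q j (m, n) z)\<^sup>2)"
        using q0[of j "(m, n)" z] by (simp add: field_simps power2_eq_square)
      also have "\<dots> \<le> levi_quad (g1 j) z w"
        unfolding g1 by (rule member_le_sum[OF G nn finG])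
      finally show ?thesis .
    qed
    then have "(\<Sum>j\<in>UNIV. (cmod (w $ j))\<^sup>2) \<le> levi_quad g z w"
      unfolding g by (intro sum_mono)
    moreover have "(\<Sum>j\<in>UNIV. (cmod (w $ j))\<^sup>2) = (norm w)\<^sup>2"
      by (simp add: norm_vec_def L2_set_def sum_nonneg)
    ultimately show ?thesis by simp
  qed
  ultimately show ?thesis using g(1) by blast
qed

section \<open>Localised test functions\<close>

text \<open>The cube of the positive part of \<open>\<rho>\<^sup>2 - |z - z0|\<^sup>2\<close>; the cube of the positive part is the lowest power that
is \<open>C\<^sup>2\<close> at \<open>0\<close>.\<close>

lemma C2_bump:
  fixes z0 :: "'a::euclidean_space"
  assumes "\<rho> > 0"
  obtains \<psi> :: "'a \<Rightarrow> real" where "Ck_on 2 \<psi> UNIV" "\<And>z. \<psi> z \<ge> 0" "\<psi> z0 > 0"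
    "\<And>z. z \<notin> ball z0 \<rho> \<Longrightarrow> \<psi> z = 0"
proof -
  define q where "q z = \<rho>\<^sup>2 - (z - z0) \<bullet> (z - z0)" for z
  have d1: "(q has_derivative (\<lambda>v. - 2 * ((z - z0) \<bullet> v))) (at z)" for z
    unfolding q_def by (auto intro!: derivative_eq_intros simp: inner_commute)
  have d2: "((\<lambda>z. - 2 * ((z - z0) \<bullet> v)) has_derivative (\<lambda>u. - 2 * (u \<bullet> v))) (at z)" for z v
    by (auto intro!: derivative_eq_intros)
  note q = Ck_on_2I(1)[OF open_UNIV d1 d2 continuous_on_const]
  note q = q d1
  define \<phi> where "\<phi> k t = (max 0 t) ^ k" for k and t :: real
  have deriv: "(\<phi> (n + 2) has_real_derivative real (n + 2) * \<phi> (n + 1) t) (at t)" for n and t :: real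
  proof -
    consider "t > 0" | "t < 0" | "t = 0" by linarith
    then show ?thesis
    proof cases
      case 1
      have "((\<lambda>t. t ^ (n + 2)) has_real_derivative real (n + 2) * t ^ (n + 1)) (at t)"
        using DERIV_pow[of "n + 2" t] by simp
      then have "(\<phi> (n + 2) has_real_derivative real (n + 2) * t ^ (n + 1)) (at t)"
        by (rule has_field_derivative_transform_within_open[of _ _ _ "{0<..}"]) (use 1 in \<open>auto simp: \<phi>_def\<close>)
      then show ?thesis using 1 by (simp add: \<phi>_def)
    next
      case 2
      have "(\<phi> (n + 2) has_real_derivative 0) (at t)"
        by (rule has_field_derivative_transform_within_open[of "\<lambda>_. 0" _ _ "{..<0}"]) (use 2 in \<open>auto simp: \<phi>_def\<close>)
      then show ?thesis using 2 by (simp add: \<phi>_def)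
    next
      case 3
      have "\<phi> (n + 2) z - \<phi> (n + 2) 0 = \<phi> (n + 1) z * (z - 0)" for z
        by (auto simp: \<phi>_def max_def)
      moreover have "isCont (\<phi> (n + 1)) 0"
        unfolding \<phi>_def by (intro continuous_intros)
      moreover have "\<phi> (n + 1) 0 = 0" by (simp add: \<phi>_def)
      ultimately show ?thesis unfolding CARAT_DERIV 3 by (intro exI[of _ "\<phi> (n + 1)"]) simp
    qed
  qed
  have p1: "(\<phi> 3 has_real_derivative 3 * \<phi> 2 t) (at t)" for t
    using deriv[of 1 t] by (simp add: numeral_2_eq_2 numeral_3_eq_3)
  have p2: "((\<lambda>t. 3 * \<phi> 2 t) has_real_derivative 3 * (2 * \<phi> 1 t)) (at t)" for t
    using DERIV_cmult[OF deriv[of 0 t], of 3] by (simp add: numeral_2_eq_2)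
  have pc: "continuous_on (q ` UNIV) (\<lambda>t. 3 * (2 * \<phi> 1 t))"
    unfolding \<phi>_def by (intro continuous_intros)
  have "Ck_on 2 (\<lambda>z. \<phi> 3 (q z)) UNIV"
    by (rule Ck_on_2_compose(1)[OF open_UNIV q(1) p1 p2 pc])
  moreover have "\<phi> 3 (q z) \<ge> 0" for z by (simp add: \<phi>_def)
  moreover have "\<phi> 3 (q z0) > 0" using assms by (simp add: \<phi>_def q_def)
  moreover have "\<phi> 3 (q z) = 0" if "z \<notin> ball z0 \<rho>" for z
  proof -
    have "\<rho> \<le> norm (z - z0)" using that by (simp add: dist_norm norm_minus_commute)
    then have "\<rho>\<^sup>2 \<le> (norm (z - z0))\<^sup>2" using assms by (intro power_mono) auto
    then show ?thesis by (simp add: \<phi>_def q_def power2_norm_eq_inner)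
  qed
  ultimately show ?thesis using that by blast
qed

text \<open>Turns a function given near a point into a global one that keeps its zeros: it is multiplied by a bump
function whose support is a small ball around \<open>z0\<close>.\<close>

lemma localize_at:
  fixes F :: "complex^'n::finite \<Rightarrow> real"
  assumes U: "open U" "z0 \<in> U" and F: "Ck_on 2 F U"
  obtains \<psi> h where "Ck_on 2 \<psi> UNIV" "\<And>z. \<psi> z \<ge> 0" "\<psi> z0 > 0"
    "Ck_on 2 h UNIV" "\<And>z. z \<in> U \<Longrightarrow> h z = \<psi> z * F z" "\<And>z. z \<notin> U \<Longrightarrow> h z = 0"
    "\<And>z w. z \<notin> U \<Longrightarrow> levi_quad h z w = 0"
proof -
  obtain \<rho> where \<rho>: "\<rho> > 0" "cball z0 \<rho> \<subseteq> U"
    using U open_contains_cball by blast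
  obtain \<psi> :: "complex^'n \<Rightarrow> real" where \<psi>: "Ck_on 2 \<psi> UNIV" "\<And>z. \<psi> z \<ge> 0" "\<psi> z0 > 0"
    "\<And>z. z \<notin> ball z0 \<rho> \<Longrightarrow> \<psi> z = 0"
    using C2_bump[OF \<rho>(1)] by metis
  define h where "h z = (if z \<in> U then \<psi> z * F z else 0)" for z
  have "Ck_on 2 (\<lambda>z. \<psi> z * F z) U"
    by (rule Ck_on_2_mult(1)[OF U(1) Ck_on_2_subset[OF \<psi>(1) subset_UNIV] F])
  then have 1: "Ck_on 2 h U"
    by (rule Ck_on_2_cong_open(1)[OF U(1)]) (simp add: h_def)
  let ?V = "- cball z0 \<rho>"
  have V: "open ?V" by (simp add: open_Compl)
  have z: "0 = h z" if "z \<in> ?V" for z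
    using that \<psi>(4)[of z] by (simp add: h_def)
  note c = Ck_on_2_cong_open[OF V Ck_on_2_const[OF V] z]
  have "Ck_on 2 h (U \<union> ?V)"
    by (rule Ck_on_2_Un[OF U(1) V 1 c(1)])
  moreover have "U \<union> ?V = UNIV" using \<rho> by auto
  ultimately have "Ck_on 2 h UNIV" by simp
  moreover have "levi_quad h z w = 0" if "z \<notin> U" for z w
  proof -
    have "z \<in> ?V" using that \<rho> by auto
    then show ?thesis
      using c(3) by (simp add: levi_quad_def) (simp add: dir_deriv2_def dir_deriv_def)
  qed
  ultimately show ?thesis
    using that[OF \<psi>(1-3)] by (simp add: h_def)
qed

text \<open>At a zero of \<open>h\<close> the Hessian of \<open>h\<^sup>2\<close> is \<open>2 |\<partial>h(w)|\<^sup>2\<close>, which is nonnegative on all vectors. So the squares of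
local functions that vanish at the base points of the remaining pairs satisfy the hypotheses of
\<open>removable_dirs_extend\<close>.\<close>

lemma removable_if_transverse:
  fixes K :: "(complex^'n::finite) set"
  assumes K: "compact K" and U: "open U" "z0 \<in> U" and F: "Ck_on 2 F U"
    and S: "\<And>x. x \<in> unit_dirs K - removable_dirs K \<Longrightarrow> fst x \<in> U \<Longrightarrow> F (fst x) = 0"
    and x0: "(z0, w0) \<in> unit_dirs K"
    and nz: "dir_deriv F z0 w0 \<noteq> 0 \<or> dir_deriv F z0 (\<i> *s w0) \<noteq> 0"
  shows "(z0, w0) \<in> removable_dirs K"
proof (rule ccontr)
  assume not_rem: "(z0, w0) \<notin> removable_dirs K"
  then have F0: "F z0 = 0" using S[of "(z0, w0)"] x0 U by simp
  obtain \<psi> h where \<psi>: "Ck_on 2 \<psi> UNIV" "\<And>z. \<psi> z \<ge> 0" "\<psi> z0 > 0"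
    and h: "Ck_on 2 h UNIV" "\<And>z. z \<in> U \<Longrightarrow> h z = \<psi> z * F z" "\<And>z. z \<notin> U \<Longrightarrow> h z = 0"
    using localize_at[OF U F] by metis
  have l: "levi_quad (\<lambda>z. h z * h z) z w = ((dir_deriv h z w)\<^sup>2 + (dir_deriv h z (\<i> *s w))\<^sup>2) / 2"
    if "h z = 0" for z w
    using levi_quad_mult[OF open_UNIV h(1) h(1) UNIV_I, of z w] that by (simp add: power2_eq_square)
  have h0: "h (fst x) = 0" if "x \<in> unit_dirs K - removable_dirs K" for x
    using S[OF that] h(2,3) by (cases "fst x \<in> U") auto
  have \<psi>U: "Ck_on 2 \<psi> U" using Ck_on_2_subset[OF \<psi>(1)] by simp
  have dh: "dir_deriv h z0 v = \<psi> z0 * dir_deriv F z0 v" for v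
    using Ck_on_2_cong_open(2)[OF U(1) Ck_on_2_mult(1)[OF U(1) \<psi>U F] _ U(2), of h] h(2)
      Ck_on_2_mult(2)[OF U(1) \<psi>U F U(2), of v] F0 by simp
  have "(dir_deriv h z0 w0)\<^sup>2 + (dir_deriv h z0 (\<i> *s w0))\<^sup>2 > 0"
    using nz \<psi>(3) unfolding dh by (auto simp: sum_power2_gt_zero_iff)
  then have "levi_quad (\<lambda>z. h z * h z) z0 w0 > 0"
    using l[of z0 w0] h0[of "(z0, w0)"] x0 not_rem by simp
  then have "(z0, w0) \<in> removable_dirs K"
    by (intro removable_dirs_extend[OF K Ck_on_2_mult(1)[OF open_UNIV h(1) h(1)]])
      (simp_all add: h0 l x0)
  then show False using not_rem by blast
qed

section \<open>Levi null directions of a pseudoconvex boundary\<close>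

lemma complex_hessian_eq_0_iff:
  "complex_hessian f z a b = 0 \<longleftrightarrow> Re (complex_hessian f z a b) = 0 \<and> Re (complex_hessian f z a (\<i> *s b)) = 0"
  by (simp add: complex_hessian_rotate_right complex_eq_iff)

text \<open>For a nonnegative Hermitian form, a vector on which the quadratic form vanishes lies in the kernel: the
affine function \<open>t \<mapsto> H(v + t a, v + t a)\<close> is nonnegative, so its slope \<open>2 Re H(a, v)\<close> is zero. The imaginary
part is the real part for \<open>\<i> v\<close>.\<close>

lemma complex_hessian_kernel:
  fixes f :: "complex^'n::finite \<Rightarrow> real"
  assumes U: "open U" "Ck_on 2 f U" "z \<in> U"
    and V: "\<And>u v. u \<in> V \<Longrightarrow> v \<in> V \<Longrightarrow> u + v \<in> V" "\<And>c v. v \<in> V \<Longrightarrow> c *\<^sub>R v \<in> V" "\<And>v. v \<in> V \<Longrightarrow> \<i> *s v \<in> V"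
    and nn: "\<And>v. v \<in> V \<Longrightarrow> levi_quad f z v \<ge> 0"
    and a: "a \<in> V" "levi_quad f z a = 0" and b: "b \<in> V"
  shows "complex_hessian f z a b = 0"
proof -
  note l1 = dir_deriv2_linear_left[OF U(2,3)] and l2 = dir_deriv2_linear_right[OF U]
  define Q where "Q u v = (dir_deriv2 f z u v + dir_deriv2 f z (\<i> *s u) (\<i> *s v)) / 4" for u v
  have sym: "Q u v = Q v u" for u v
    unfolding Q_def using dir_deriv2_symmetric[OF U] by simp
  have "Q a v = 0" if v: "v \<in> V" for v
  proof -
    have ex: "levi_quad f z (v + t *\<^sub>R a) = levi_quad f z v + 2 * t * Q a v" for t
    proof -
      have "levi_quad f z (v + t *\<^sub>R a) = Q v v + t * Q v a + t * Q a v + t\<^sup>2 * Q a a"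
        unfolding levi_quad_def Q_def linear_add[OF i_scale_linear] linear_scale[OF i_scale_linear]
        unfolding linear_add[OF l1] linear_add[OF l2] linear_scale[OF l1] linear_scale[OF l2]
        by (simp add: field_simps power2_eq_square)
      moreover have "Q a a = 0" "Q v v = levi_quad f z v" using a(2) by (simp_all add: Q_def levi_quad_def)
      ultimately show ?thesis using sym[of v a] by simp
    qed
    have nn': "levi_quad f z v + 2 * t * Q a v \<ge> 0" for t
      unfolding ex[symmetric] by (intro nn V v a)
    show ?thesis
    proof (rule ccontr)
      assume "Q a v \<noteq> 0"
      define t where "t = - (levi_quad f z v + 1) / (2 * Q a v)"
      have "2 * t * Q a v = - (levi_quad f z v + 1)" using \<open>Q a v \<noteq> 0\<close> by (simp add: t_def)
      then show False using nn'[of t] by linarith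
    qed
  qed
  then have "Q a b = 0" "Q a (\<i> *s b) = 0" using b V(3) by blast+
  then show ?thesis
    unfolding complex_hessian_eq_0_iff Re_complex_hessian[OF U] Q_def by blast
qed

lemma local_defining_function_at:
  "local_defining_function \<Omega> p U r \<Longrightarrow> q \<in> frontier \<Omega> \<Longrightarrow> q \<in> U \<Longrightarrow> local_defining_function \<Omega> q U r"
  by (simp add: local_defining_function_def)

lemma local_defining_function_C2:
  "local_defining_function \<Omega> p U r \<Longrightarrow> Ck_on 2 r U"
  by (simp add: local_defining_function_def smooth_on_def)

lemma local_defining_function_zero:
  assumes \<Omega>: "open \<Omega>" and r: "local_defining_function \<Omega> p U r"
  shows "r p = 0"
proof (rule antisym)
  have p: "p \<in> frontier \<Omega>" "open U" "p \<in> U" and eq: "\<Omega> \<inter> U = {z\<in>U. r z < 0}"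
    using r by (auto simp: local_defining_function_def)
  have "p \<notin> \<Omega>" using p(1) \<Omega> by (simp add: frontier_def interior_open)
  then show "0 \<le> r p" using eq p(3) by force
  show "r p \<le> 0"
  proof (rule ccontr)
    assume "\<not> r p \<le> 0"
    have "continuous_on U r" by (rule Ck_on_2_continuous(1)[OF local_defining_function_C2[OF r]])
    then have "open (r -` {0<..} \<inter> U)"
      using continuous_on_open_vimage[OF p(2), of r] open_greaterThan by blast
    moreover have "r -` {0<..} \<inter> U = {z\<in>U. 0 < r z}" by auto
    ultimately have "open {z\<in>U. 0 < r z}" by simp
    moreover have "p \<in> {z\<in>U. 0 < r z}" using p \<open>\<not> r p \<le> 0\<close> by simp
    moreover have "p \<in> closure \<Omega>" using p(1) by (simp add: frontier_def)
    ultimately obtain y where "y \<in> \<Omega>" "y \<in> U" "0 < r y"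
      using open_Int_closure_eq_empty[of "{z\<in>U. 0 < r z}" \<Omega>] by blast
    then show False using eq by force
  qed
qed

lemma directional_sign:
  fixes f :: "'a::real_normed_vector \<Rightarrow> real"
  assumes "Ck_on 2 f U" "open U" "x \<in> U" "f x = 0" "dir_deriv f x v < 0"
  obtains d where "d > 0" "\<And>t. 0 < t \<Longrightarrow> t < d \<Longrightarrow> x + t *\<^sub>R v \<in> U \<and> f (x + t *\<^sub>R v) < 0"
proof -
  have f0: "(f has_derivative dir_deriv f x) (at (x + 0 *\<^sub>R v))"
    using has_derivative_dir_deriv(1)[OF assms(1,3)] by simp
  have line: "((\<lambda>t. x + t *\<^sub>R v) has_derivative (\<lambda>t. t *\<^sub>R v)) (at 0)"
    by (auto intro!: derivative_eq_intros)
  from has_derivative_compose[OF line f0]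
  have "((\<lambda>t. f (x + t *\<^sub>R v)) has_real_derivative dir_deriv f x v) (at 0)"
    using linear_scale[OF dir_deriv_linear[OF assms(1,3)]]
    by (simp add: has_field_derivative_def mult_commute_abs)
  from DERIV_neg_dec_right[OF this assms(5)] obtain d1 where d1: "d1 > 0"
    "\<And>t. 0 < t \<Longrightarrow> t < d1 \<Longrightarrow> f (x + t *\<^sub>R v) < 0" using assms(4) by auto
  have "continuous (at 0) (\<lambda>t. x + t *\<^sub>R v)" by (intro continuous_intros)
  then have "\<forall>\<^sub>F t in nhds 0. x + t *\<^sub>R v \<in> U"
    using assms(2,3) by (simp add: continuous_at_open eventually_nhds)
  then obtain d2 where d2: "d2 > 0" "\<And>t. dist t 0 < d2 \<Longrightarrow> x + t *\<^sub>R v \<in> U"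
    unfolding eventually_nhds_metric by blast
  show ?thesis
    by (rule that[of "min d1 d2"]) (use d1 d2 in auto)
qed

text \<open>The definition of \<open>tangent_space\<close> allows any defining function; this fixes one. If the kernels of the
differentials of two defining functions differed, some vector would point into the domain for one of them and
out of it for the other.\<close>

lemma tangent_space_iff:
  assumes \<Omega>: "open \<Omega>" and r: "local_defining_function \<Omega> p U r"
  shows "v \<in> tangent_space \<Omega> p \<longleftrightarrow> dir_deriv r p v = 0"
proof
  assume "dir_deriv r p v = 0"
  then show "v \<in> tangent_space \<Omega> p"
    using r unfolding tangent_space_def dir_deriv_def by blast
next
  have opposite: False
    if r1: "local_defining_function \<Omega> p U1 r1" and r2: "local_defining_function \<Omega> p U2 r2"
      and neg: "dir_deriv r1 p v < 0" and pos: "dir_deriv r2 p v > 0" for U1 r1 U2 r2 v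
  proof -
    have U: "open U1" "p \<in> U1" "open U2" "p \<in> U2"
      and eq: "\<Omega> \<inter> U1 = {z\<in>U1. r1 z < 0}" "\<Omega> \<inter> U2 = {z\<in>U2. r2 z < 0}"
      using r1 r2 by (auto simp: local_defining_function_def)
    note C = local_defining_function_C2[OF r1] local_defining_function_C2[OF r2]
    obtain d1 where d1: "d1 > 0" "\<And>t. 0 < t \<Longrightarrow> t < d1 \<Longrightarrow> p + t *\<^sub>R v \<in> U1 \<and> r1 (p + t *\<^sub>R v) < 0"
      using directional_sign[OF C(1) U(1,2) local_defining_function_zero[OF \<Omega> r1] neg] by metis
    define m2 where "m2 z = - 1 * r2 z" for z
    have "Ck_on 2 m2 U2" "dir_deriv m2 p v < 0" "m2 p = 0"
      using Ck_on_2_mult[OF U(3) Ck_on_2_const[OF U(3), of "-1"] C(2)] pos local_defining_function_zero[OF \<Omega> r2] U(4)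
      unfolding m2_def[abs_def] by (simp_all add: dir_deriv_def)
    then obtain d2 where d2: "d2 > 0" "\<And>t. 0 < t \<Longrightarrow> t < d2 \<Longrightarrow> p + t *\<^sub>R v \<in> U2 \<and> m2 (p + t *\<^sub>R v) < 0"
      using directional_sign[OF _ U(3,4)] by metis
    define t where "t = min d1 d2 / 2"
    have "0 < t" "t < d1" "t < d2" using d1 d2 by (auto simp: t_def)
    then have "p + t *\<^sub>R v \<in> \<Omega> \<inter> U1" "p + t *\<^sub>R v \<in> U2" "r2 (p + t *\<^sub>R v) > 0"
      using d1(2)[of t] d2(2)[of t] eq by (auto simp: m2_def)
    then show False using eq by force
  qed
  assume "v \<in> tangent_space \<Omega> p"
  then obtain U' r' where r': "local_defining_function \<Omega> p U' r'" and v: "dir_deriv r' p v = 0"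
    unfolding tangent_space_def dir_deriv_def by blast
  have p: "p \<in> U" "p \<in> U'" using r r' by (auto simp: local_defining_function_def)
  note lin = dir_deriv_linear[OF local_defining_function_C2[OF r] p(1)]
    and lin' = dir_deriv_linear[OF local_defining_function_C2[OF r'] p(2)]
  show "dir_deriv r p v = 0"
  proof (rule ccontr)
    assume nz: "dir_deriv r p v \<noteq> 0"
    have "frechet_derivative r' (at p) \<noteq> (\<lambda>_. 0)"
      using r' by (auto simp: local_defining_function_def)
    then obtain u where u: "dir_deriv r' p u \<noteq> 0"
      unfolding dir_deriv_def by (auto simp: fun_eq_iff)
    \<comment> \<open>subtracting a multiple of \<open>v\<close>, which does not change the derivative of \<open>r'\<close>, gives the two
      derivatives opposite values \<open>e\<close> and \<open>- e\<close>\<close>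
    define e where "e = dir_deriv r' p u"
    define c where "c = (e + dir_deriv r p u) / dir_deriv r p v"
    define w where "w = (if e < 0 then 1 else - 1) *\<^sub>R (u - c *\<^sub>R v)"
    have "dir_deriv r' p w = (if e < 0 then e else - e)"
      by (simp add: w_def e_def linear_diff[OF lin'] linear_scale[OF lin'] linear_neg[OF lin'] v)
    moreover have "dir_deriv r p w = (if e < 0 then - e else e)"
      using nz by (simp add: w_def c_def linear_diff[OF lin] linear_scale[OF lin] linear_neg[OF lin])
    ultimately have "dir_deriv r' p w < 0" "dir_deriv r p w > 0" using u by (auto simp: e_def)
    then show False using opposite[OF r' r] by blast
  qed
qed

lemma type10_alt: "type10 a = ((1/2) *\<^sub>R a, (- 1/2) *\<^sub>R (\<i> *s a))"
  by (simp add: type10_def vec_eq_iff complex_eq_iff)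

lemma tangent10_iff:
  assumes \<Omega>: "open \<Omega>" and r: "local_defining_function \<Omega> p U r"
  shows "a \<in> tangent10 \<Omega> p \<longleftrightarrow> dir_deriv r p a = 0 \<and> dir_deriv r p (\<i> *s a) = 0"
proof -
  have "p \<in> U" using r by (auto simp: local_defining_function_def)
  note lin = dir_deriv_linear[OF local_defining_function_C2[OF r] this]
  show ?thesis
    by (simp add: tangent10_def complexify_def type10_alt tangent_space_iff[OF assms] linear_scale[OF lin] del: scaleR_minus_left)
qed

text \<open>By \<open>removable_if_transverse\<close> for the defining function itself, the remaining vectors are of type
\<open>(1,0)\<close> and tangent. On those the Hessian of the localised defining function is a nonnegative multiple of the
Levi form, so \<open>removable_dirs_extend\<close> applies. A tangent vector outside the kernel of the Levi form has
positive Levi form by \<open>complex_hessian_kernel\<close>.\<close>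

lemma removable_if_not_levi_null:
  fixes \<Omega> :: "(complex^'n::finite) set"
  assumes \<Omega>: "open \<Omega>" "bounded \<Omega>" and psc: "levi_pseudoconvex \<Omega>"
    and r: "local_defining_function \<Omega> z0 U r"
    and x0: "(z0, w0) \<in> unit_dirs (frontier \<Omega>)" and nn: "type10 w0 \<notin> levi_null \<Omega> z0"
  shows "(z0, w0) \<in> removable_dirs (frontier \<Omega>)"
proof -
  let ?K = "frontier \<Omega>"
  have K: "compact ?K" using \<Omega>(2) by (simp add: compact_frontier_bounded)
  have U: "open U" "z0 \<in> U" using r by (auto simp: local_defining_function_def)
  note C = local_defining_function_C2[OF r]
  have rK: "r z = 0" if "z \<in> ?K" "z \<in> U" for z
    by (rule local_defining_function_zero[OF \<Omega>(1) local_defining_function_at[OF r that]])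
  have inK: "fst x \<in> ?K" if "x \<in> unit_dirs ?K - A" for x A using that by (auto simp: unit_dirs_def)
  have tang: "w \<in> tangent10 \<Omega> z" if "z \<in> U" "(z, w) \<in> unit_dirs ?K - removable_dirs ?K" for z w
  proof -
    have zK: "z \<in> ?K" using inK[OF that(2)] by simp
    have "(z, w) \<in> removable_dirs ?K" if nz: "dir_deriv r z w \<noteq> 0 \<or> dir_deriv r z (\<i> *s w) \<noteq> 0"
      by (rule removable_if_transverse[OF K U(1) \<open>z \<in> U\<close> C _ _ nz])
        (use inK rK \<open>(z, w) \<in> _\<close> in auto)
    then show ?thesis
      using that(2) tangent10_iff[OF \<Omega>(1) local_defining_function_at[OF r zK that(1)]] by blast
  qed
  have levi: "levi_quad r z w \<ge> 0" if "z \<in> U" "z \<in> ?K" "w \<in> tangent10 \<Omega> z" for z w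
  proof -
    have "Re (complex_hessian r z w w) \<ge> 0"
      using psc local_defining_function_at[OF r that(2,1)] that(3) unfolding levi_pseudoconvex_def by blast
    then show ?thesis by (simp add: levi_quad_def Re_complex_hessian[OF U(1) C that(1)])
  qed
  obtain \<psi> h where \<psi>: "Ck_on 2 \<psi> UNIV" "\<And>z. \<psi> z \<ge> 0" "\<psi> z0 > 0"
    and h: "Ck_on 2 h UNIV" "\<And>z. z \<in> U \<Longrightarrow> h z = \<psi> z * r z" "\<And>z. z \<notin> U \<Longrightarrow> h z = 0"
      "\<And>z w. z \<notin> U \<Longrightarrow> levi_quad h z w = 0"
    using localize_at[OF U C] by metis
  have \<psi>U: "Ck_on 2 \<psi> U" using Ck_on_2_subset[OF \<psi>(1)] by simp
  have lh: "levi_quad h z w = \<psi> z * levi_quad r z w" if "z \<in> U" "z \<in> ?K" "w \<in> tangent10 \<Omega> z" for z w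
  proof -
    have "levi_quad h z w = levi_quad (\<lambda>z. \<psi> z * r z) z w"
      by (rule levi_quad_cong_open[OF U(1) Ck_on_2_mult(1)[OF U(1) \<psi>U C] _ that(1)]) (simp add: h)
    then show ?thesis
      using levi_quad_mult[OF U(1) \<psi>U C that(1), of w] rK[OF that(2,1)]
        tangent10_iff[OF \<Omega>(1) local_defining_function_at[OF r that(2,1)]] that(3) by simp
  qed
  show ?thesis
  proof (rule ccontr)
    assume nr: "(z0, w0) \<notin> removable_dirs ?K"
    have z0: "z0 \<in> ?K" using x0 by (simp add: unit_dirs_def)
    have w0: "w0 \<in> tangent10 \<Omega> z0" using tang[OF U(2)] x0 nr by blast
    then obtain b where b: "b \<in> tangent10 \<Omega> z0" "complex_hessian r z0 w0 b \<noteq> 0"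
      using nn r unfolding levi_null_def by blast
    note lin = dir_deriv_linear[OF C U(2)]
    have ii: "\<i> *s (\<i> *s v) = - v" for v :: "complex^'n" by (simp add: vec_eq_iff)
    note ti = tangent10_iff[OF \<Omega>(1) r]
    have "levi_quad r z0 w0 \<noteq> 0"
    proof
      assume 0: "levi_quad r z0 w0 = 0"
      have "complex_hessian r z0 w0 b = 0"
      proof (rule complex_hessian_kernel[OF U(1) C U(2), where V = "tangent10 \<Omega> z0"])
        show "u + v \<in> tangent10 \<Omega> z0" if "u \<in> tangent10 \<Omega> z0" "v \<in> tangent10 \<Omega> z0" for u v
          using that unfolding ti linear_add[OF i_scale_linear] linear_add[OF lin] by simp
        show "c *\<^sub>R v \<in> tangent10 \<Omega> z0" if "v \<in> tangent10 \<Omega> z0" for c v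
          using that unfolding ti linear_scale[OF i_scale_linear] linear_scale[OF lin] by simp
        show "\<i> *s v \<in> tangent10 \<Omega> z0" if "v \<in> tangent10 \<Omega> z0" for v
          using that unfolding ti ii linear_neg[OF lin] by simp
      qed (use levi[OF U(2) z0] w0 b 0 in auto)
      then show False using b by blast
    qed
    then have "levi_quad r z0 w0 > 0" using levi[OF U(2) z0 w0] by simp
    then have pos: "levi_quad h z0 w0 > 0" using lh[OF U(2) z0 w0] \<psi>(3) by simp
    have "(z0, w0) \<in> removable_dirs ?K"
    proof (rule removable_dirs_extend[OF K h(1)])
      fix x assume x: "x \<in> unit_dirs ?K - removable_dirs ?K"
      show "h (fst x) = 0" using inK[OF x] rK h(2,3) by (cases "fst x \<in> U") auto
      show "levi_quad h (fst x) (snd x) \<ge> 0"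
      proof (cases "fst x \<in> U")
        case True
        then have "snd x \<in> tangent10 \<Omega> (fst x)" using tang[of "fst x" "snd x"] x by simp
        then show ?thesis using lh[OF True inK[OF x]] levi[OF True inK[OF x]] \<psi>(2) by simp
      next
        case False then show ?thesis using h(4) by simp
      qed
    qed (use x0 pos in auto)
    then show False using nr by blast
  qed
qed

section \<open>Derived distributions\<close>

lemma smooth_extension_C2: "smooth_extension_at M f p U F \<Longrightarrow> Ck_on 2 F U"
  by (simp add: smooth_extension_at_def smooth_on_def)

lemma type10_eq_0_iff: "type10 a = 0 \<longleftrightarrow> a = 0"
  by (auto simp: type10_def vec_eq_iff prod_eq_iff complex_eq_iff)

lemma dist_support_iff: "p \<in> dist_support \<Omega> D \<longleftrightarrow> p \<in> frontier \<Omega> \<and> (\<exists>x\<in>D p. x \<noteq> 0)"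
proof -
  have "dim (D p) > 0 \<longleftrightarrow> \<not> D p \<subseteq> {0}" by (metis dim_eq_0 gr0I less_irrefl)
  then show ?thesis unfolding dist_support_def by auto
qed

lemma levi_null_real_tangent:
  assumes "x \<in> levi_null \<Omega> p"
  obtains a where "x = type10 a" "p \<in> frontier \<Omega>" "fst x \<in> tangent_space \<Omega> p" "snd x \<in> tangent_space \<Omega> p"
proof -
  obtain a U r where "x = type10 a" "a \<in> tangent10 \<Omega> p" "local_defining_function \<Omega> p U r"
    using assms unfolding levi_null_def by blast
  then show ?thesis
    by (intro that[of a]) (auto simp: tangent10_def complexify_def mem_Times_iff local_defining_function_def)
qed

text \<open>One function witnesses that \<open>x\<close> leaves the distribution. It serves two purposes: it vanishes on the
support, so that its square removes \<open>x\<close>; and it excludes from the derived distribution all vectors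
near \<open>x\<close> as well, because it is a local extension at all nearby points of the boundary.\<close>

lemma not_in_derived_dist_witness:
  fixes \<Omega> :: "(complex^'n::finite) set"
  assumes N: "D p \<subseteq> levi_null \<Omega> p" and x: "x \<in> D p" "x \<notin> derived_dist \<Omega> D p"
  obtains U F where "open U" "p \<in> U" "Ck_on 2 F U"
    "dir_deriv F p (fst x) \<noteq> 0 \<or> dir_deriv F p (snd x) \<noteq> 0"
    "\<And>z. z \<in> U \<Longrightarrow> z \<in> dist_support \<Omega> D \<Longrightarrow> F z = 0"
    "\<And>q y. q \<in> U \<Longrightarrow> y \<in> derived_dist \<Omega> D q \<Longrightarrow> dir_deriv F q (fst y) = 0 \<and> dir_deriv F q (snd y) = 0"
proof -
  let ?S = "dist_support \<Omega> D" and ?K = "frontier \<Omega>"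
  have "fst x \<in> tangent_space \<Omega> p" "snd x \<in> tangent_space \<Omega> p"
    using levi_null_real_tangent N x(1) by blast+
  moreover have "fst x \<notin> zariski_tangent_space \<Omega> ?S p \<or> snd x \<notin> zariski_tangent_space \<Omega> ?S p"
    using x by (auto simp: derived_dist_def complexify_def mem_Times_iff)
  ultimately obtain f U F where f: "smooth_on_submanifold ?K f" "\<forall>z\<in>?S. f z = 0"
    and F: "smooth_extension_at ?K f p U F" and nz: "dir_deriv F p (fst x) \<noteq> 0 \<or> dir_deriv F p (snd x) \<noteq> 0"
    unfolding zariski_tangent_space_def dir_deriv_def by blast
  have U: "open U" "p \<in> U" and ext: "\<forall>z\<in>U \<inter> ?K. F z = f z"
    using F by (auto simp: smooth_extension_at_def)
  have SK: "?S \<subseteq> ?K" by (auto simp: dist_support_def)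
  have "dir_deriv F q v = 0" if "q \<in> U" "v \<in> zariski_tangent_space \<Omega> ?S q" for q v
  proof -
    have "smooth_extension_at ?K f q U F" using F that(1) by (simp add: smooth_extension_at_def)
    then show ?thesis using that(2) f unfolding zariski_tangent_space_def dir_deriv_def by blast
  qed
  then have "dir_deriv F q (fst y) = 0 \<and> dir_deriv F q (snd y) = 0" if "q \<in> U" "y \<in> derived_dist \<Omega> D q" for q y
    using that by (auto simp: derived_dist_def complexify_def mem_Times_iff)
  moreover have "F z = 0" if "z \<in> U" "z \<in> ?S" for z
    using that ext f(2) SK by auto
  ultimately show ?thesis
    using that[OF U smooth_extension_C2[OF F] nz] by blast
qed

section \<open>Transfinite iteration and stabilization\<close>

lemma iterated_dist_induct:
  assumes r: "Well_order r"
    and zero: "P D"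
    and succ: "\<And>j. P (iterated_dist r \<Omega> D j) \<Longrightarrow> P (derived_dist \<Omega> (iterated_dist r \<Omega> D j))"
    and lim: "\<And>J. J \<noteq> {} \<Longrightarrow> (\<And>j. j \<in> J \<Longrightarrow> P (iterated_dist r \<Omega> D j)) \<Longrightarrow>
      P (\<lambda>p. \<Inter>j\<in>J. iterated_dist r \<Omega> D j p)"
  shows "P (iterated_dist r \<Omega> D i)"
proof -
  have wo: "wo_rel r" using r by (simp add: wo_rel_def)
  show ?thesis
  proof (induction i rule: wo_rel.well_order_induct[OF wo])
    case (1 i)
    then have IH: "P (iterated_dist r \<Omega> D j)" if "j \<in> underS r i" for j
      using that by (auto simp: underS_def)
    show ?case
    proof (cases "underS r i = {}")
      case True
      then show ?thesis using zero by (simp add: iterated_dist_zero[OF r])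
    next
      case ne: False
      show ?thesis
      proof (cases "\<exists>j. immediate_pred r j i")
        case True
        then obtain j where j: "immediate_pred r j i" by blast
        then have "j \<in> underS r i" by (simp add: immediate_pred_def)
        then show ?thesis unfolding iterated_dist_succ[OF r j] by (intro succ IH)
      next
        case False
        then have "iterated_dist r \<Omega> D i = (\<lambda>p. \<Inter>j\<in>underS r i. iterated_dist r \<Omega> D j p)"
          by (intro ext iterated_dist_limit[OF r ne]) blast
        then show ?thesis using lim[OF ne IH] by simp
      qed
    qed
  qed
qed

text \<open>If \<open>i\<close> is not the immediate predecessor of \<open>j\<close>, some stage lies strictly between them and the induction
hypothesis applies to it.\<close>

lemma iterated_dist_subset_derived:
  assumes r: "Well_order r" and ij: "(i, j) \<in> r" "i \<noteq> j"
  shows "iterated_dist r \<Omega> D j p \<subseteq> derived_dist \<Omega> (iterated_dist r \<Omega> D i) p"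
proof -
  let ?N = "iterated_dist r \<Omega> D"
  have wo: "wo_rel r" using r by (simp add: wo_rel_def)
  show ?thesis
    using ij
  proof (induction j rule: wo_rel.well_order_induct[OF wo])
    case (1 j)
    have i: "i \<in> underS r j" using 1 by (auto simp: underS_def)
    show ?case
    proof (cases "\<exists>k. immediate_pred r k j")
      case True
      then obtain k where k: "immediate_pred r k j" by blast
      have eq: "?N j = derived_dist \<Omega> (?N k)" by (rule iterated_dist_succ[OF r k])
      show ?thesis
      proof (cases "k = i")
        case False
        have "(i, k) \<in> r" "k \<noteq> j" "(k, j) \<in> r" using k i by (auto simp: immediate_pred_def underS_def)
        then have "?N k p \<subseteq> derived_dist \<Omega> (?N i) p" using 1 False by auto
        then show ?thesis unfolding eq by (auto simp: derived_dist_def)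
      qed (simp add: eq)
    next
      case False
      then obtain k where k: "k \<in> underS r j" "(k, i) \<notin> r" using i by (auto simp: immediate_pred_def)
      have "i \<in> Field r" "k \<in> Field r" using i k by (auto simp: underS_def Field_def)
      then have "(i, k) \<in> r" "i \<noteq> k" using k(2) wo_rel.TOTALS[OF wo] wo_rel.REFL[OF wo]
        by (auto simp: refl_on_def)
      then have "?N k p \<subseteq> derived_dist \<Omega> (?N i) p" using 1 k by (auto simp: underS_def)
      moreover have "?N j p = (\<Inter>j\<in>underS r j. ?N j p)"
        using i False by (intro iterated_dist_limit[OF r]) auto
      ultimately show ?thesis using k(1) by auto
    qed
  qed
qed

lemma iterated_dist_mono:
  assumes "Well_order r" "(i, j) \<in> r"
  shows "iterated_dist r \<Omega> D j p \<subseteq> iterated_dist r \<Omega> D i p"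
  using iterated_dist_subset_derived[OF assms, of \<Omega> D p] by (cases "i = j") (auto simp: derived_dist_def)

lemma iterated_dist_stable:
  assumes r: "Well_order r" and stat: "derived_dist \<Omega> (iterated_dist r \<Omega> D i) = iterated_dist r \<Omega> D i"
    and ij: "(i, j) \<in> r"
  shows "iterated_dist r \<Omega> D j = iterated_dist r \<Omega> D i"
proof -
  let ?N = "iterated_dist r \<Omega> D"
  have wo: "wo_rel r" using r by (simp add: wo_rel_def)
  show ?thesis
    using ij
  proof (induction j rule: wo_rel.well_order_induct[OF wo])
    case (1 j)
    show ?case
    proof (cases "i = j")
      case ne: False
      then have i: "i \<in> underS r j" using 1 by (auto simp: underS_def)
      show ?thesis
      proof (cases "\<exists>k. immediate_pred r k j")
        case True
        then obtain k where k: "immediate_pred r k j" by blast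
        then have "(i, k) \<in> r" "k \<noteq> j" "(k, j) \<in> r" using i by (auto simp: immediate_pred_def underS_def)
        then have "?N k = ?N i" using 1 by blast
        then show ?thesis by (simp add: iterated_dist_succ[OF r k] stat)
      next
        case False
        have "?N j p = ?N i p" for p
        proof
          show "?N j p \<subseteq> ?N i p" by (rule iterated_dist_mono[OF r 1(2)])
          have "?N i p \<subseteq> ?N k p" if k: "k \<in> underS r j" for k
          proof (cases "(k, i) \<in> r")
            case True then show ?thesis by (rule iterated_dist_mono[OF r])
          next
            case False
            have "i \<in> Field r" "k \<in> Field r" using i k by (auto simp: underS_def Field_def)
            then have "(i, k) \<in> r" using False wo_rel.TOTALS[OF wo] by blast
            then have "?N k = ?N i" using 1 k by (auto simp: underS_def)
            then show ?thesis by simp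
          qed
          then show "?N i p \<subseteq> ?N j p"
            using i False by (subst iterated_dist_limit[OF r]) auto
        qed
        then show ?thesis by (rule ext)
      qed
    qed simp
  qed
qed

lemma Well_order_omega1: "Well_order omega1"
  using cardSuc_Card_order[OF natLeq_Card_order] card_order_on_well_order_on by blast

lemma uncountable_Field_omega1:
  includes cardinal_syntax
  shows "\<not> countable (Field omega1)"
proof
  assume "countable (Field omega1)"
  then obtain f :: "nat set \<Rightarrow> nat" where "inj_on f (Field omega1)" by (auto simp: countable_def)
  then have "|Field omega1| \<le>o |UNIV :: nat set|"
    using card_of_ordLeqI[of f "Field omega1" UNIV] by auto
  moreover have "|UNIV :: nat set| =o natLeq"
    using card_of_Field_ordIso[OF natLeq_Card_order] by (simp add: Field_natLeq)
  moreover have "|Field omega1| =o omega1"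
    by (rule card_of_Field_ordIso[OF cardSuc_Card_order[OF natLeq_Card_order]])
  ultimately have "omega1 \<le>o natLeq"
    by (meson ordIso_ordLeq_trans ordIso_symmetric ordLeq_ordIso_trans)
  then show False
    using cardSuc_greater[OF natLeq_Card_order] not_ordLess_ordLeq by blast
qed

text \<open>Choosing a basic open set between \<open>x i\<close> and \<open>V i\<close> is injective in \<open>i\<close>.\<close>

lemma countable_if_separated_chain:
  fixes x :: "'i \<Rightarrow> 'a::second_countable_topology"
  assumes V: "\<And>i. i \<in> I \<Longrightarrow> open (V i) \<and> x i \<in> V i"
    and sep: "\<And>i j. i \<in> I \<Longrightarrow> j \<in> I \<Longrightarrow> i \<noteq> j \<Longrightarrow> x j \<notin> V i \<or> x i \<notin> V j"
  shows "countable I"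
proof -
  obtain \<B> :: "'a set set" where \<B>: "countable \<B>" "topological_basis \<B>"
    using ex_countable_basis by blast
  have "\<exists>B. B \<in> \<B> \<and> x i \<in> B \<and> B \<subseteq> V i" if i: "i \<in> I" for i
  proof -
    have "open (V i)" "x i \<in> V i" using V[OF i] by auto
    from topological_basisE[OF \<B>(2) this] show ?thesis by blast
  qed
  then obtain B where B: "\<And>i. i \<in> I \<Longrightarrow> B i \<in> \<B> \<and> x i \<in> B i \<and> B i \<subseteq> V i"
    by metis
  have "inj_on B I"
  proof (rule inj_onI, rule ccontr)
    fix i j assume "i \<in> I" "j \<in> I" "B i = B j" "i \<noteq> j"
    then show False using sep[of i j] B[of i] B[of j] by blast
  qed
  moreover have "B ` I \<subseteq> \<B>" using B by blast
  ultimately show ?thesis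
    using \<B>(1) countable_image_inj_on countable_subset by blast
qed

lemma iterated_dist_subset: "Well_order r \<Longrightarrow> iterated_dist r \<Omega> D i p \<subseteq> D p"
  by (rule iterated_dist_induct[where P = "\<lambda>N. N p \<subseteq> D p"]) (auto simp: derived_dist_def)

text \<open>Suppose that no countable stage is a fixed point of the derivation. Every stage \<open>i\<close> then contains a
vector that is missing, together with an open neighbourhood \<open>V i\<close>, from the next stage, and hence from
all later ones. The vectors chosen at later stages are thus outside \<open>V i\<close>, so \<open>countable_if_separated_chain\<close>
would make the set of countable ordinals countable.\<close>

lemma levi_core_eq_iterated:
  fixes \<Omega> :: "(complex^'n::finite) set"
  obtains \<gamma> where "levi_core \<Omega> = iterated_dist omega1 \<Omega> (levi_null \<Omega>) \<gamma>"
proof -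
  let ?N = "iterated_dist omega1 \<Omega> (levi_null \<Omega>)"
  note r = Well_order_omega1
  have wo: "wo_rel omega1" using r by (simp add: wo_rel_def)
  have "\<exists>i\<in>Field omega1. derived_dist \<Omega> (?N i) = ?N i"
  proof (rule ccontr)
    assume neg: "\<not> ?thesis"
    have "\<exists>y V. snd y \<in> ?N i (fst y) \<and> open V \<and> y \<in> V \<and> (\<forall>u\<in>V. snd u \<notin> derived_dist \<Omega> (?N i) (fst u))"
      if i: "i \<in> Field omega1" for i
    proof -
      have "derived_dist \<Omega> (?N i) \<noteq> ?N i" using neg i by blast
      then obtain p x where x: "x \<in> ?N i p" "x \<notin> derived_dist \<Omega> (?N i) p"
        by (auto simp: fun_eq_iff derived_dist_def)
      obtain U F where U: "open U" "p \<in> U" "Ck_on 2 F U"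
        and nz: "dir_deriv F p (fst x) \<noteq> 0 \<or> dir_deriv F p (snd x) \<noteq> 0"
        and z: "\<And>q y. q \<in> U \<Longrightarrow> y \<in> derived_dist \<Omega> (?N i) q \<Longrightarrow> dir_deriv F q (fst y) = 0 \<and> dir_deriv F q (snd y) = 0"
        using not_in_derived_dist_witness[OF iterated_dist_subset[OF r] x] by metis
      define V where "V = {u \<in> U \<times> UNIV. dir_deriv F (fst u) (fst (snd u)) \<noteq> 0} \<union>
        {u \<in> U \<times> UNIV. dir_deriv F (fst u) (snd (snd u)) \<noteq> 0}"
      have c: "continuous_on (U \<times> UNIV) (\<lambda>u. dir_deriv F (fst u) (snd u))"
        using continuous_on_dir_deriv[OF U(3)] by (simp add: case_prod_beta)
      have o: "open {u \<in> U \<times> UNIV. dir_deriv F (fst u) (g (snd u)) \<noteq> 0}"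
        if g: "continuous_on UNIV g" for g :: "(complex^'n) \<times> (complex^'n) \<Rightarrow> complex^'n"
      proof -
        have "continuous_on (U \<times> UNIV) (\<lambda>u. dir_deriv F (fst (fst u, g (snd u))) (snd (fst u, g (snd u))))"
          by (rule continuous_on_compose2[OF c, of _ "\<lambda>u. (fst u, g (snd u))"])
            (auto intro!: continuous_intros continuous_on_compose2[OF g])
        then have c': "continuous_on (U \<times> UNIV) (\<lambda>u. dir_deriv F (fst u) (g (snd u)))"
          by simp
        have "open (- {0::real})" by auto
        with c' have "open ((\<lambda>u. dir_deriv F (fst u) (g (snd u))) -` (- {0}) \<inter> (U \<times> UNIV))"
          unfolding continuous_on_open_vimage[OF open_Times[OF U(1) open_UNIV]] by blast
        then show ?thesis by (rule back_subst[of "open"]) auto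
      qed
      have "open V" unfolding V_def
        by (intro open_Un o continuous_on_fst continuous_on_snd continuous_on_id)
      moreover have "(p, x) \<in> V" using nz U(2) by (auto simp: V_def)
      moreover have "\<forall>u\<in>V. snd u \<notin> derived_dist \<Omega> (?N i) (fst u)"
        using z by (fastforce simp: V_def)
      ultimately show ?thesis using x(1) by (intro exI[of _ "(p, x)"] exI[of _ V]) simp
    qed
    then obtain y V where yV: "\<And>i. i \<in> Field omega1 \<Longrightarrow> snd (y i) \<in> ?N i (fst (y i))"
      "\<And>i. i \<in> Field omega1 \<Longrightarrow> open (V i) \<and> y i \<in> V i"
      "\<And>i u. i \<in> Field omega1 \<Longrightarrow> u \<in> V i \<Longrightarrow> snd u \<notin> derived_dist \<Omega> (?N i) (fst u)"
      by metis
    have later: "y j \<notin> V i" if "i \<in> Field omega1" "j \<in> Field omega1" "(i, j) \<in> omega1" "i \<noteq> j" for i j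
      using yV(3)[OF that(1)] yV(1)[OF that(2)] iterated_dist_subset_derived[OF r that(3,4)] by blast
    have "countable (Field omega1)"
    proof (rule countable_if_separated_chain[of _ V y])
      fix i j assume ij: "i \<in> Field omega1" "j \<in> Field omega1" "i \<noteq> j"
      then have "(i, j) \<in> omega1 \<or> (j, i) \<in> omega1" using wo_rel.TOTALS[OF wo] by blast
      then show "y j \<notin> V i \<or> y i \<notin> V j" using later ij by blast
    qed (rule yV(2))
    then show False using uncountable_Field_omega1 by blast
  qed
  then obtain \<gamma> where g: "\<gamma> \<in> Field omega1" "derived_dist \<Omega> (?N \<gamma>) = ?N \<gamma>" by blast
  have "levi_core \<Omega> = ?N \<gamma>"
    unfolding levi_core_def by (rule dist_core_eqI[OF g(1) iterated_dist_stable[OF r g(2)]])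
  then show ?thesis using that by blast
qed

section \<open>Removability outside the Levi core\<close>

lemma compact_unremovable:
  assumes "compact K"
  shows "compact (unit_dirs K - removable_dirs K)"
proof -
  have "unit_dirs K - removable_dirs K = unit_dirs K - \<Union>{V. open V \<and> removable K (V \<inter> unit_dirs K)}"
    by (auto simp: removable_dirs_def)
  moreover have "open (\<Union>{V. open V \<and> removable K (V \<inter> unit_dirs K)})" by auto
  ultimately show ?thesis using compact_diff[OF compact_unit_dirs[OF assms]] by simp
qed

definition outside_removable :: "(complex^'n::finite) set \<Rightarrow> 'n distribution \<Rightarrow> bool" where
  "outside_removable \<Omega> D \<longleftrightarrow>
     (\<forall>x\<in>unit_dirs (frontier \<Omega>). type10 (snd x) \<notin> D (fst x) \<longrightarrow> x \<in> removable_dirs (frontier \<Omega>))"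

lemma unremovable_in_support:
  assumes "outside_removable \<Omega> D" "x \<in> unit_dirs (frontier \<Omega>) - removable_dirs (frontier \<Omega>)"
  shows "fst x \<in> dist_support \<Omega> D"
proof -
  have "type10 (snd x) \<in> D (fst x)" using assms by (auto simp: outside_removable_def)
  moreover have "snd x \<noteq> 0" "fst x \<in> frontier \<Omega>" using assms(2) by (auto simp: unit_dirs_def)
  ultimately show ?thesis unfolding dist_support_iff using type10_eq_0_iff by blast
qed

text \<open>The base points of the remaining pairs lie in the support of \<open>D\<close>, where the functions that define its
Zariski tangent space vanish. So a vector that is not in the complexified Zariski tangent space is
transverse to such a function.\<close>

lemma outside_removable_derived:
  fixes \<Omega> :: "(complex^'n::finite) set"
  assumes \<Omega>: "bounded \<Omega>" and N: "\<And>p. D p \<subseteq> levi_null \<Omega> p" and D: "outside_removable \<Omega> D"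
  shows "outside_removable \<Omega> (derived_dist \<Omega> D)"
  unfolding outside_removable_def
proof (intro ballI impI)
  let ?K = "frontier \<Omega>"
  have K: "compact ?K" using \<Omega> by (simp add: compact_frontier_bounded)
  fix x assume x: "x \<in> unit_dirs ?K" "type10 (snd x) \<notin> derived_dist \<Omega> D (fst x)"
  show "x \<in> removable_dirs ?K"
  proof (cases "type10 (snd x) \<in> D (fst x)")
    case False then show ?thesis using D x by (auto simp: outside_removable_def)
  next
    case True
    obtain U F where U: "open U" "fst x \<in> U" "Ck_on 2 F U"
      and nz: "dir_deriv F (fst x) (fst (type10 (snd x))) \<noteq> 0 \<or> dir_deriv F (fst x) (snd (type10 (snd x))) \<noteq> 0"
      and z: "\<And>z. z \<in> U \<Longrightarrow> z \<in> dist_support \<Omega> D \<Longrightarrow> F z = 0"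
      using not_in_derived_dist_witness[OF N True x(2)] by metis
    note lin = dir_deriv_linear[OF U(3,2)]
    have "dir_deriv F (fst x) (snd x) \<noteq> 0 \<or> dir_deriv F (fst x) (\<i> *s snd x) \<noteq> 0"
      using nz unfolding type10_alt fst_conv snd_conv linear_scale[OF lin] by auto
    then have "(fst x, snd x) \<in> removable_dirs ?K"
      using x(1) by (intro removable_if_transverse[OF K U]) (auto intro: z unremovable_in_support[OF D])
    then show ?thesis by simp
  qed
qed

theorem corollary2:
  fixes \<Omega> :: "(complex^'n::finite) set"
  assumes "smooth_bounded_domain \<Omega>"
    and "levi_pseudoconvex \<Omega>"
    and "hausdorff_measure 2 (dist_support \<Omega> (levi_core \<Omega>)) = 0"
  shows "property_P (frontier \<Omega>)"
proof -
  let ?K = "frontier \<Omega>"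
  have \<Omega>: "open \<Omega>" "bounded \<Omega>" and ldf: "\<And>p. p \<in> ?K \<Longrightarrow> \<exists>U r. local_defining_function \<Omega> p U r"
    using assms(1) by (auto simp: smooth_bounded_domain_def)
  have K: "compact ?K" using \<Omega>(2) by (simp add: compact_frontier_bounded)
  obtain \<gamma> where \<gamma>: "levi_core \<Omega> = iterated_dist omega1 \<Omega> (levi_null \<Omega>) \<gamma>"
    using levi_core_eq_iterated by blast
  have "(\<forall>p. levi_core \<Omega> p \<subseteq> levi_null \<Omega> p) \<and> outside_removable \<Omega> (levi_core \<Omega>)"
    unfolding \<gamma>
  proof (rule iterated_dist_induct[OF Well_order_omega1, where P = "\<lambda>D. (\<forall>p. D p \<subseteq> levi_null \<Omega> p) \<and> outside_removable \<Omega> D"])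
    have "outside_removable \<Omega> (levi_null \<Omega>)"
      unfolding outside_removable_def
    proof (intro ballI impI)
      fix x assume x: "x \<in> unit_dirs ?K" "type10 (snd x) \<notin> levi_null \<Omega> (fst x)"
      then obtain U r where "local_defining_function \<Omega> (fst x) U r"
        using ldf[of "fst x"] by (auto simp: unit_dirs_def)
      from removable_if_not_levi_null[OF \<Omega> assms(2) this, of "snd x"] x
      show "x \<in> removable_dirs ?K" by simp
    qed
    then show "(\<forall>p. levi_null \<Omega> p \<subseteq> levi_null \<Omega> p) \<and> outside_removable \<Omega> (levi_null \<Omega>)" by simp
  next
    fix j let ?D = "iterated_dist omega1 \<Omega> (levi_null \<Omega>) j"
    assume "(\<forall>p. ?D p \<subseteq> levi_null \<Omega> p) \<and> outside_removable \<Omega> ?D"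
    then show "(\<forall>p. derived_dist \<Omega> ?D p \<subseteq> levi_null \<Omega> p) \<and> outside_removable \<Omega> (derived_dist \<Omega> ?D)"
      using outside_removable_derived[OF \<Omega>(2), of ?D] by (auto simp: derived_dist_def)
  next
    fix J :: "nat set set"
    assume "J \<noteq> {}" and IH: "\<And>j. j \<in> J \<Longrightarrow> (\<forall>p. iterated_dist omega1 \<Omega> (levi_null \<Omega>) j p \<subseteq> levi_null \<Omega> p) \<and>
      outside_removable \<Omega> (iterated_dist omega1 \<Omega> (levi_null \<Omega>) j)"
    then show "(\<forall>p. (\<Inter>j\<in>J. iterated_dist omega1 \<Omega> (levi_null \<Omega>) j p) \<subseteq> levi_null \<Omega> p) \<and>
      outside_removable \<Omega> (\<lambda>p. \<Inter>j\<in>J. iterated_dist omega1 \<Omega> (levi_null \<Omega>) j p)"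
      unfolding outside_removable_def by blast
  qed
  then have out: "outside_removable \<Omega> (levi_core \<Omega>)" by simp
  let ?R = "unit_dirs ?K - removable_dirs ?K"
  have S: "compact (fst ` ?R)"
    by (intro compact_continuous_image continuous_on_fst continuous_on_id compact_unremovable K)
  have SA: "fst ` ?R \<subseteq> dist_support \<Omega> (levi_core \<Omega>)"
    using unremovable_in_support[OF out] by blast
  show ?thesis
  proof (rule property_P_if_rest_tested[OF K])
    fix \<epsilon> :: real assume "\<epsilon> > 0"
    then obtain g where g: "Ck_on 2 g UNIV" "\<forall>z\<in>?K. \<bar>g z\<bar> \<le> \<epsilon>" "\<forall>z w. levi_quad g z w \<ge> 0"
      "\<forall>z\<in>fst ` ?R. \<forall>w. levi_quad g z w \<ge> (norm w)\<^sup>2"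
      using small_psh_test_on_null_set[OF S SA assms(3) compact_imp_bounded[OF K]] by blast
    have "levi_quad g (fst x) (snd x) \<ge> 1" if "x \<in> ?R" for x
    proof -
      have "norm (snd x) = 1" using that by (auto simp: unit_dirs_def)
      moreover have "(norm (snd x))\<^sup>2 \<le> levi_quad g (fst x) (snd x)" using g(4) that by blast
      ultimately show ?thesis by simp
    qed
    then show "\<exists>g. Ck_on 2 g UNIV \<and> (\<forall>z\<in>?K. \<bar>g z\<bar> \<le> \<epsilon>) \<and> (\<forall>z w. levi_quad g z w \<ge> 0) \<and>
        (\<forall>x\<in>?R. levi_quad g (fst x) (snd x) \<ge> 1)"
      using g by blast
  qed
qed

end
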